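(* Let $(X,\Pi)$ be a $d$-dimensional weighted pure simplicial complex which is a two-sided $\gamma$-local-spectral expander with $\gamma\le 2^{-\Omega(k)}$, where $k\le d$, and let $f\in C_k$ be boolean ($\{0,1\}$-valued). For any $0\le K\le k$, if $I[f]\le K\,\mathrm{Var}(f)$, then there exist $i\le K$ and $\tau\in X(i)$ such that \[ \mathbb{E}_{X_\tau}[f]\ge 2^{-O(K)}. \]
   Context: A $d$-dimensional pure simplicial complex $X$ on $[n]$: a nonempty $X(d)\subseteq\binom{[n]}{d}$ with downward closure $X(i)=\{s\in\binom{[n]}{i}:\exists t\in X(d),s\subseteq t\}$ (an $i$-face has $i$ elements). Weighted: distribution $\pi_d=\Pi$ on $X(d)$, $\pi_i(x)=\frac{1}{i+1}\sum_{y\in X(i+1),y\supset x}\pi_{i+1}(y)$. $C_i$: functions on $X(i)$, $\langle f,g\rangle=\mathbb{E}_{\pi_i}[fg]$, $\mathbb{E}[f]=\mathbb{E}_{\pi_i}[f]$, $\mathrm{Var}(f)=\mathbb{E}[f^2]-\mathbb{E}[f]^2$. Link $X_s=\{t\setminus s:t\in X,t\supseteq s\}$ weighted proportionally to $\Pi(t)$. $U_{k-1}:C_{k-1}\to C_k$, $U_{k-1}f(\tau)=\frac1k\sum_{\sigma\in X(k-1),\sigma\subset\tau}f(\sigma)$; $D_k:C_k\to C_{k-1}$, $D_kf(\tau)$ is the $\pi_k$-weighted average of $f$ over $k$-faces containing $\tau$. Total influence: $I[f]=\langle f,k(I-U_{k-1}D_k)f\rangle$. For $\tau\in X(i)$,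 $\mathbb{E}_{X_\tau}[f]$ is the $\pi_k$-weighted average of $f$ over $k$-faces containing $\tau$. Two-sided $\gamma$-local-spectral expander: for all $0\le i\le d-2$, $s\in X(i)$, the weighted graph $(X_s(1),X_s(2))$ (weighted by the link's level-2 distribution) has all nontrivial random-walk eigenvalues of absolute value at most $\gamma$. $O(\cdot),\Omega(\cdot)$ hide absolute constants.
   Formalization: The function f is assumed not to vanish (its mean is nonzero), since for f = 0 we have I[f] = Var(f) = 0 and the conclusion fails; K is taken to be an integer, as it bounds the face sizes. *)

theory Defs
  imports Complex_Main
begin

text \<open>
  A \<open>d\<close>-dimensional pure simplicial complex is represented by its set \<open>X\<close> of top faces
  \<open>X(d)\<close>, and a weighted one by \<open>d\<close>, \<open>X\<close> and the weight \<open>P\<close> of the top faces.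
  An \<open>i\<close>-face has \<open>i\<close> elements, so \<open>X(0)\<close> contains only the empty set.
\<close>

definition pure_complex :: "nat \<Rightarrow> nat \<Rightarrow> nat set set \<Rightarrow> bool" where
  "pure_complex n d X \<longleftrightarrow> X \<noteq> {} \<and> (\<forall>t\<in>X. t \<subseteq> {1..n} \<and> card t = d)"

definition faces :: "'a set set \<Rightarrow> nat \<Rightarrow> 'a set set" where
  "faces X i = {s. finite s \<and> card s = i \<and> (\<exists>t\<in>X. s \<subseteq> t)}"

definition distribution_on :: "'b set \<Rightarrow> ('b \<Rightarrow> real) \<Rightarrow> bool" where
  "distribution_on X P \<longleftrightarrow> (\<forall>t\<in>X. 0 \<le> P t) \<and> sum P X = 1"

definition weighted_complex :: "nat \<Rightarrow> nat \<Rightarrow> nat set set \<Rightarrow> (nat set \<Rightarrow> real) \<Rightarrow> bool" where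
  "weighted_complex n d X P \<longleftrightarrow> pure_complex n d X \<and> distribution_on X P"

text \<open>The induced distribution on \<open>X(i)\<close>; only meaningful for \<open>i \<le> d\<close>.\<close>

function level_wt ::
    "nat \<Rightarrow> 'a set set \<Rightarrow> ('a set \<Rightarrow> real) \<Rightarrow> nat \<Rightarrow> 'a set \<Rightarrow> real" where
  "level_wt d X P i x =
     (if d \<le> i then P x
      else (1 / real (i + 1)) * (\<Sum>y | y \<in> faces X (i + 1) \<and> x \<subset> y. level_wt d X P (i + 1) y))"
  by pat_completeness auto
termination
  by (relation "measure (\<lambda>(d, X, P, i, x). d - i)") auto

declare level_wt.simps [simp del]

definition inner_lvl ::
    "nat \<Rightarrow> 'a set set \<Rightarrow> ('a set \<Rightarrow> real) \<Rightarrow> nat \<Rightarrow> ('a set \<Rightarrow> real) \<Rightarrow> ('a set \<Rightarrow> real) \<Rightarrow> real" where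
  "inner_lvl d X P i f g = (\<Sum>x\<in>faces X i. level_wt d X P i x * (f x * g x))"

definition mean ::
    "nat \<Rightarrow> 'a set set \<Rightarrow> ('a set \<Rightarrow> real) \<Rightarrow> nat \<Rightarrow> ('a set \<Rightarrow> real) \<Rightarrow> real" where
  "mean d X P i f = (\<Sum>x\<in>faces X i. level_wt d X P i x * f x)"

definition var ::
    "nat \<Rightarrow> 'a set set \<Rightarrow> ('a set \<Rightarrow> real) \<Rightarrow> nat \<Rightarrow> ('a set \<Rightarrow> real) \<Rightarrow> real" where
  "var d X P i f = mean d X P i (\<lambda>x. (f x)\<^sup>2) - (mean d X P i f)\<^sup>2"

text \<open>
  The weighted average of \<open>f\<close> over the \<open>k\<close>-faces containing \<open>\<tau>\<close>. It is \<open>0\<close> by the convention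
  \<open>0 / 0 = 0\<close> if \<open>\<tau>\<close> has weight \<open>0\<close>.
\<close>

definition link_mean ::
    "nat \<Rightarrow> 'a set set \<Rightarrow> ('a set \<Rightarrow> real) \<Rightarrow> nat \<Rightarrow> ('a set \<Rightarrow> real) \<Rightarrow> 'a set \<Rightarrow> real" where
  "link_mean d X P k f \<tau> =
     (\<Sum>\<sigma> | \<sigma> \<in> faces X k \<and> \<tau> \<subseteq> \<sigma>. level_wt d X P k \<sigma> * f \<sigma>) /
     (\<Sum>\<sigma> | \<sigma> \<in> faces X k \<and> \<tau> \<subseteq> \<sigma>. level_wt d X P k \<sigma>)"

definition up_op :: "'a set set \<Rightarrow> nat \<Rightarrow> ('a set \<Rightarrow> real) \<Rightarrow> 'a set \<Rightarrow> real" where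
  "up_op X i f \<tau> = (1 / real (i + 1)) * (\<Sum>\<sigma> | \<sigma> \<in> faces X i \<and> \<sigma> \<subset> \<tau>. f \<sigma>)"

definition down_op ::
    "nat \<Rightarrow> 'a set set \<Rightarrow> ('a set \<Rightarrow> real) \<Rightarrow> nat \<Rightarrow> ('a set \<Rightarrow> real) \<Rightarrow> 'a set \<Rightarrow> real" where
  "down_op d X P k f \<tau> = link_mean d X P k f \<tau>"

text \<open>For \<open>k = 0\<close> the truncated subtraction is harmless: the factor \<open>k\<close> makes the value \<open>0\<close>.\<close>

definition total_influence ::
    "nat \<Rightarrow> 'a set set \<Rightarrow> ('a set \<Rightarrow> real) \<Rightarrow> nat \<Rightarrow> ('a set \<Rightarrow> real) \<Rightarrow> real" where
  "total_influence d X P k f =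
     inner_lvl d X P k f
       (\<lambda>\<sigma>. real k * (f \<sigma> - up_op X (k - 1) (down_op d X P k f) \<sigma>))"

text \<open>
  The link of \<open>s\<close> is the weighted complex of dimension \<open>d - card s\<close> with top faces \<open>link X s\<close>
  and weights \<open>link_wt X P s\<close>.
\<close>

definition link :: "'a set set \<Rightarrow> 'a set \<Rightarrow> 'a set set" where
  "link X s = {t - s | t. t \<in> X \<and> s \<subseteq> t}"

definition link_wt :: "'a set set \<Rightarrow> ('a set \<Rightarrow> real) \<Rightarrow> 'a set \<Rightarrow> 'a set \<Rightarrow> real" where
  "link_wt X P s t = P (t \<union> s) / (\<Sum>t' | t' \<in> X \<and> s \<subseteq> t'. P t')"

text \<open>
  The random walk on the weighted graph \<open>(X(1), X(2))\<close>: from \<open>v\<close> move to a neighbour \<open>u\<close> with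
  probability proportional to the weight of the edge \<open>{v, u}\<close>.
\<close>

definition nbrs :: "'a set set \<Rightarrow> 'a \<Rightarrow> 'a set" where
  "nbrs X v = {u. u \<noteq> v \<and> {v, u} \<in> faces X 2}"

definition walk_op ::
    "nat \<Rightarrow> 'a set set \<Rightarrow> ('a set \<Rightarrow> real) \<Rightarrow> ('a \<Rightarrow> real) \<Rightarrow> 'a \<Rightarrow> real" where
  "walk_op d X P g v =
     (\<Sum>u\<in>nbrs X v. level_wt d X P 2 {v, u} * g u) / (\<Sum>u\<in>nbrs X v. level_wt d X P 2 {v, u})"

text \<open>
  The trivial eigenvalue is one copy of \<open>1\<close>, with the constants as eigenfunctions. The walk is
  reversible with stationary distribution the level-1 weights, so the remaining eigenvalues,
  with multiplicity, are real and are those on the orthogonal complement of the constants.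
\<close>

definition nontrivial_walk_eigenvalue ::
    "nat \<Rightarrow> 'a set set \<Rightarrow> ('a set \<Rightarrow> real) \<Rightarrow> real \<Rightarrow> bool" where
  "nontrivial_walk_eigenvalue d X P r \<longleftrightarrow>
     (\<exists>g. (\<exists>v. {v} \<in> faces X 1 \<and> g v \<noteq> 0)
        \<and> (\<Sum>v | {v} \<in> faces X 1. level_wt d X P 1 {v} * g v) = 0
        \<and> (\<forall>v. {v} \<in> faces X 1 \<longrightarrow> walk_op d X P g v = r * g v))"

text \<open>The condition \<open>i + 2 \<le> d\<close> avoids the truncated difference \<open>d - 2\<close>.\<close>

definition two_sided_local_spectral_expander ::
    "nat \<Rightarrow> 'a set set \<Rightarrow> ('a set \<Rightarrow> real) \<Rightarrow> real \<Rightarrow> bool" where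
  "two_sided_local_spectral_expander d X P \<gamma> \<longleftrightarrow>
     (\<forall>i s r. i + 2 \<le> d \<and> s \<in> faces X i
        \<and> nontrivial_walk_eigenvalue (d - i) (link X s) (link_wt X P s) r
        \<longrightarrow> \<bar>r\<bar> \<le> \<gamma>)"

end

(*
  Read X as an exchangeable random tuple: order a random top face uniformly. For a set S of
  coordinates let E_S be the conditional expectation given the coordinates in S. The spectral
  gaps of the links say that E_{S+i} E_{S+j} is close to E_S, and telescoping gives
  ||E_S E_T - E_{S Int T}|| <= k^2 gamma. Hence the components f_S = sum_{T <= S} (-1)^|S-T| E_T f
  behave like an Efron-Stein decomposition up to errors 2^{O(k)} gamma ||f||^2, which are harmless.

  I[f] is nearly sum_S |S| ||f_S||^2, so I[f] <= K Var f puts weight at least Var f / O(K) on the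
  levels at most K. Suppose that all restrictions of at most K coordinates have density at most eps,
  and let G = sum_{|S| <= K} 4^{-|S|} f_S. Then (E[f G])^4 <= (E f)^3 E[G^4], and E[G^4] is bounded
  as follows: symmetrization and Bonami's lemma give E[G^4] <= E[(sum f_S^2)^2]; sorting the pairs
  S, S' by T = S Int S' bounds this by sum_T E[N_T^2] with N_T = sum_{S >= T} E_T[f_S^2]; and
  E[N_T^2] is nearly at most E[N_T (sum_{S >= T} f_S)^2] <= 4^|T| eps E[N_T], because
  sum_{S >= T} f_S is an alternating sum of the functions E_{A Un T^c} f with A <= T. Thus
  E[G^4] <= 2^{O(K)} eps E f, a contradiction if eps = 2^{-CK}.
*)
theory Submission
  imports Defs "HOL-Analysis.Analysis"
begin

section \<open>Moebius inversion on finite sets\<close>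

text \<open>The coordinates are not independent, so neither orthogonality of components nor
  hypercontractivity holds exactly. Each identity of the product case is kept up to an error that is
  a power of \<open>M = 2^k\<close> times \<open>del\<close>: there are only \<open>M\<close> sets
  of coordinates, so sums over families of sets cost fixed powers of \<open>M\<close>. The argument
  asks for \<open>del * M ^ 40 \<le> 1\<close>; as \<open>del\<close> is \<open>k^2\<close> times
  the spectral bound and \<open>k \<le> M\<close>, this explains the exponent 42 in the assumption
  on gamma.

  The density of \<open>f\<close> has no lower bound, so every error has to be relative to
  \<open>E f = (nrm f)^2\<close>. For this reason error terms are estimated with two factors in L2
  norm, and the remaining factors in sup norm by a power of \<open>M\<close>. In the end the powers
  of \<open>E f\<close> on both sides cancel.

  For \<open>K = 0\<close> no fourth moment is involved: influence at most 0 forces the variance to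
  vanish, after centering the function so that the errors become relative to the variance.\<close>

definition mob :: "('a set \<Rightarrow> real) \<Rightarrow> 'a set \<Rightarrow> real" where
  "mob a S = (\<Sum>T\<in>Pow S. (- 1) ^ card (S - T) * a T)"

lemma sum_Pow_insert:
  fixes g :: "'a set \<Rightarrow> 'b::comm_monoid_add"
  assumes "finite S" "x \<notin> S"
  shows "sum g (Pow (insert x S)) = (\<Sum>T\<in>Pow S. g T) + (\<Sum>T\<in>Pow S. g (insert x T))"
proof -
  have "inj_on (insert x) (Pow S)" using assms(2) by (auto simp: inj_on_def)
  moreover have "Pow S \<inter> insert x ` Pow S = {}" using assms(2) by auto
  ultimately show ?thesis
    using assms(1) by (simp add: Pow_insert sum.union_disjoint sum.reindex)
qed

lemma mob_empty [simp]: "mob a {} = a {}"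
  by (simp add: mob_def)

lemma mob_insert:
  assumes "finite S" "x \<notin> S"
  shows "mob a (insert x S) = mob (\<lambda>T. a (insert x T)) S - mob a S"
proof -
  have 1: "card (insert x S - T) = Suc (card (S - T))" if "T \<in> Pow S" for T
  proof -
    have "insert x S - T = insert x (S - T)" using that assms by auto
    then show ?thesis using assms by simp
  qed
  have 2: "insert x S - insert x T = S - T" for T using assms by auto
  have "(\<Sum>T\<in>Pow S. (- 1) ^ card (insert x S - T) * a T) = (\<Sum>T\<in>Pow S. - ((- 1) ^ card (S - T) * a T))"
    by (rule sum.cong) (auto simp: 1)
  then show ?thesis
    unfolding mob_def sum_Pow_insert[OF assms] 2 by (simp add: sum_negf)
qed

text \<open>Every coordinate of \<open>W\<close> is summed both present and absent, so the
  alternating signs in these directions cancel and only the terms containing all of \<open>W\<close>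
  survive; the alternation over \<open>T\<close> remains. \<open>T = {}\<close> is Moebius
  inversion; the general case evaluates the sum of all components above \<open>T\<close>.\<close>

lemma sum_mob_Un:
  assumes "finite W" "finite T" "T \<inter> W = {}"
  shows "(\<Sum>R\<in>Pow W. mob a (T \<union> R)) = mob (\<lambda>A. a (A \<union> W)) T"
  using assms(2,3)
proof (induction T arbitrary: a rule: finite_induct)
  case empty
  show ?case using assms(1)
  proof (induction W arbitrary: a rule: finite_induct)
    case empty
    show ?case by simp
  next
    case (insert w W)
    have "mob a (insert w R) = mob (\<lambda>T. a (insert w T)) R - mob a R" if "R \<in> Pow W" for R
      using that insert.hyps by (intro mob_insert) (auto intro: finite_subset)
    then have "(\<Sum>R\<in>Pow W. mob a (insert w R))
        = (\<Sum>R\<in>Pow W. mob (\<lambda>T. a (insert w T)) R) - (\<Sum>R\<in>Pow W. mob a R)"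
      by (simp add: sum_subtractf)
    with insert.IH[of "\<lambda>T. a (insert w T)"] insert.hyps show ?case
      by (simp add: sum_Pow_insert)
  qed
next
  case (insert t T)
  have "mob a (insert t T \<union> R) = mob (\<lambda>A. a (insert t A)) (T \<union> R) - mob a (T \<union> R)"
    if "R \<in> Pow W" for R
  proof -
    have "t \<notin> T \<union> R" "finite (T \<union> R)"
      using that insert assms(1) by (auto intro: finite_subset)
    then show ?thesis using mob_insert[of "T \<union> R" t a] by simp
  qed
  then have "(\<Sum>R\<in>Pow W. mob a (insert t T \<union> R))
      = (\<Sum>R\<in>Pow W. mob (\<lambda>A. a (insert t A)) (T \<union> R)) - (\<Sum>R\<in>Pow W. mob a (T \<union> R))"
    by (simp add: sum_subtractf)
  then show ?case
    using insert by (simp add: mob_insert)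
qed

lemma sum_mob: "finite W \<Longrightarrow> (\<Sum>R\<in>Pow W. mob a R) = a W"
  using sum_mob_Un[of W "{}" a] by simp

text \<open>Pairing \<open>T\<close> with \<open>insert s T\<close> for some \<open>s\<close> in
  \<open>S - U\<close> cancels all terms. In the product case this is the statement that averaging
  out a coordinate of \<open>S\<close> kills the component of \<open>S\<close>.\<close>

lemma mob_Int_eq_0:
  assumes "finite S" "\<not> S \<subseteq> U"
  shows "mob (\<lambda>T. a (U \<inter> T)) S = 0"
proof -
  obtain s where "s \<in> S" "s \<notin> U" using assms by auto
  moreover define S' where "S' = S - {s}"
  ultimately have "S = insert s S'" "s \<notin> S'" "finite S'" "U \<inter> insert s T = U \<inter> T" for T
    using assms by auto
  then show ?thesis by (simp add: mob_insert)
qed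

lemma mob_diff: "mob a S - mob b S = mob (\<lambda>T. a T - b T) S"
  by (simp add: mob_def sum_subtractf[symmetric] right_diff_distrib)

section \<open>Conditional expectations on a finite space of tuples\<close>

definition agree :: "'i set \<Rightarrow> ('i \<Rightarrow> 'v) \<Rightarrow> ('i \<Rightarrow> 'v) \<Rightarrow> bool" where
  "agree S x y \<longleftrightarrow> (\<forall>i\<in>S. x i = y i)"

lemma agree_refl [simp]: "agree S x x"
  by (simp add: agree_def)

lemma agree_sym: "agree S x y \<longleftrightarrow> agree S y x"
  by (auto simp: agree_def)

lemma agree_mono: "agree T x y \<Longrightarrow> S \<subseteq> T \<Longrightarrow> agree S x y"
  by (auto simp: agree_def)

text \<open>Strict positivity of \<open>mu\<close> gives every class positive mass, so
  \<open>cond\<close> never divides by 0 at a point of \<open>Om\<close>.\<close>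

locale coord_space =
  fixes Om :: "('i \<Rightarrow> 'v) set" and mu :: "('i \<Rightarrow> 'v) \<Rightarrow> real"
  assumes finite_Om: "finite Om" and mu_pos: "x \<in> Om \<Longrightarrow> mu x > 0"
begin

definition ex :: "(('i \<Rightarrow> 'v) \<Rightarrow> real) \<Rightarrow> real" where
  "ex h = (\<Sum>x\<in>Om. mu x * h x)"

definition cls :: "'i set \<Rightarrow> ('i \<Rightarrow> 'v) \<Rightarrow> ('i \<Rightarrow> 'v) set" where
  "cls S x = {y \<in> Om. agree S y x}"

definition cond :: "'i set \<Rightarrow> (('i \<Rightarrow> 'v) \<Rightarrow> real) \<Rightarrow> ('i \<Rightarrow> 'v) \<Rightarrow> real" where
  "cond S h x = (\<Sum>y\<in>cls S x. mu y * h y) / sum mu (cls S x)"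

definition nrm :: "(('i \<Rightarrow> 'v) \<Rightarrow> real) \<Rightarrow> real" where
  "nrm h = sqrt (ex (\<lambda>x. (h x)\<^sup>2))"

definition meas :: "'i set \<Rightarrow> (('i \<Rightarrow> 'v) \<Rightarrow> real) \<Rightarrow> bool" where
  "meas S h \<longleftrightarrow> (\<forall>x\<in>Om. \<forall>y\<in>Om. agree S x y \<longrightarrow> h x = h y)"

lemma ex_cong: "(\<And>x. x \<in> Om \<Longrightarrow> g x = h x) \<Longrightarrow> ex g = ex h"
  unfolding ex_def by (rule sum.cong) simp_all

lemma ex_add: "ex (\<lambda>x. g x + h x) = ex g + ex h"
  by (simp add: ex_def sum.distrib distrib_left)

lemma ex_diff: "ex (\<lambda>x. g x - h x) = ex g - ex h"
  by (simp add: ex_def sum_subtractf right_diff_distrib)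

lemma ex_cmult: "ex (\<lambda>x. c * h x) = c * ex h"
  by (simp add: ex_def sum_distrib_left algebra_simps)

lemma ex_sum: "ex (\<lambda>x. \<Sum>i\<in>A. h i x) = (\<Sum>i\<in>A. ex (h i))"
  unfolding ex_def sum_distrib_left by (rule sum.swap)

lemma ex_mono: "(\<And>x. x \<in> Om \<Longrightarrow> g x \<le> h x) \<Longrightarrow> ex g \<le> ex h"
  unfolding ex_def by (intro sum_mono mult_left_mono) (auto dest: mu_pos less_imp_le)

lemma ex_nonneg: "(\<And>x. x \<in> Om \<Longrightarrow> 0 \<le> h x) \<Longrightarrow> 0 \<le> ex h"
  unfolding ex_def by (intro sum_nonneg mult_nonneg_nonneg) (auto dest: mu_pos less_imp_le)

lemma cls_subset: "cls S x \<subseteq> Om"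
  by (auto simp: cls_def)

lemma finite_cls [simp]: "finite (cls S x)"
  by (rule finite_subset[OF cls_subset finite_Om])

lemma self_in_cls: "x \<in> Om \<Longrightarrow> x \<in> cls S x"
  by (simp add: cls_def)

lemma cls_eq: "agree S x y \<Longrightarrow> cls S x = cls S y"
  by (auto simp: cls_def agree_def)

lemma sum_cls_pos: "x \<in> Om \<Longrightarrow> sum mu (cls S x) > 0"
  by (rule sum_pos2[OF finite_cls self_in_cls]) (auto simp: cls_def mu_pos less_imp_le)

lemma measD: "meas S h \<Longrightarrow> x \<in> Om \<Longrightarrow> y \<in> Om \<Longrightarrow> agree S x y \<Longrightarrow> h x = h y"
  unfolding meas_def by blast

lemma meas_cond: "meas S (cond S h)"
  by (auto simp: meas_def cond_def dest: cls_eq)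

lemma meas_mono: "meas S h \<Longrightarrow> S \<subseteq> T \<Longrightarrow> meas T h"
  unfolding meas_def using agree_mono by blast

lemma meas_comb2: "meas S g \<Longrightarrow> meas S h \<Longrightarrow> meas S (\<lambda>x. F (g x) (h x))"
  unfolding meas_def by (intro ballI impI arg_cong2[where f = F]) blast+

lemma meas_comb: "meas S g \<Longrightarrow> meas S (\<lambda>x. F (g x))"
  unfolding meas_def by (intro ballI impI arg_cong[where f = F]) blast

lemma meas_sum: "(\<And>i. i \<in> A \<Longrightarrow> meas S (h i)) \<Longrightarrow> meas S (\<lambda>x. \<Sum>i\<in>A. h i x)"
  unfolding meas_def by (intro ballI impI sum.cong) blast+

lemma cond_sum: "cond S (\<lambda>x. \<Sum>i\<in>A. h i x) x = (\<Sum>i\<in>A. cond S (h i) x)"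
  unfolding cond_def sum_distrib_left sum_divide_distrib[symmetric] by (subst sum.swap) simp

lemma cond_cmult: "cond S (\<lambda>x. c * h x) x = c * cond S h x"
proof -
  have "(\<Sum>y\<in>cls S x. mu y * (c * h y)) = c * (\<Sum>y\<in>cls S x. mu y * h y)"
    by (simp add: sum_distrib_left mult.left_commute)
  then show ?thesis by (simp add: cond_def)
qed

lemma cond_add: "cond S (\<lambda>x. g x + h x) x = cond S g x + cond S h x"
  by (simp add: cond_def distrib_left sum.distrib add_divide_distrib)

lemma cond_diff: "cond S (\<lambda>x. g x - h x) x = cond S g x - cond S h x"
  by (simp add: cond_def right_diff_distrib sum_subtractf diff_divide_distrib)

lemma cond_cong: "(\<And>y. y \<in> Om \<Longrightarrow> g y = h y) \<Longrightarrow> cond S g x = cond S h x"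
  using cls_subset[of S x] by (auto simp: cond_def subset_iff intro!: arg_cong2[where f = "(/)"] sum.cong)

lemma cond_pull:
  assumes "meas S g" "x \<in> Om"
  shows "cond S (\<lambda>x. g x * h x) x = g x * cond S h x"
proof -
  have "(\<Sum>y\<in>cls S x. mu y * (g y * h y)) = (\<Sum>y\<in>cls S x. g x * (mu y * h y))"
  proof (rule sum.cong[OF refl])
    fix y assume "y \<in> cls S x"
    then have "g y = g x" using measD[OF assms(1) _ assms(2)] by (simp add: cls_def)
    then show "mu y * (g y * h y) = g x * (mu y * h y)" by simp
  qed
  then show ?thesis by (simp add: cond_def sum_distrib_left)
qed

lemma cond_one: "x \<in> Om \<Longrightarrow> cond S (\<lambda>_. 1) x = 1"
  using sum_cls_pos[of x S] by (simp add: cond_def)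

lemma cond_id: "meas S g \<Longrightarrow> x \<in> Om \<Longrightarrow> cond S g x = g x"
  using cond_pull[of S g x "\<lambda>_. 1"] cond_one by simp

lemma cond_const: "x \<in> Om \<Longrightarrow> cond S (\<lambda>_. c) x = c"
  by (rule cond_id) (auto simp: meas_def)

text \<open>Self-adjointness of the projection: expanding \<open>cond\<close> gives a sum over pairs
  \<open>x\<close>, \<open>y\<close> that agree on \<open>S\<close>. Both \<open>g\<close> and the
  mass of the class take the same value at the two points, so their roles can be exchanged.\<close>

lemma ex_mult_cond:
  assumes "meas S g"
  shows "ex (\<lambda>x. g x * cond S h x) = ex (\<lambda>x. g x * h x)"
proof -
  let ?m = "\<lambda>x. sum mu (cls S x)"
  have "ex (\<lambda>x. g x * cond S h x) = (\<Sum>x\<in>Om. \<Sum>y | y \<in> Om \<and> agree S y x. mu x * g x * (mu y * h y) / ?m x)"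
    by (simp add: ex_def cond_def cls_def sum_distrib_left sum_divide_distrib mult.assoc)
  also have "\<dots> = (\<Sum>y\<in>Om. \<Sum>x | x \<in> Om \<and> agree S y x. mu x * g x * (mu y * h y) / ?m x)"
    by (rule sum.swap_restrict) (use finite_Om in auto)
  also have "\<dots> = (\<Sum>y\<in>Om. mu y * (g y * h y))"
  proof (rule sum.cong[OF refl])
    fix y assume y: "y \<in> Om"
    have "(\<Sum>x | x \<in> Om \<and> agree S y x. mu x * g x * (mu y * h y) / ?m x)
        = (\<Sum>x\<in>cls S y. mu x * (g y * (mu y * h y) / ?m y))"
    proof (rule sum.cong)
      show "{x \<in> Om. agree S y x} = cls S y" by (auto simp: cls_def agree_sym)
      fix x assume "x \<in> cls S y"
      then have "x \<in> Om" "agree S x y" by (auto simp: cls_def)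
      then have "g x = g y" "?m x = ?m y"
        using measD[OF assms _ y] cls_eq[of S x y] by auto
      then show "mu x * g x * (mu y * h y) / ?m x = mu x * (g y * (mu y * h y) / ?m y)" by simp
    qed
    also have "\<dots> = ?m y * (g y * (mu y * h y) / ?m y)"
      by (rule sum_distrib_right[symmetric])
    finally show "(\<Sum>x | x \<in> Om \<and> agree S y x. mu x * g x * (mu y * h y) / ?m x) = mu y * (g y * h y)"
      using sum_cls_pos[OF y, of S] by simp
  qed
  finally show ?thesis by (simp add: ex_def)
qed

lemma ex_cond: "ex (cond S h) = ex h"
  using ex_mult_cond[of S "\<lambda>_. 1" h] by (simp add: meas_def)

lemma ex_cond_mult_cond: "ex (\<lambda>x. cond S g x * cond S h x) = ex (\<lambda>x. cond S g x * h x)"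
  by (rule ex_mult_cond[OF meas_cond])

text \<open>The indicator of an \<open>S\<close>-class is \<open>T\<close>-measurable, so
  \<open>ex_mult_cond\<close> localizes to one class. The tower property follows without another
  double sum.\<close>

lemma sum_cls_cond:
  assumes "S \<subseteq> T" "x \<in> Om"
  shows "(\<Sum>y\<in>cls S x. mu y * cond T h y) = (\<Sum>y\<in>cls S x. mu y * h y)"
proof -
  let ?g = "\<lambda>y. if agree S y x then 1 else 0 :: real"
  have "meas S ?g" by (auto simp: meas_def agree_def)
  then have "meas T ?g" using assms meas_mono by blast
  moreover have "ex (\<lambda>y. ?g y * h y) = (\<Sum>y\<in>cls S x. mu y * h y)" for h
    unfolding ex_def cls_def using finite_Om
    by (simp add: if_distrib[of "\<lambda>c. c * _"] if_distrib[of "\<lambda>c. _ * c"] sum.If_cases Int_def cong: if_cong)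
  ultimately show ?thesis using ex_mult_cond[of T ?g h] by simp
qed

lemma cond_cond: "S \<subseteq> T \<Longrightarrow> x \<in> Om \<Longrightarrow> cond S (cond T h) x = cond S h x"
  by (simp add: cond_def[of S] sum_cls_cond)

lemma cond_cond': "S \<subseteq> T \<Longrightarrow> x \<in> Om \<Longrightarrow> cond T (cond S h) x = cond S h x"
  by (rule cond_id[OF meas_mono[OF meas_cond]])

lemma cond_mono:
  assumes "\<And>y. y \<in> Om \<Longrightarrow> g y \<le> h y" shows "cond S g x \<le> cond S h x"
  unfolding cond_def
  by (intro divide_right_mono sum_mono mult_left_mono sum_nonneg)
    (use assms mu_pos cls_subset in \<open>auto simp: subset_iff less_imp_le\<close>)

lemma cond_nonneg: "(\<And>y. y \<in> Om \<Longrightarrow> 0 \<le> h y) \<Longrightarrow> 0 \<le> cond S h x"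
  using cond_mono[of "\<lambda>_. 0" h S x] by (simp add: cond_def)

lemma abs_cond_le:
  assumes "\<And>y. y \<in> Om \<Longrightarrow> \<bar>h y\<bar> \<le> B" "x \<in> Om" shows "\<bar>cond S h x\<bar> \<le> B"
proof -
  have "cond S h x \<le> B" "- B \<le> cond S h x"
    using cond_mono[of h "\<lambda>_. B" S x] cond_mono[of "\<lambda>_. - B" h S x] assms
    by (auto simp: cond_const abs_le_iff minus_le_iff)
  then show ?thesis by simp
qed

text \<open>Jensen's inequality, as nonnegativity of the variance within the class of
  \<open>x\<close>.\<close>

lemma cond_square_le:
  assumes "x \<in> Om" shows "(cond S h x)\<^sup>2 \<le> cond S (\<lambda>y. (h y)\<^sup>2) x"
proof -
  define c where "c = cond S h x"
  have "0 \<le> cond S (\<lambda>y. (h y - c)\<^sup>2) x" by (rule cond_nonneg) simp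
  also have "(\<lambda>y. (h y - c)\<^sup>2) = (\<lambda>y. ((h y)\<^sup>2 - (2 * c) * h y) + c\<^sup>2)"
    by (auto simp: power2_diff)
  finally show ?thesis
    using assms by (simp add: cond_add cond_diff cond_cmult cond_const c_def[symmetric] power2_eq_square)
qed

lemma nrm_L2: "nrm h = L2_set (\<lambda>x. sqrt (mu x) * h x) Om"
  unfolding nrm_def L2_set_def ex_def
  by (intro arg_cong[where f = sqrt] sum.cong) (auto simp: power_mult_distrib mu_pos less_imp_le)

lemma nrm_nonneg [simp]: "0 \<le> nrm h"
  by (simp add: nrm_L2)

lemma nrm_square: "(nrm h)\<^sup>2 = ex (\<lambda>x. (h x)\<^sup>2)"
  unfolding nrm_def by (intro real_sqrt_pow2 ex_nonneg) simp

lemma nrm_cong: "(\<And>x. x \<in> Om \<Longrightarrow> g x = h x) \<Longrightarrow> nrm g = nrm h"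
  unfolding nrm_def using ex_cong[of "\<lambda>x. (g x)\<^sup>2" "\<lambda>x. (h x)\<^sup>2"] by simp

lemma nrm_add_le: "nrm (\<lambda>x. g x + h x) \<le> nrm g + nrm h"
  unfolding nrm_L2 distrib_left by (rule L2_set_triangle_ineq)

lemma nrm_cmult: "nrm (\<lambda>x. c * h x) = \<bar>c\<bar> * nrm h"
  unfolding nrm_def power_mult_distrib ex_cmult by (simp add: real_sqrt_mult)

lemma nrm_zero [simp]: "nrm (\<lambda>_. 0) = 0"
  by (simp add: nrm_def ex_def)

lemma nrm_sum_le: "nrm (\<lambda>x. \<Sum>i\<in>A. h i x) \<le> (\<Sum>i\<in>A. nrm (h i))"
proof (induction A rule: infinite_finite_induct)
  case (insert a A)
  then show ?case using nrm_add_le[of "h a" "\<lambda>x. \<Sum>i\<in>A. h i x"] by simp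
qed simp_all

lemma nrm_sum_le_card:
  assumes "\<And>i. i \<in> A \<Longrightarrow> nrm (h i) \<le> B"
  shows "nrm (\<lambda>x. \<Sum>i\<in>A. h i x) \<le> real (card A) * B"
  using nrm_sum_le[of h A] sum_bounded_above[of A "\<lambda>i. nrm (h i)" B] assms by force

lemma nrm_mono:
  assumes "\<And>x. x \<in> Om \<Longrightarrow> \<bar>g x\<bar> \<le> \<bar>h x\<bar>" shows "nrm g \<le> nrm h"
  unfolding nrm_def by (intro real_sqrt_le_mono ex_mono) (use assms abs_le_square_iff in blast)

lemma nrm_mult_le:
  assumes "\<And>x. x \<in> Om \<Longrightarrow> \<bar>g x\<bar> \<le> B" "0 \<le> B"
  shows "nrm (\<lambda>x. g x * h x) \<le> B * nrm h"
proof -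
  have "nrm (\<lambda>x. g x * h x) \<le> nrm (\<lambda>x. B * h x)"
    by (rule nrm_mono) (use assms in \<open>auto simp: abs_mult intro!: mult_right_mono\<close>)
  then show ?thesis using assms by (simp add: nrm_cmult)
qed

lemma cauchy_schwarz: "\<bar>ex (\<lambda>x. g x * h x)\<bar> \<le> nrm g * nrm h"
proof -
  have "\<bar>ex (\<lambda>x. g x * h x)\<bar> \<le> (\<Sum>x\<in>Om. \<bar>mu x * (g x * h x)\<bar>)"
    unfolding ex_def by (rule sum_abs)
  also have "\<dots> = (\<Sum>x\<in>Om. \<bar>sqrt (mu x) * g x\<bar> * \<bar>sqrt (mu x) * h x\<bar>)"
  proof (rule sum.cong[OF refl])
    fix x assume "x \<in> Om"
    then have "mu x = sqrt (mu x) * sqrt (mu x)" "0 < mu x" using mu_pos by (auto simp: less_imp_le)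
    then show "\<bar>mu x * (g x * h x)\<bar> = \<bar>sqrt (mu x) * g x\<bar> * \<bar>sqrt (mu x) * h x\<bar>"
      by (simp add: abs_mult)
  qed
  also have "\<dots> \<le> nrm g * nrm h"
    unfolding nrm_L2 by (rule L2_set_mult_ineq)
  finally show ?thesis .
qed

lemma ex_mult_le: "ex (\<lambda>x. g x * h x) \<le> nrm g * nrm h"
  using cauchy_schwarz[of g h] by simp

lemma nrm_cond_le: "nrm (cond S h) \<le> nrm h"
proof -
  have "ex (\<lambda>x. (cond S h x)\<^sup>2) \<le> ex (cond S (\<lambda>y. (h y)\<^sup>2))"
    by (rule ex_mono) (rule cond_square_le)
  then show ?thesis by (simp add: nrm_def ex_cond)
qed

lemma cond_mob: "cond U (\<lambda>x. mob (\<lambda>T. a T x) S) x = mob (\<lambda>T. cond U (a T) x) S"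
  unfolding mob_def by (simp add: cond_sum cond_cmult)

text \<open>The \<open>f_S\<close> of the overview. \<open>mob\<close> acts pointwise in
  \<open>x\<close>, so the identities for set functions carry over directly.\<close>

definition comp :: "'i set \<Rightarrow> (('i \<Rightarrow> 'v) \<Rightarrow> real) \<Rightarrow> ('i \<Rightarrow> 'v) \<Rightarrow> real" where
  "comp S h x = mob (\<lambda>T. cond T h x) S"

lemma meas_comp: "meas S (comp S h)"
  unfolding comp_def mob_def
  by (intro meas_sum meas_comb[where F = "\<lambda>u. c * u" for c]) (auto intro: meas_mono[OF meas_cond])

lemma nrm_mob_le:
  assumes "finite S" "\<And>T. T \<subseteq> S \<Longrightarrow> nrm (a T) \<le> B"
  shows "nrm (\<lambda>x. mob (\<lambda>T. a T x) S) \<le> 2 ^ card S * B"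
proof -
  have "nrm (\<lambda>x. mob (\<lambda>T. a T x) S) \<le> real (card (Pow S)) * B"
    unfolding mob_def by (rule nrm_sum_le_card) (use assms in \<open>simp add: nrm_cmult power_abs\<close>)
  then show ?thesis using assms by (simp add: card_Pow)
qed

lemma sum_comp: "finite U \<Longrightarrow> (\<Sum>S\<in>Pow U. comp S h x) = cond U h x"
  unfolding comp_def by (rule sum_mob)

end

section \<open>Approximate Efron--Stein decomposition\<close>

text \<open>\<open>I\<close> holds the coordinates that the function sees; points of
  \<open>Om\<close> may have more. For a product measure \<open>approx\<close> holds with
  \<open>del = 0\<close>, so \<open>del\<close> measures the distance from independence.\<close>

locale approx_space = coord_space Om mu for Om :: "('i \<Rightarrow> 'v) set" and mu +
  fixes I :: "'i set" and del :: real
  assumes finite_I: "finite I"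
    and sum_mu: "sum mu Om = 1"
    and del_nonneg: "0 \<le> del"
    and approx: "S \<subseteq> I \<Longrightarrow> T \<subseteq> I \<Longrightarrow>
      nrm (\<lambda>x. cond S (cond T h) x - cond (S \<inter> T) h x) \<le> del * nrm h"
begin

text \<open>Every error term below is bounded by a power of \<open>M\<close> times \<open>del\<close>.\<close>

definition M :: real where "M = 2 ^ card I"

lemma M_ge_1: "1 \<le> M"
  by (simp add: M_def)

lemma M_pos [simp]: "0 < M" "0 \<le> M"
  using M_ge_1 by linarith+

lemma card_Pow_I: "real (card (Pow I)) = M"
  using finite_I by (simp add: card_Pow M_def)

lemma finite_sub: "S \<subseteq> I \<Longrightarrow> finite S"
  using finite_I finite_subset by blast

lemma card_family_le: "F \<subseteq> Pow I \<Longrightarrow> real (card F) \<le> M"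
  using card_mono[of "Pow I" F] finite_I card_Pow_I by simp

lemma two_power_card_le: "S \<subseteq> I \<Longrightarrow> 2 ^ card S \<le> M"
  unfolding M_def using card_mono[OF finite_I] by (simp add: power_increasing)

lemma ex_const [simp]: "ex (\<lambda>_. c) = c"
  using sum_mu by (simp add: ex_def flip: sum_distrib_right)

lemma nrm_mob_le_M:
  assumes "S \<subseteq> I" "\<And>T. T \<subseteq> S \<Longrightarrow> nrm (a T) \<le> B"
  shows "nrm (\<lambda>x. mob (\<lambda>T. a T x) S) \<le> M * B"
proof -
  have "0 \<le> B" using assms(2)[of "{}"] nrm_nonneg order_trans by blast
  have "nrm (\<lambda>x. mob (\<lambda>T. a T x) S) \<le> 2 ^ card S * B"
    using assms by (intro nrm_mob_le finite_sub) auto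
  also have "\<dots> \<le> M * B"
    using assms(1) \<open>0 \<le> B\<close> by (intro mult_right_mono two_power_card_le)
  finally show ?thesis .
qed

lemma nrm_comp_le: "S \<subseteq> I \<Longrightarrow> nrm (comp S h) \<le> M * nrm h"
  using nrm_mob_le_M[of S "\<lambda>T. cond T h" "nrm h"] nrm_cond_le
  by (simp add: comp_def[abs_def])

lemma abs_comp_le:
  assumes "S \<subseteq> I" "\<And>y. y \<in> Om \<Longrightarrow> \<bar>h y\<bar> \<le> 1" "x \<in> Om"
  shows "\<bar>comp S h x\<bar> \<le> M"
proof -
  have "\<bar>comp S h x\<bar> \<le> (\<Sum>T\<in>Pow S. \<bar>(- 1) ^ card (S - T) * cond T h x\<bar>)"
    unfolding comp_def mob_def by (rule sum_abs)
  also have "\<dots> \<le> real (card (Pow S)) * 1"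
    by (rule sum_bounded_above) (use abs_cond_le[OF assms(2,3)] in \<open>simp add: abs_mult power_abs\<close>)
  also have "\<dots> \<le> M"
    using card_family_le[of "Pow S"] assms(1) by auto
  finally show ?thesis .
qed

text \<open>In each term of the alternating sum, \<open>cond U (cond T h)\<close> may be exchanged
  for \<open>cond (U \<inter> T) h\<close> at the cost of \<open>del\<close>, and after the exchange
  the sum is 0 by \<open>mob_Int_eq_0\<close>.\<close>

lemma nrm_cond_comp_le:
  assumes "S \<subseteq> I" "U \<subseteq> I" "\<not> S \<subseteq> U"
  shows "nrm (cond U (comp S h)) \<le> M * (del * nrm h)"
proof -
  have "cond U (comp S h) x = mob (\<lambda>T. cond U (cond T h) x - cond (U \<inter> T) h x) S" for x
  proof -
    have "cond U (comp S h) x = mob (\<lambda>T. cond U (cond T h) x) S"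
      unfolding comp_def[abs_def] by (rule cond_mob)
    also have "\<dots> = mob (\<lambda>T. cond U (cond T h) x) S - mob (\<lambda>T. cond (U \<inter> T) h x) S"
      using mob_Int_eq_0[OF finite_sub[OF assms(1)] assms(3), of "\<lambda>T. cond T h x"] by simp
    finally show ?thesis by (simp add: mob_diff)
  qed
  then have "nrm (cond U (comp S h)) = nrm (\<lambda>x. mob (\<lambda>T. cond U (cond T h) x - cond (U \<inter> T) h x) S)"
    by (simp add: nrm_def)
  also have "\<dots> \<le> M * (del * nrm h)"
    by (rule nrm_mob_le_M[OF assms(1)]) (use assms approx in auto)
  finally show ?thesis .
qed

text \<open>As \<open>g\<close> sees only \<open>S\<close>, the component may be replaced by its
  projection to \<open>S\<close>, which is small because \<open>S'\<close> has a coordinate outside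
  \<open>S\<close>.\<close>

lemma ex_mult_comp_le:
  assumes "meas S g" "S \<subseteq> I" "S' \<subseteq> I" "\<not> S' \<subseteq> S"
  shows "\<bar>ex (\<lambda>x. g x * comp S' h x)\<bar> \<le> nrm g * (M * (del * nrm h))"
proof -
  have "\<bar>ex (\<lambda>x. g x * comp S' h x)\<bar> = \<bar>ex (\<lambda>x. g x * cond S (comp S' h) x)\<bar>"
    using ex_mult_cond[OF assms(1)] by simp
  also have "\<dots> \<le> nrm g * nrm (cond S (comp S' h))"
    by (rule cauchy_schwarz)
  also have "\<dots> \<le> nrm g * (M * (del * nrm h))"
    by (intro mult_left_mono nrm_cond_comp_le assms nrm_nonneg)
  finally show ?thesis .
qed

text \<open>Of two distinct sets one, say \<open>S'\<close>, is not contained in the other. Because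
  \<open>T \<subseteq> S\<close>, the product \<open>v * comp S h\<close> still sees only
  \<open>S\<close>, so the weight does not disturb \<open>ex_mult_comp_le\<close>.\<close>

lemma ex_comp_comp_le:
  assumes "S \<subseteq> I" "S' \<subseteq> I" "S \<noteq> S'" "T \<subseteq> S" "T \<subseteq> S'" "meas T v"
    "\<And>x. x \<in> Om \<Longrightarrow> \<bar>v x\<bar> \<le> B"
  shows "\<bar>ex (\<lambda>x. v x * (comp S h x * comp S' h x))\<bar> \<le> B * M\<^sup>2 * del * (nrm h)\<^sup>2"
proof -
  have *: "\<bar>ex (\<lambda>x. v x * (comp S h x * comp S' h x))\<bar> \<le> B * M\<^sup>2 * del * (nrm h)\<^sup>2"
    if "S \<subseteq> I" "S' \<subseteq> I" "\<not> S' \<subseteq> S" "T \<subseteq> S" for S S'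
  proof -
    have "Om \<noteq> {}" using sum_mu by auto
    then have "0 \<le> B" using assms(7) abs_ge_zero order_trans by blast
    have "nrm (\<lambda>x. v x * comp S h x) \<le> B * nrm (comp S h)"
      by (rule nrm_mult_le) (use assms \<open>0 \<le> B\<close> in auto)
    also have "\<dots> \<le> B * (M * nrm h)"
      by (intro mult_left_mono nrm_comp_le that \<open>0 \<le> B\<close>)
    finally have n: "nrm (\<lambda>x. v x * comp S h x) \<le> B * (M * nrm h)" .
    have "meas S (\<lambda>x. v x * comp S h x)"
      by (intro meas_comb2[where F = "\<lambda>u w. u * w"] meas_comp meas_mono[OF assms(6)] that)
    from ex_mult_comp_le[OF this that(1,2,3)]
    have "\<bar>ex (\<lambda>x. v x * (comp S h x * comp S' h x))\<bar>
        \<le> nrm (\<lambda>x. v x * comp S h x) * (M * (del * nrm h))" by (simp add: mult.assoc)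
    also have "\<dots> \<le> B * (M * nrm h) * (M * (del * nrm h))"
      using n del_nonneg by (intro mult_right_mono) auto
    finally show ?thesis by (simp add: power2_eq_square mult_ac)
  qed
  show ?thesis
  proof (cases "S' \<subseteq> S")
    case False
    then show ?thesis using * assms by blast
  next
    case True
    then have "\<not> S \<subseteq> S'" using assms by auto
    from *[OF assms(2,1) this assms(5)] show ?thesis by (simp add: mult.commute)
  qed
qed

text \<open>Expanding the square leaves the diagonal and at most \<open>M ^ 2\<close> pairs of
  distinct sets, each nearly orthogonal. The weight is there for the second moment of
  \<open>pile\<close>, where \<open>v\<close> is \<open>pile\<close> itself; it may depend only on
  coordinates common to all sets of \<open>F\<close>.\<close>

lemma weighted_parseval:
  assumes F: "F \<subseteq> Pow I" "\<And>S. S \<in> F \<Longrightarrow> T \<subseteq> S" and v: "meas T v"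
    "\<And>x. x \<in> Om \<Longrightarrow> \<bar>v x\<bar> \<le> B"
  shows "\<bar>ex (\<lambda>x. v x * (\<Sum>S\<in>F. comp S h x)\<^sup>2) - (\<Sum>S\<in>F. ex (\<lambda>x. v x * (comp S h x)\<^sup>2))\<bar>
    \<le> B * M ^ 4 * del * (nrm h)\<^sup>2"
proof -
  let ?e = "\<lambda>S S'. ex (\<lambda>x. v x * (comp S h x * comp S' h x))"
  let ?b = "B * M\<^sup>2 * del * (nrm h)\<^sup>2"
  have "Om \<noteq> {}" using sum_mu by auto
  then have "0 \<le> B" using v(2) abs_ge_zero order_trans by blast
  then have b: "0 \<le> ?b" using del_nonneg by simp
  have fF: "finite F" using F(1) finite_I finite_subset by blast
  have "ex (\<lambda>x. v x * (\<Sum>S\<in>F. comp S h x)\<^sup>2) = (\<Sum>S\<in>F. \<Sum>S'\<in>F. ?e S S')"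
    by (simp only: power2_eq_square sum_product) (simp only: sum_distrib_left ex_sum)
  moreover have "(\<Sum>S\<in>F. ex (\<lambda>x. v x * (comp S h x)\<^sup>2)) = (\<Sum>S\<in>F. \<Sum>S'\<in>F. if S' = S then ?e S S' else 0)"
    using fF by (simp add: power2_eq_square)
  ultimately have "\<bar>ex (\<lambda>x. v x * (\<Sum>S\<in>F. comp S h x)\<^sup>2) - (\<Sum>S\<in>F. ex (\<lambda>x. v x * (comp S h x)\<^sup>2))\<bar>
    = \<bar>\<Sum>S\<in>F. \<Sum>S'\<in>F. ?e S S' - (if S' = S then ?e S S' else 0)\<bar>"
    by (simp add: sum_subtractf)
  also have "\<dots> \<le> (\<Sum>S\<in>F. \<bar>\<Sum>S'\<in>F. ?e S S' - (if S' = S then ?e S S' else 0)\<bar>)"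
    by (rule sum_abs)
  also have "\<dots> \<le> (\<Sum>S\<in>F. \<Sum>S'\<in>F. \<bar>?e S S' - (if S' = S then ?e S S' else 0)\<bar>)"
    by (intro sum_mono sum_abs)
  also have "\<dots> \<le> (\<Sum>S\<in>F. \<Sum>S'\<in>F. ?b)"
  proof (intro sum_mono)
    fix S S' assume "S \<in> F" "S' \<in> F"
    then show "\<bar>?e S S' - (if S' = S then ?e S S' else 0)\<bar> \<le> ?b"
      using ex_comp_comp_le[of S S' T v B h] F v b by auto
  qed
  also have "\<dots> = real (card F) * real (card F) * ?b" by simp
  also have "\<dots> \<le> M * M * ?b"
    using card_family_le[OF F(1)] b by (intro mult_right_mono mult_mono) auto
  finally show ?thesis by (simp add: power2_eq_square power4_eq_xxxx mult_ac)
qed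

section \<open>Weights of the components, Parseval and influence\<close>

definition wt :: "'i set \<Rightarrow> (('i \<Rightarrow> 'v) \<Rightarrow> real) \<Rightarrow> real" where
  "wt S h = ex (\<lambda>x. (comp S h x)\<^sup>2)"

lemma wt_nonneg [simp]: "0 \<le> wt S h"
  unfolding wt_def by (rule ex_nonneg) simp

lemma parseval:
  assumes "U \<subseteq> I"
  shows "\<bar>ex (\<lambda>x. (cond U h x)\<^sup>2) - (\<Sum>S\<in>Pow U. wt S h)\<bar> \<le> M ^ 4 * del * (nrm h)\<^sup>2"
  using weighted_parseval[of "Pow U" "{}" "\<lambda>_. 1" 1 h] assms
  by (auto simp: wt_def meas_def sum_comp finite_sub)

text \<open>Up to two Parseval errors, coordinate \<open>i\<close> contributes the weight of the
  sets containing \<open>i\<close>; summed over \<open>i\<close>, each \<open>S\<close> is counted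
  \<open>card S\<close> times.\<close>

lemma influence_ge:
  assumes "meas I h"
  shows "(\<Sum>i\<in>I. ex (\<lambda>x. (h x)\<^sup>2) - ex (\<lambda>x. (cond (I - {i}) h x)\<^sup>2))
    \<ge> (\<Sum>S\<in>Pow I. card S * wt S h) - card I * (2 * M ^ 4 * del * (nrm h)\<^sup>2)"
proof -
  let ?b = "M ^ 4 * del * (nrm h)\<^sup>2"
  have I: "ex (\<lambda>x. (cond I h x)\<^sup>2) = ex (\<lambda>x. (h x)\<^sup>2)"
    by (rule ex_cong) (simp add: cond_id assms)
  have "(\<Sum>S\<in>Pow I. card S * wt S h) = (\<Sum>S\<in>Pow I. \<Sum>i\<in>I. if i \<in> S then wt S h else 0)"
  proof (rule sum.cong[OF refl])
    fix S assume "S \<in> Pow I"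
    then have "I \<inter> S = S" by auto
    then show "card S * wt S h = (\<Sum>i\<in>I. if i \<in> S then wt S h else 0)"
      using finite_I by (simp add: sum.If_cases)
  qed
  also have "\<dots> = (\<Sum>i\<in>I. \<Sum>S\<in>Pow I. if i \<in> S then wt S h else 0)"
    by (rule sum.swap)
  also have "\<dots> = (\<Sum>i\<in>I. (\<Sum>S\<in>Pow I. wt S h) - (\<Sum>S\<in>Pow (I - {i}). wt S h))"
  proof (rule sum.cong[OF refl])
    fix i assume "i \<in> I"
    have "Pow I - Pow (I - {i}) = Pow I \<inter> {S. i \<in> S}" by auto
    then show "(\<Sum>S\<in>Pow I. if i \<in> S then wt S h else 0)
      = (\<Sum>S\<in>Pow I. wt S h) - (\<Sum>S\<in>Pow (I - {i}). wt S h)"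
      using finite_I sum_diff[of "Pow I" "Pow (I - {i})" "\<lambda>S. wt S h"]
      by (simp add: sum.If_cases Pow_mono)
  qed
  also have "\<dots> \<le> (\<Sum>i\<in>I. (ex (\<lambda>x. (h x)\<^sup>2) - ex (\<lambda>x. (cond (I - {i}) h x)\<^sup>2)) + 2 * ?b)"
  proof (rule sum_mono)
    fix i assume "i \<in> I"
    show "(\<Sum>S\<in>Pow I. wt S h) - (\<Sum>S\<in>Pow (I - {i}). wt S h)
      \<le> (ex (\<lambda>x. (h x)\<^sup>2) - ex (\<lambda>x. (cond (I - {i}) h x)\<^sup>2)) + 2 * ?b"
      using parseval[of I h] parseval[of "I - {i}" h] I by (simp add: abs_le_iff)
  qed
  finally show ?thesis by (simp add: sum.distrib mult.assoc)
qed

text \<open>As \<open>h\<close> sees only \<open>I\<close>, it is the sum of all its components, and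
  only the one at \<open>S\<close> correlates with \<open>comp S h\<close> by more than an
  error.\<close>

lemma ex_mult_comp_ge:
  assumes "meas I h" "S \<subseteq> I"
  shows "ex (\<lambda>x. h x * comp S h x) \<ge> wt S h - M ^ 3 * del * (nrm h)\<^sup>2"
proof -
  let ?e = "\<lambda>S'. ex (\<lambda>x. comp S' h x * comp S h x)"
  have "ex (\<lambda>x. h x * comp S h x) = ex (\<lambda>x. (\<Sum>S'\<in>Pow I. comp S' h x) * comp S h x)"
    by (rule ex_cong) (simp add: sum_comp finite_I cond_id assms)
  also have "\<dots> = (\<Sum>S'\<in>Pow I. ?e S')"
    by (simp add: sum_distrib_right ex_sum)
  also have "\<dots> = ?e S + (\<Sum>S'\<in>Pow I - {S}. ?e S')"
    using assms finite_I by (intro sum.remove) auto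
  finally have 1: "ex (\<lambda>x. h x * comp S h x) = wt S h + (\<Sum>S'\<in>Pow I - {S}. ?e S')"
    by (simp add: wt_def power2_eq_square)
  have "\<bar>\<Sum>S'\<in>Pow I - {S}. ?e S'\<bar> \<le> (\<Sum>S'\<in>Pow I - {S}. \<bar>?e S'\<bar>)"
    by (rule sum_abs)
  also have "\<dots> \<le> real (card (Pow I - {S})) * (M\<^sup>2 * del * (nrm h)\<^sup>2)"
  proof (rule sum_bounded_above)
    fix S' assume "S' \<in> Pow I - {S}"
    then show "\<bar>?e S'\<bar> \<le> M\<^sup>2 * del * (nrm h)\<^sup>2"
      using ex_comp_comp_le[of S' S "{}" "\<lambda>_. 1" 1 h] assms by (auto simp: meas_def)
  qed
  also have "\<dots> \<le> M * (M\<^sup>2 * del * (nrm h)\<^sup>2)"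
    using card_family_le[of "Pow I - {S}"] del_nonneg by (intro mult_right_mono) auto
  finally show ?thesis
    using 1 by (simp add: abs_le_iff power2_eq_square power3_eq_cube mult_ac)
qed

end

section \<open>The fourth moment of global functions\<close>

text \<open>\<open>(- 1) ^ card (S \<inter> R)\<close> is the character of \<open>S\<close> at the
  sign vector that is -1 exactly on \<open>R\<close>. Divided by \<open>2 ^ card J\<close>, this is
  the (2,4) hypercontractive inequality with noise 1/2 for a multilinear polynomial in uniform
  signs. The induction splits off the sign of \<open>j\<close>: the polynomial becomes
  \<open>A + B / 2\<close> or \<open>A - B / 2\<close>, and the odd powers of \<open>B\<close>
  cancel.\<close>

lemma bonami:
  fixes a :: "'a set \<Rightarrow> real"
  assumes "finite J"
  shows "(\<Sum>R\<in>Pow J. (\<Sum>S\<in>Pow J. (1/2) ^ card S * (- 1) ^ card (S \<inter> R) * a S) ^ 4)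
    \<le> 2 ^ card J * (\<Sum>S\<in>Pow J. (a S)\<^sup>2)\<^sup>2"
  using assms
proof (induction J arbitrary: a rule: finite_induct)
  case empty
  then show ?case by (simp add: power4_eq_xxxx power2_eq_square)
next
  case (insert j J)
  let ?L = "\<lambda>a R. \<Sum>S\<in>Pow J. (1/2) ^ card S * (- 1) ^ card (S \<inter> R) * a S :: real"
  define A where "A = ?L a"
  define B where "B = ?L (\<lambda>S. a (insert j S))"
  define X where "X = (\<Sum>S\<in>Pow J. (a S)\<^sup>2)"
  define Y where "Y = (\<Sum>S\<in>Pow J. (a (insert j S))\<^sup>2)"
  have XY: "0 \<le> X" "0 \<le> Y" by (simp_all add: X_def Y_def sum_nonneg)
  have A: "(\<Sum>R\<in>Pow J. A R ^ 4) \<le> 2 ^ card J * X\<^sup>2"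
    unfolding A_def X_def by (rule insert.IH)
  have B: "(\<Sum>R\<in>Pow J. B R ^ 4) \<le> 2 ^ card J * Y\<^sup>2"
    unfolding B_def Y_def by (rule insert.IH)
  have "(\<Sum>R\<in>Pow J. (A R)\<^sup>2 * (B R)\<^sup>2)\<^sup>2 \<le> (\<Sum>R\<in>Pow J. ((A R)\<^sup>2)\<^sup>2) * (\<Sum>R\<in>Pow J. ((B R)\<^sup>2)\<^sup>2)"
    by (rule Cauchy_Schwarz_ineq_sum)
  also have "\<dots> \<le> (2 ^ card J * X\<^sup>2) * (2 ^ card J * Y\<^sup>2)"
    by (rule mult_mono) (use A B in \<open>simp_all add: sum_nonneg\<close>)
  finally have "(\<Sum>R\<in>Pow J. (A R)\<^sup>2 * (B R)\<^sup>2)\<^sup>2 \<le> (2 ^ card J * (X * Y))\<^sup>2"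
    by (simp add: power2_eq_square mult_ac)
  then have AB: "(\<Sum>R\<in>Pow J. (A R)\<^sup>2 * (B R)\<^sup>2) \<le> 2 ^ card J * (X * Y)"
    by (rule power2_le_imp_le) (use XY in simp)
  have split: "(\<Sum>S\<in>Pow (insert j J). (1/2) ^ card S * (- 1) ^ card (S \<inter> R) * a S) = A R + B R / 2"
    "(\<Sum>S\<in>Pow (insert j J). (1/2) ^ card S * (- 1) ^ card (S \<inter> insert j R) * a S) = A R - B R / 2"
    if R: "R \<in> Pow J" for R
  proof -
    have ids: "card (insert j S) = Suc (card S)" "insert j S \<inter> R = S \<inter> R"
      "S \<inter> insert j R = S \<inter> R" "card (insert j (S \<inter> R)) = Suc (card (S \<inter> R))"
      if "S \<in> Pow J" for S
    proof -
      have "finite S" "j \<notin> S" "j \<notin> R" using that R insert.hyps finite_subset by auto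
      then show "card (insert j S) = Suc (card S)" "insert j S \<inter> R = S \<inter> R"
        "S \<inter> insert j R = S \<inter> R" "card (insert j (S \<inter> R)) = Suc (card (S \<inter> R))"
        by auto
    qed
    show "(\<Sum>S\<in>Pow (insert j J). (1/2) ^ card S * (- 1) ^ card (S \<inter> R) * a S) = A R + B R / 2"
      unfolding sum_Pow_insert[OF insert.hyps] A_def B_def sum_divide_distrib
      by (intro arg_cong2[where f = "(+)"] sum.cong) (auto simp: ids)
    show "(\<Sum>S\<in>Pow (insert j J). (1/2) ^ card S * (- 1) ^ card (S \<inter> insert j R) * a S) = A R - B R / 2"
      unfolding sum_Pow_insert[OF insert.hyps] A_def B_def sum_divide_distrib diff_conv_add_uminus sum_negf[symmetric]
      by (intro arg_cong2[where f = "(+)"] sum.cong) (auto simp: ids)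
  qed
  have "(\<Sum>R\<in>Pow (insert j J). (\<Sum>S\<in>Pow (insert j J). (1/2) ^ card S * (- 1) ^ card (S \<inter> R) * a S) ^ 4)
    = (\<Sum>R\<in>Pow J. (A R + B R / 2) ^ 4 + (A R - B R / 2) ^ 4)"
    unfolding sum_Pow_insert[OF insert.hyps, of "\<lambda>R. (\<Sum>S\<in>Pow (insert j J). _ S R) ^ 4"] sum.distrib
    by (intro arg_cong2[where f = "(+)"] sum.cong refl arg_cong[where f = "\<lambda>x. x ^ 4"] split)
  \<comment> \<open>The even terms have coefficients 2, 12/4 = 3 and 2/16 = 1/8. They are rounded up
    to 2, 4, 2, so that with the Cauchy-Schwarz bound \<open>AB\<close> on the mixed term the total
    is twice the square of \<open>X + Y\<close>.\<close>
  also have "\<dots> \<le> (\<Sum>R\<in>Pow J. 2 * A R ^ 4 + 4 * ((A R)\<^sup>2 * (B R)\<^sup>2) + 2 * B R ^ 4)"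
  proof (rule sum_mono)
    fix R
    have "(A R + B R / 2) ^ 4 + (A R - B R / 2) ^ 4
      = 2 * A R ^ 4 + 3 * ((A R)\<^sup>2 * (B R)\<^sup>2) + B R ^ 4 / 8"
      by (simp add: power2_eq_square power4_eq_xxxx field_simps)
    moreover have "0 \<le> (A R)\<^sup>2 * (B R)\<^sup>2" "0 \<le> B R ^ 4" by simp_all
    ultimately show "(A R + B R / 2) ^ 4 + (A R - B R / 2) ^ 4
      \<le> 2 * A R ^ 4 + 4 * ((A R)\<^sup>2 * (B R)\<^sup>2) + 2 * B R ^ 4" by linarith
  qed
  also have "\<dots> \<le> 2 * (2 ^ card J * X\<^sup>2) + 4 * (2 ^ card J * (X * Y)) + 2 * (2 ^ card J * Y\<^sup>2)"
    using A B AB by (simp add: sum.distrib flip: sum_distrib_left)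
  also have "\<dots> = 2 ^ card (insert j J) * (X + Y)\<^sup>2"
    using insert.hyps by (simp add: power2_eq_square algebra_simps)
  also have "X + Y = (\<Sum>S\<in>Pow (insert j J). (a S)\<^sup>2)"
    unfolding X_def Y_def by (rule sum_Pow_insert[OF insert.hyps, symmetric])
  finally show ?case .
qed

text \<open>The term linear in \<open>b\<close> on the left is exactly the added
  \<open>2 * (a ^ 3 * b)\<close>. The halving shrinks the term in \<open>a * b ^ 3\<close> so far
  that the even terms absorb it. The sum of squares in the proof is four times the difference of the
  two sides.\<close>

lemma half_fourth_power_le:
  fixes a b :: real
  shows "(a + b / 2) ^ 4 \<le> ((a + b) ^ 4 + (a - b) ^ 4) / 2 + 2 * (a ^ 3 * b)"
proof -
  have "0 \<le> (a * b - b\<^sup>2)\<^sup>2 + 17 * (a * b)\<^sup>2 + 11 * b ^ 4 / 4" by simp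
  then show ?thesis
    by (simp add: power2_eq_square power3_eq_cube power4_eq_xxxx field_simps)
qed

context approx_space
begin

text \<open>
  Odd moments do not vanish, so the halving on the left is needed to absorb the term cubic in the
  part containing \<open>j\<close>; the term linear in that part is an error by near-orthogonality.
\<close>

lemma symmetrization_step:
  assumes h: "\<And>y. y \<in> Om \<Longrightarrow> \<bar>h y\<bar> \<le> 1" and F: "F \<subseteq> Pow I" and j: "j \<in> I"
    and c: "\<And>S. \<bar>c S\<bar> \<le> 1"
  shows "ex (\<lambda>x. (\<Sum>S\<in>F. c S * (if j \<in> S then 1/2 else 1) * comp S h x) ^ 4)
    \<le> (ex (\<lambda>x. (\<Sum>S\<in>F. c S * comp S h x) ^ 4)
       + ex (\<lambda>x. (\<Sum>S\<in>F. c S * (if j \<in> S then -1 else 1) * comp S h x) ^ 4)) / 2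
      + 2 * M ^ 8 * del * (nrm h)\<^sup>2"
proof -
  define a where "a x = (\<Sum>S\<in>F \<inter> {S. j \<notin> S}. c S * comp S h x)" for x
  define b where "b x = (\<Sum>S\<in>F \<inter> {S. j \<in> S}. c S * comp S h x)" for x
  have fF: "finite F" using F finite_I finite_subset by blast
  have split: "(\<Sum>S\<in>F. c S * (if j \<in> S then t else 1) * comp S h x) = a x + t * b x" for t x
  proof -
    have "(\<Sum>S\<in>F. c S * (if j \<in> S then t else 1) * comp S h x)
      = (\<Sum>S\<in>F. if j \<in> S then t * (c S * comp S h x) else c S * comp S h x)"
      by (rule sum.cong) auto
    also have "\<dots> = (\<Sum>S\<in>F \<inter> {S. j \<in> S}. t * (c S * comp S h x)) + a x"
      using fF by (simp add: sum.If_cases a_def Compl_eq)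
    finally show ?thesis by (simp add: b_def sum_distrib_left)
  qed
  have abs_a: "\<bar>a x\<bar> \<le> M\<^sup>2" if "x \<in> Om" for x
  proof -
    have "\<bar>a x\<bar> \<le> (\<Sum>S\<in>F \<inter> {S. j \<notin> S}. \<bar>c S * comp S h x\<bar>)"
      unfolding a_def by (rule sum_abs)
    also have "\<dots> \<le> real (card (F \<inter> {S. j \<notin> S})) * M"
    proof (rule sum_bounded_above)
      fix S assume "S \<in> F \<inter> {S. j \<notin> S}"
      then have "\<bar>comp S h x\<bar> \<le> M" using abs_comp_le h that F by blast
      then show "\<bar>c S * comp S h x\<bar> \<le> M" using mult_mono[OF c[of S]] by (simp add: abs_mult)
    qed
    also have "\<dots> \<le> M * M"
      using F by (intro mult_right_mono card_family_le) auto
    finally show ?thesis by (simp add: power2_eq_square)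
  qed
  have nrm_a: "nrm a \<le> M\<^sup>2 * nrm h"
  proof -
    have "nrm a \<le> real (card (F \<inter> {S. j \<notin> S})) * (M * nrm h)"
      unfolding a_def[abs_def]
    proof (rule nrm_sum_le_card)
      fix S assume "S \<in> F \<inter> {S. j \<notin> S}"
      then have "nrm (comp S h) \<le> M * nrm h" using nrm_comp_le F by blast
      then show "nrm (\<lambda>x. c S * comp S h x) \<le> M * nrm h"
        using mult_mono[OF c[of S]] by (simp add: nrm_cmult)
    qed
    also have "\<dots> \<le> M * (M * nrm h)"
      using F by (intro mult_right_mono card_family_le) auto
    finally show ?thesis by (simp add: power2_eq_square mult_ac)
  qed
  have "nrm (\<lambda>x. (a x)\<^sup>2 * a x) \<le> M ^ 4 * nrm a"
  proof (rule nrm_mult_le)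
    fix x assume "x \<in> Om"
    from power_mono[OF abs_a[OF this], of 2]
    show "\<bar>(a x)\<^sup>2\<bar> \<le> M ^ 4" by simp
  qed simp
  also have "\<dots> \<le> M ^ 4 * (M\<^sup>2 * nrm h)" by (intro mult_left_mono nrm_a) simp
  finally have nrm_a3: "nrm (\<lambda>x. a x ^ 3) \<le> M ^ 6 * nrm h"
    by (simp add: power2_eq_square power3_eq_cube numeral_eq_Suc mult_ac)
  \<comment> \<open>\<open>a\<close> uses only sets without \<open>j\<close>, so
    \<open>a ^ 3\<close> sees only \<open>I - {j}\<close>, while every set in \<open>b\<close>
    contains \<open>j\<close>: this is the near-orthogonality behind \<open>err\<close>.\<close>
  have meas_a: "meas (I - {j}) (\<lambda>x. a x ^ 3)"
    unfolding a_def
    by (intro meas_comb[where F = "\<lambda>t. t ^ 3"] meas_sum meas_comb[where F = "\<lambda>u. t * u" for t]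
        meas_mono[OF meas_comp]) (use F in auto)
  have "ex (\<lambda>x. a x ^ 3 * b x) = (\<Sum>S\<in>F \<inter> {S. j \<in> S}. c S * ex (\<lambda>x. a x ^ 3 * comp S h x))"
    unfolding b_def sum_distrib_left ex_sum by (simp add: mult.left_commute ex_cmult)
  also have "\<dots> \<le> real (card (F \<inter> {S. j \<in> S})) * (M ^ 7 * del * (nrm h)\<^sup>2)"
  proof (rule sum_bounded_above)
    fix S assume S: "S \<in> F \<inter> {S. j \<in> S}"
    have "\<bar>ex (\<lambda>x. a x ^ 3 * comp S h x)\<bar> \<le> nrm (\<lambda>x. a x ^ 3) * (M * (del * nrm h))"
      by (rule ex_mult_comp_le[OF meas_a]) (use S F in auto)
    also have "\<dots> \<le> M ^ 6 * nrm h * (M * (del * nrm h))"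
      by (intro mult_right_mono nrm_a3) (simp add: del_nonneg)
    finally have "\<bar>ex (\<lambda>x. a x ^ 3 * comp S h x)\<bar> \<le> M ^ 7 * del * (nrm h)\<^sup>2"
      by (simp add: power2_eq_square numeral_eq_Suc mult_ac)
    then have "\<bar>c S\<bar> * \<bar>ex (\<lambda>x. a x ^ 3 * comp S h x)\<bar> \<le> 1 * (M ^ 7 * del * (nrm h)\<^sup>2)"
      by (intro mult_mono c) auto
    then show "c S * ex (\<lambda>x. a x ^ 3 * comp S h x) \<le> M ^ 7 * del * (nrm h)\<^sup>2"
      by (simp flip: abs_mult)
  qed
  also have "\<dots> \<le> M * (M ^ 7 * del * (nrm h)\<^sup>2)"
    using F del_nonneg by (intro mult_right_mono card_family_le) auto
  finally have err: "ex (\<lambda>x. a x ^ 3 * b x) \<le> M ^ 8 * del * (nrm h)\<^sup>2"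
    by (simp add: numeral_eq_Suc mult_ac)
  have "ex (\<lambda>x. (a x + b x / 2) ^ 4) \<le> ex (\<lambda>x. ((a x + b x) ^ 4 + (a x - b x) ^ 4) / 2 + 2 * (a x ^ 3 * b x))"
    by (rule ex_mono) (rule half_fourth_power_le)
  also have "\<dots> = (ex (\<lambda>x. (a x + b x) ^ 4) + ex (\<lambda>x. (a x - b x) ^ 4)) / 2 + 2 * ex (\<lambda>x. a x ^ 3 * b x)"
    using ex_cmult[of "1/2" "\<lambda>x. (a x + b x) ^ 4 + (a x - b x) ^ 4"] by (simp add: ex_add ex_cmult)
  finally show ?thesis
    using err split[of "1/2"] split[of "-1"] split[of 1] by simp
qed

text \<open>Coordinates are treated one at a time, and \<open>R\<close> is the set of coordinates
  with sign -1. The induction hypothesis is applied to coefficients that already carry the factor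
  1/2 for \<open>j\<close>, and \<open>symmetrization_step\<close> then trades this factor for the
  average over the sign of \<open>j\<close>; hence the general coefficients \<open>c\<close> of
  absolute value at most 1.\<close>

lemma symmetrization:
  assumes h: "\<And>y. y \<in> Om \<Longrightarrow> \<bar>h y\<bar> \<le> 1" and F: "F \<subseteq> Pow I" and J: "J \<subseteq> I"
    and c: "\<And>S. \<bar>c S\<bar> \<le> 1"
  shows "ex (\<lambda>x. (\<Sum>S\<in>F. c S * (1/2) ^ card (S \<inter> J) * comp S h x) ^ 4)
    \<le> (\<Sum>R\<in>Pow J. ex (\<lambda>x. (\<Sum>S\<in>F. c S * (- 1) ^ card (S \<inter> R) * comp S h x) ^ 4)) / 2 ^ card J
      + card J * (2 * M ^ 8 * del * (nrm h)\<^sup>2)"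
  using finite_sub[OF J] J c
proof (induction J arbitrary: c rule: finite_induct)
  case empty
  then show ?case by simp
next
  case (insert j J)
  let ?e = "2 * M ^ 8 * del * (nrm h)\<^sup>2"
  let ?g = "\<lambda>d. ex (\<lambda>x. (\<Sum>S\<in>F. d S * comp S h x) ^ 4)"
  define d where "d S = c S * (if j \<in> S then 1/2 else 1)" for S
  have eq: "(1/2) ^ card (S \<inter> insert j J) = (if j \<in> S then 1/2 else 1) * (1/2 :: real) ^ card (S \<inter> J)" for S
    using insert.hyps by (simp add: Int_insert_right)
  have "?g (\<lambda>S. c S * (1/2) ^ card (S \<inter> insert j J)) = ?g (\<lambda>S. d S * (1/2) ^ card (S \<inter> J))"
    unfolding eq d_def by (simp only: mult_ac)
  also have "\<dots> \<le> (\<Sum>R\<in>Pow J. ?g (\<lambda>S. d S * (- 1) ^ card (S \<inter> R))) / 2 ^ card J + card J * ?e"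
  proof (rule insert.IH)
    show "\<bar>d S\<bar> \<le> 1" for S
      using insert.prems(2)[of S] by (auto simp: d_def abs_mult)
  qed (use insert.prems in auto)
  also have "(\<Sum>R\<in>Pow J. ?g (\<lambda>S. d S * (- 1) ^ card (S \<inter> R)))
    \<le> (\<Sum>R\<in>Pow J. (?g (\<lambda>S. c S * (- 1) ^ card (S \<inter> R))
        + ?g (\<lambda>S. c S * (- 1) ^ card (S \<inter> insert j R))) / 2 + ?e)"
  proof (rule sum_mono)
    fix R assume R: "R \<in> Pow J"
    then have jR: "j \<notin> R" "finite R" using insert.hyps finite_subset by auto
    have eq: "(- 1) ^ card (S \<inter> insert j R) = (if j \<in> S then - 1 else 1) * (- 1 :: real) ^ card (S \<inter> R)"
      for S :: "'i set"
      using jR by (simp add: Int_insert_right)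
    have "?g (\<lambda>S. (c S * (- 1) ^ card (S \<inter> R)) * (if j \<in> S then 1/2 else 1))
      \<le> (?g (\<lambda>S. c S * (- 1) ^ card (S \<inter> R))
        + ?g (\<lambda>S. (c S * (- 1) ^ card (S \<inter> R)) * (if j \<in> S then - 1 else 1))) / 2 + ?e"
      by (rule symmetrization_step[OF h F]) (use insert.prems in \<open>auto simp: abs_mult power_abs\<close>)
    then show "?g (\<lambda>S. d S * (- 1) ^ card (S \<inter> R)) \<le> (?g (\<lambda>S. c S * (- 1) ^ card (S \<inter> R))
        + ?g (\<lambda>S. c S * (- 1) ^ card (S \<inter> insert j R))) / 2 + ?e"
      unfolding eq d_def by (simp only: mult_ac)
  qed
  also have "\<dots> = (\<Sum>R\<in>Pow (insert j J). ?g (\<lambda>S. c S * (- 1) ^ card (S \<inter> R))) / 2 + 2 ^ card J * ?e"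
    using insert.hyps
    by (simp add: sum_Pow_insert sum.distrib card_Pow add_divide_distrib flip: sum_divide_distrib)
  finally show ?case
    using insert.hyps by (simp add: divide_right_mono add_divide_distrib algebra_simps)
qed

text \<open>1/4 is 1/2 times 1/2: one factor per coordinate is consumed by the symmetrization, the
  other is the noise in Bonami's lemma, which is applied for each fixed \<open>x\<close> to the
  coefficients \<open>comp S h x\<close>.\<close>

lemma fourth_moment_le:
  assumes h: "\<And>y. y \<in> Om \<Longrightarrow> \<bar>h y\<bar> \<le> 1" and F: "F \<subseteq> Pow I"
  shows "ex (\<lambda>x. (\<Sum>S\<in>F. (1/4) ^ card S * comp S h x) ^ 4)
    \<le> ex (\<lambda>x. (\<Sum>S\<in>F. (comp S h x)\<^sup>2)\<^sup>2) + card I * (2 * M ^ 8 * del * (nrm h)\<^sup>2)"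
proof -
  have "(\<Sum>S\<in>F. (1/4) ^ card S * comp S h x)
    = (\<Sum>S\<in>F. (1/2) ^ card S * (1/2) ^ card (S \<inter> I) * comp S h x)" for x
  proof (rule sum.cong[OF refl])
    fix S assume "S \<in> F"
    then have "S \<inter> I = S" using F by auto
    then show "(1/4) ^ card S * comp S h x = (1/2) ^ card S * (1/2) ^ card (S \<inter> I) * comp S h x"
      by (simp flip: power_mult_distrib)
  qed
  then have "ex (\<lambda>x. (\<Sum>S\<in>F. (1/4) ^ card S * comp S h x) ^ 4)
    = ex (\<lambda>x. (\<Sum>S\<in>F. (1/2) ^ card S * (1/2) ^ card (S \<inter> I) * comp S h x) ^ 4)" by simp
  also have "\<dots> \<le> (\<Sum>R\<in>Pow I. ex (\<lambda>x. (\<Sum>S\<in>F. (1/2) ^ card S * (- 1) ^ card (S \<inter> R) * comp S h x) ^ 4)) / 2 ^ card I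
      + card I * (2 * M ^ 8 * del * (nrm h)\<^sup>2)"
    by (rule symmetrization[OF h F]) (auto simp: power_abs power_le_one)
  also have "(\<Sum>R\<in>Pow I. ex (\<lambda>x. (\<Sum>S\<in>F. (1/2) ^ card S * (- 1) ^ card (S \<inter> R) * comp S h x) ^ 4))
    \<le> ex (\<lambda>x. 2 ^ card I * (\<Sum>S\<in>F. (comp S h x)\<^sup>2)\<^sup>2)"
    unfolding ex_sum[symmetric]
  proof (rule ex_mono)
    fix x
    let ?a = "\<lambda>S. if S \<in> F then comp S h x else 0"
    have FI: "Pow I \<inter> F = F" using F by auto
    have "(\<Sum>S\<in>Pow I. t S * ?a S) = (\<Sum>S\<in>F. t S * comp S h x)" for t
      using finite_I FI by (simp add: if_distrib sum.If_cases cong: if_cong)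
    moreover have "(\<Sum>S\<in>Pow I. (?a S)\<^sup>2) = (\<Sum>S\<in>F. (comp S h x)\<^sup>2)"
      using finite_I FI by (simp add: if_distrib[of "\<lambda>t. t\<^sup>2"] sum.If_cases cong: if_cong)
    ultimately show "(\<Sum>R\<in>Pow I. (\<Sum>S\<in>F. (1/2) ^ card S * (- 1) ^ card (S \<inter> R) * comp S h x) ^ 4)
      \<le> 2 ^ card I * (\<Sum>S\<in>F. (comp S h x)\<^sup>2)\<^sup>2"
      using bonami[OF finite_I, of ?a] by simp
  qed
  finally show ?thesis
    by (simp add: ex_cmult divide_right_mono)
qed

section \<open>Second moment of the square function of the low components\<close>

definition low :: "nat \<Rightarrow> 'i set set" where
  "low K = {S. S \<subseteq> I \<and> card S \<le> K}"

lemma low_subset: "low K \<subseteq> Pow I"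
  by (auto simp: low_def)

lemma finite_low [simp]: "finite (low K)"
  using finite_subset[OF low_subset] finite_I by simp

text \<open>The \<open>N_T\<close> of the overview, over sets of size at most \<open>K\<close>. The
  projection to \<open>T\<close> lets it serve as a \<open>T\<close>-measurable weight in
  \<open>weighted_parseval\<close>.\<close>

definition pile :: "nat \<Rightarrow> (('i \<Rightarrow> 'v) \<Rightarrow> real) \<Rightarrow> 'i set \<Rightarrow> ('i \<Rightarrow> 'v) \<Rightarrow> real" where
  "pile K h T x = (\<Sum>S\<in>{S\<in>low K. T \<subseteq> S}. cond T (\<lambda>y. (comp S h y)\<^sup>2) x)"

lemma nrm_comp_square_le:
  assumes h: "\<And>y. y \<in> Om \<Longrightarrow> \<bar>h y\<bar> \<le> 1" and "S \<subseteq> I"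
  shows "nrm (\<lambda>y. (comp S h y)\<^sup>2) \<le> M\<^sup>2 * nrm h"
proof -
  have "nrm (\<lambda>y. comp S h y * comp S h y) \<le> M * nrm (comp S h)"
    by (rule nrm_mult_le) (use abs_comp_le[OF assms(2) h] in auto)
  also have "\<dots> \<le> M * (M * nrm h)"
    by (intro mult_left_mono nrm_comp_le assms) simp
  finally show ?thesis by (simp add: power2_eq_square mult_ac)
qed

text \<open>Given the coordinates in \<open>S \<inter> S'\<close>, the squares of two components are
  nearly uncorrelated by \<open>approx\<close>, so each pair is charged to
  \<open>T = S \<inter> S'\<close>. As all terms are nonnegative, each pair may then be counted for
  every \<open>T\<close> contained in both sets, which completes the double sum for fixed
  \<open>T\<close> to a square.\<close>

lemma ex_squares_le:
  assumes h: "\<And>y. y \<in> Om \<Longrightarrow> \<bar>h y\<bar> \<le> 1"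
  shows "ex (\<lambda>x. (\<Sum>S\<in>low K. (comp S h x)\<^sup>2)\<^sup>2)
    \<le> (\<Sum>T\<in>low K. ex (\<lambda>x. (pile K h T x)\<^sup>2)) + M ^ 6 * del * (nrm h)\<^sup>2"
proof -
  let ?u = "\<lambda>S y. (comp S h y)\<^sup>2"
  let ?p = "\<lambda>T S S'. ex (\<lambda>x. cond T (?u S) x * cond T (?u S') x)"
  let ?e = "M ^ 4 * del * (nrm h)\<^sup>2"
  have p_nonneg: "0 \<le> ?p T S S'" for T S S'
    by (intro ex_nonneg mult_nonneg_nonneg cond_nonneg) simp_all
  have pair: "ex (\<lambda>x. ?u S x * ?u S' x) \<le> ?p (S \<inter> S') S S' + ?e" if "S \<in> low K" "S' \<in> low K" for S S'
  proof -
    have SI: "S \<subseteq> I" "S' \<subseteq> I" using that low_subset by auto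
    have u: "meas S (?u S)" for S by (intro meas_comb[OF meas_comp])
    let ?r = "\<lambda>x. cond S (cond S' (?u S')) x - cond (S \<inter> S') (?u S') x"
    have "ex (\<lambda>x. ?u S x * ?u S' x) = ex (\<lambda>x. ?u S x * cond S' (?u S') x)"
      by (rule ex_cong) (simp add: cond_id[OF u])
    also have "\<dots> = ex (\<lambda>x. ?u S x * cond S (cond S' (?u S')) x)"
      by (rule ex_mult_cond[OF u, symmetric])
    also have "\<dots> = ex (\<lambda>x. cond (S \<inter> S') (?u S') x * ?u S x) + ex (\<lambda>x. ?u S x * ?r x)"
      unfolding ex_add[symmetric] by (rule ex_cong) (simp add: algebra_simps)
    finally have 1: "ex (\<lambda>x. ?u S x * ?u S' x)
      = ex (\<lambda>x. cond (S \<inter> S') (?u S') x * ?u S x) + ex (\<lambda>x. ?u S x * ?r x)" .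
    have 2: "ex (\<lambda>x. cond (S \<inter> S') (?u S') x * ?u S x) = ?p (S \<inter> S') S S'"
      by (subst ex_cond_mult_cond[symmetric]) (simp add: mult.commute)
    have "ex (\<lambda>x. ?u S x * ?r x) \<le> nrm (?u S) * nrm ?r"
      by (rule ex_mult_le)
    also have "\<dots> \<le> nrm (?u S) * (del * nrm (?u S'))"
      by (rule mult_left_mono[OF approx[OF SI] nrm_nonneg])
    also have "\<dots> \<le> (M\<^sup>2 * nrm h) * (del * (M\<^sup>2 * nrm h))"
      by (intro mult_mono nrm_comp_square_le[OF h] SI) (simp_all add: del_nonneg)
    also have "\<dots> = ?e" by (simp add: power2_eq_square power4_eq_xxxx)
    finally show ?thesis using 1 2 by simp
  qed
  have "ex (\<lambda>x. (\<Sum>S\<in>low K. ?u S x)\<^sup>2) = (\<Sum>S\<in>low K. \<Sum>S'\<in>low K. ex (\<lambda>x. ?u S x * ?u S' x))"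
    by (subst power2_eq_square) (simp only: sum_product ex_sum)
  also have "\<dots> \<le> (\<Sum>S\<in>low K. \<Sum>S'\<in>low K. (\<Sum>T\<in>low K. if T \<subseteq> S \<and> T \<subseteq> S' then ?p T S S' else 0) + ?e)"
  proof (intro sum_mono)
    fix S S' assume S: "S \<in> low K" "S' \<in> low K"
    have "S \<inter> S' \<in> low K"
      using S card_mono[OF finite_sub, of S "S \<inter> S'"] by (auto simp: low_def)
    then have "?p (S \<inter> S') S S' \<le> (\<Sum>T\<in>low K. if T \<subseteq> S \<and> T \<subseteq> S' then ?p T S S' else 0)"
      using member_le_sum[of "S \<inter> S'" "low K" "\<lambda>T. if T \<subseteq> S \<and> T \<subseteq> S' then ?p T S S' else 0"] p_nonneg
      by simp
    with pair[OF S] show "ex (\<lambda>x. ?u S x * ?u S' x)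
      \<le> (\<Sum>T\<in>low K. if T \<subseteq> S \<and> T \<subseteq> S' then ?p T S S' else 0) + ?e" by linarith
  qed
  also have "\<dots> = (\<Sum>S\<in>low K. \<Sum>S'\<in>low K. \<Sum>T\<in>low K. if T \<subseteq> S \<and> T \<subseteq> S' then ?p T S S' else 0)
      + real (card (low K)) * real (card (low K)) * ?e"
    by (simp add: sum.distrib)
  also have "(\<Sum>S\<in>low K. \<Sum>S'\<in>low K. \<Sum>T\<in>low K. if T \<subseteq> S \<and> T \<subseteq> S' then ?p T S S' else 0)
    = (\<Sum>S\<in>low K. \<Sum>T\<in>low K. \<Sum>S'\<in>low K. if T \<subseteq> S \<and> T \<subseteq> S' then ?p T S S' else 0)"
    by (intro sum.cong refl sum.swap)
  also have "\<dots> = (\<Sum>T\<in>low K. \<Sum>S\<in>low K. \<Sum>S'\<in>low K. if T \<subseteq> S \<and> T \<subseteq> S' then ?p T S S' else 0)"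
    by (rule sum.swap)
  also have "\<dots> = (\<Sum>T\<in>low K. ex (\<lambda>x. (pile K h T x)\<^sup>2))"
  proof (rule sum.cong[OF refl])
    fix T
    have "ex (\<lambda>x. (pile K h T x)\<^sup>2) = (\<Sum>S\<in>{S\<in>low K. T \<subseteq> S}. \<Sum>S'\<in>{S'\<in>low K. T \<subseteq> S'}. ?p T S S')"
      by (subst power2_eq_square) (simp only: pile_def sum_product ex_sum)
    also have "\<dots> = (\<Sum>S\<in>low K. if T \<subseteq> S then \<Sum>S'\<in>low K. if T \<subseteq> S' then ?p T S S' else 0 else 0)"
      by (simp add: sum.inter_filter)
    also have "\<dots> = (\<Sum>S\<in>low K. \<Sum>S'\<in>low K. if T \<subseteq> S \<and> T \<subseteq> S' then ?p T S S' else 0)"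
      by (intro sum.cong) auto
    finally show "(\<Sum>S\<in>low K. \<Sum>S'\<in>low K. if T \<subseteq> S \<and> T \<subseteq> S' then ?p T S S' else 0)
      = ex (\<lambda>x. (pile K h T x)\<^sup>2)" ..
  qed
  also have "real (card (low K)) * real (card (low K)) * ?e \<le> M * M * ?e"
    using card_family_le[OF low_subset] del_nonneg by (intro mult_right_mono mult_mono) auto
  finally show ?thesis by (simp add: numeral_eq_Suc mult_ac)
qed

lemma square_mob_le:
  assumes "finite S"
  shows "(mob a S)\<^sup>2 \<le> 2 ^ card S * (\<Sum>T\<in>Pow S. (a T)\<^sup>2)"
proof -
  have "(mob a S)\<^sup>2 \<le> (\<Sum>T\<in>Pow S. ((- 1) ^ card (S - T))\<^sup>2) * (\<Sum>T\<in>Pow S. (a T)\<^sup>2)"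
    unfolding mob_def by (rule Cauchy_Schwarz_ineq_sum)
  also have "(\<Sum>T\<in>Pow S. ((- 1 :: real) ^ card (S - T))\<^sup>2) = 2 ^ card S"
    using assms by (simp add: card_Pow power2_eq_square)
  finally show ?thesis .
qed

lemma ex_pile:
  "ex (pile K h T) = (\<Sum>S\<in>{S\<in>low K. T \<subseteq> S}. wt S h)"
  unfolding pile_def ex_sum ex_cond wt_def ..

lemma meas_pile: "meas T (pile K h T)"
  unfolding pile_def by (intro meas_sum meas_cond)

lemma pile_nonneg: "0 \<le> pile K h T x"
  unfolding pile_def by (intro sum_nonneg cond_nonneg) simp

text \<open>Crude by a power of \<open>M\<close>; it enters only the coefficient of an error
  term.\<close>

lemma pile_le:
  assumes h: "\<And>y. y \<in> Om \<Longrightarrow> \<bar>h y\<bar> \<le> 1" and "x \<in> Om"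
  shows "pile K h T x \<le> M ^ 3"
proof -
  have "pile K h T x \<le> real (card {S\<in>low K. T \<subseteq> S}) * M\<^sup>2"
    unfolding pile_def
  proof (rule sum_bounded_above)
    fix S assume "S \<in> {S\<in>low K. T \<subseteq> S}"
    then have S: "S \<subseteq> I" by (auto simp: low_def)
    have "\<bar>(comp S h y)\<^sup>2\<bar> \<le> M\<^sup>2" if "y \<in> Om" for y
      using power_mono[OF abs_comp_le[OF S h that] abs_ge_zero, where n = 2] by simp
    from abs_cond_le[OF this assms(2)] show "cond T (\<lambda>y. (comp S h y)\<^sup>2) x \<le> M\<^sup>2"
      by (simp add: abs_le_iff)
  qed
  also have "\<dots> \<le> M * M\<^sup>2"
    by (intro mult_right_mono card_family_le) (auto simp: low_def)
  finally show ?thesis by (simp add: power2_eq_square power3_eq_cube)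
qed

lemma nrm_pile_le:
  assumes h: "\<And>y. y \<in> Om \<Longrightarrow> \<bar>h y\<bar> \<le> 1"
  shows "nrm (pile K h T) \<le> M ^ 3 * nrm h"
proof -
  have "nrm (pile K h T) \<le> real (card {S\<in>low K. T \<subseteq> S}) * (M\<^sup>2 * nrm h)"
    unfolding pile_def[abs_def]
  proof (rule nrm_sum_le_card)
    fix S assume "S \<in> {S\<in>low K. T \<subseteq> S}"
    then have "S \<subseteq> I" by (auto simp: low_def)
    from order_trans[OF nrm_cond_le nrm_comp_square_le[where h = h, OF h this]]
    show "nrm (cond T (\<lambda>y. (comp S h y)\<^sup>2)) \<le> M\<^sup>2 * nrm h" .
  qed
  also have "\<dots> \<le> M * (M\<^sup>2 * nrm h)"
    by (intro mult_right_mono card_family_le) (auto simp: low_def)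
  finally show ?thesis by (simp add: power2_eq_square power3_eq_cube)
qed

text \<open>One factor \<open>pile\<close> is kept as a weight and the other is unfolded; as the
  weight sees only \<open>T\<close>, the projections in the unfolded factor disappear. Weighted
  Parseval turns the sum of squares into the square of a sum, which is alternating over
  \<open>A \<subseteq> T\<close>. One \<open>2 ^ card T\<close> comes from Cauchy-Schwarz, the other
  from the number of sets \<open>A\<close>.\<close>

lemma ex_pile_square_le:
  assumes f: "\<And>y. y \<in> Om \<Longrightarrow> f y \<in> {0, 1}" and "T \<subseteq> I"
    and glob: "\<And>A x. A \<subseteq> T \<Longrightarrow> x \<in> Om \<Longrightarrow> cond A f x \<le> eps"
  shows "ex (\<lambda>x. (pile K f T x)\<^sup>2) \<le> 4 ^ card T * eps * ex (pile K f T) + 2 * M ^ 7 * del * (nrm f)\<^sup>2"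
proof -
  let ?v = "pile K f T"
  let ?G = "{S. S \<subseteq> I \<and> T \<subseteq> S}"
  let ?c = "\<lambda>A. cond (A \<union> (I - T)) f"
  have h: "\<bar>f y\<bar> \<le> 1" if "y \<in> Om" for y using f[OF that] by auto
  have fT: "finite T" using finite_sub assms by blast
  have fG: "finite ?G" using finite_I by simp
  have "ex (\<lambda>x. (?v x)\<^sup>2) = (\<Sum>S\<in>{S\<in>low K. T \<subseteq> S}. ex (\<lambda>x. ?v x * cond T (\<lambda>y. (comp S f y)\<^sup>2) x))"
  proof -
    have "(?v x)\<^sup>2 = (\<Sum>S\<in>{S\<in>low K. T \<subseteq> S}. ?v x * cond T (\<lambda>y. (comp S f y)\<^sup>2) x)" for x
      unfolding sum_distrib_left[symmetric] pile_def[symmetric] by (rule power2_eq_square)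
    then show ?thesis by (simp only: ex_sum)
  qed
  also have "\<dots> = (\<Sum>S\<in>{S\<in>low K. T \<subseteq> S}. ex (\<lambda>x. ?v x * (comp S f x)\<^sup>2))"
    by (simp only: ex_mult_cond[OF meas_pile])
  \<comment> \<open>Sets larger than \<open>K\<close> are added, which is allowed because the terms
    are nonnegative: only the sum over all \<open>S\<close> above \<open>T\<close> collapses by
    \<open>sum_mob_Un\<close>.\<close>
  also have "\<dots> \<le> (\<Sum>S\<in>?G. ex (\<lambda>x. ?v x * (comp S f x)\<^sup>2))"
    by (rule sum_mono2[OF fG]) (auto simp: low_def intro!: ex_nonneg mult_nonneg_nonneg pile_nonneg)
  also have "\<dots> \<le> ex (\<lambda>x. ?v x * (\<Sum>S\<in>?G. comp S f x)\<^sup>2) + M ^ 3 * M ^ 4 * del * (nrm f)\<^sup>2"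
  proof -
    have "\<bar>?v x\<bar> \<le> M ^ 3" if "x \<in> Om" for x
      using pile_le[where h = f, OF h that] pile_nonneg by (simp add: abs_le_iff order_trans[OF _ pile_nonneg])
    then have "\<bar>ex (\<lambda>x. ?v x * (\<Sum>S\<in>?G. comp S f x)\<^sup>2) - (\<Sum>S\<in>?G. ex (\<lambda>x. ?v x * (comp S f x)\<^sup>2))\<bar>
      \<le> M ^ 3 * M ^ 4 * del * (nrm f)\<^sup>2"
      by (intro weighted_parseval[OF _ _ meas_pile]) auto
    then show ?thesis by linarith
  qed
  finally have 1: "ex (\<lambda>x. (?v x)\<^sup>2) \<le> ex (\<lambda>x. ?v x * (\<Sum>S\<in>?G. comp S f x)\<^sup>2)
    + M ^ 3 * M ^ 4 * del * (nrm f)\<^sup>2" .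
  have "ex (\<lambda>x. ?v x * (\<Sum>S\<in>?G. comp S f x)\<^sup>2) \<le> ex (\<lambda>x. ?v x * (2 ^ card T * (\<Sum>A\<in>Pow T. ?c A x)))"
  proof (intro ex_mono mult_left_mono pile_nonneg)
    fix x assume x: "x \<in> Om"
    have "?G = (\<lambda>R. T \<union> R) ` Pow (I - T)"
    proof (intro equalityI subsetI)
      fix S assume "S \<in> ?G"
      then have "S = T \<union> (S - T)" "S - T \<in> Pow (I - T)" by auto
      then show "S \<in> (\<lambda>R. T \<union> R) ` Pow (I - T)" by (rule image_eqI)
    qed (use assms in auto)
    moreover have "inj_on (\<lambda>R. T \<union> R) (Pow (I - T))" by (auto simp: inj_on_def)
    ultimately have "(\<Sum>S\<in>?G. comp S f x) = (\<Sum>R\<in>Pow (I - T). comp (T \<union> R) f x)"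
      by (simp add: sum.reindex)
    also have "\<dots> = mob (\<lambda>A. ?c A x) T"
      unfolding comp_def by (rule sum_mob_Un) (use finite_I fT in auto)
    finally have "(\<Sum>S\<in>?G. comp S f x)\<^sup>2 \<le> 2 ^ card T * (\<Sum>A\<in>Pow T. (?c A x)\<^sup>2)"
      using square_mob_le[OF fT] by simp
    also have "\<dots> \<le> 2 ^ card T * (\<Sum>A\<in>Pow T. ?c A x)"
    proof (intro mult_left_mono sum_mono)
      fix A
      \<comment> \<open>No bound by \<open>eps\<close> is available for \<open>?c A\<close> itself,
        since it fixes coordinates outside \<open>T\<close>. Jensen and \<open>f ^ 2 = f\<close>
        make the bound linear in \<open>?c A\<close>, and then averaging out \<open>I - T\<close>
        leaves \<open>cond A f\<close>, which is at most \<open>eps\<close>.\<close>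
      have "(?c A x)\<^sup>2 \<le> cond (A \<union> (I - T)) (\<lambda>y. (f y)\<^sup>2) x" by (rule cond_square_le[OF x])
      also have "\<dots> = ?c A x" by (rule cond_cong) (use f in fastforce)
      finally show "(?c A x)\<^sup>2 \<le> ?c A x" .
    qed simp
    finally show "(\<Sum>S\<in>?G. comp S f x)\<^sup>2 \<le> 2 ^ card T * (\<Sum>A\<in>Pow T. ?c A x)" .
  qed
  also have "\<dots> = 2 ^ card T * (\<Sum>A\<in>Pow T. ex (\<lambda>x. ?v x * ?c A x))"
    by (simp only: mult.left_commute[of _ "2 ^ card T"] ex_cmult) (simp only: sum_distrib_left ex_sum)
  also have "\<dots> \<le> 2 ^ card T * (real (card (Pow T)) * (eps * ex ?v + M ^ 3 * del * (nrm f)\<^sup>2))"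
  proof (intro mult_left_mono sum_bounded_above)
    fix A assume "A \<in> Pow T"
    then have A: "A \<subseteq> T" "T \<inter> (A \<union> (I - T)) = A" "A \<union> (I - T) \<subseteq> I" using assms by auto
    let ?r = "\<lambda>x. cond T (?c A) x - cond A f x"
    have "ex (\<lambda>x. ?v x * ?c A x) = ex (\<lambda>x. ?v x * cond T (?c A) x)"
      by (rule ex_mult_cond[OF meas_pile, symmetric])
    also have "\<dots> = ex (\<lambda>x. ?v x * cond A f x) + ex (\<lambda>x. ?v x * ?r x)"
      unfolding ex_add[symmetric] by (rule ex_cong) (simp add: algebra_simps)
    finally have 1: "ex (\<lambda>x. ?v x * ?c A x) = ex (\<lambda>x. ?v x * cond A f x) + ex (\<lambda>x. ?v x * ?r x)" .
    have 2: "ex (\<lambda>x. ?v x * cond A f x) \<le> eps * ex ?v"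
      unfolding ex_cmult[symmetric] using mult_left_mono[OF glob[OF A(1)] pile_nonneg]
      by (intro ex_mono) (simp add: mult.commute)
    have "ex (\<lambda>x. ?v x * ?r x) \<le> nrm ?v * nrm ?r" by (rule ex_mult_le)
    also have "\<dots> \<le> (M ^ 3 * nrm f) * (del * nrm f)"
      using approx[OF assms(2) A(3), of f] A(2) by (intro mult_mono nrm_pile_le h) auto
    finally show "ex (\<lambda>x. ?v x * ?c A x) \<le> eps * ex ?v + M ^ 3 * del * (nrm f)\<^sup>2"
      using 1 2 by (simp add: power2_eq_square mult_ac)
  qed simp
  also have "\<dots> = 4 ^ card T * eps * ex ?v + (2 ^ card T)\<^sup>2 * (M ^ 3 * del * (nrm f)\<^sup>2)"
  proof -
    have "(4::real) ^ card T = 2 ^ card T * 2 ^ card T" by (simp flip: power_mult_distrib)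
    then show ?thesis using fT by (simp add: card_Pow power2_eq_square algebra_simps)
  qed
  finally have 2: "ex (\<lambda>x. ?v x * (\<Sum>S\<in>?G. comp S f x)\<^sup>2)
    \<le> 4 ^ card T * eps * ex ?v + (2 ^ card T)\<^sup>2 * (M ^ 3 * del * (nrm f)\<^sup>2)" .
  have "(2 ^ card T)\<^sup>2 * (M ^ 3 * del * (nrm f)\<^sup>2) \<le> M ^ 4 * (M ^ 3 * del * (nrm f)\<^sup>2)"
  proof (rule mult_right_mono)
    have "(2 ^ card T)\<^sup>2 \<le> M\<^sup>2" by (intro power_mono two_power_card_le assms) simp
    also have "\<dots> \<le> M ^ 4" by (rule power_increasing) (use M_ge_1 in auto)
    finally show "(2 ^ card T)\<^sup>2 \<le> M ^ 4" .
  qed (simp add: del_nonneg)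
  also have "\<dots> = M ^ 3 * M ^ 4 * del * (nrm f)\<^sup>2" by simp
  finally have "ex (\<lambda>x. (?v x)\<^sup>2) \<le> 4 ^ card T * eps * ex ?v + 2 * (M ^ 3 * M ^ 4 * del * (nrm f)\<^sup>2)"
    using 1 2 by linarith
  then show ?thesis by (simp flip: power_add)
qed

lemma sum_wt_le: "(\<Sum>S\<in>Pow I. wt S h) \<le> (1 + M ^ 4 * del) * (nrm h)\<^sup>2"
proof -
  have "(\<Sum>S\<in>Pow I. wt S h) \<le> (nrm (cond I h))\<^sup>2 + M ^ 4 * del * (nrm h)\<^sup>2"
    using parseval[of I h] by (auto simp: nrm_square abs_le_iff)
  also have "(nrm (cond I h))\<^sup>2 \<le> (nrm h)\<^sup>2"
    by (intro power_mono nrm_cond_le) simp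
  finally show ?thesis by (simp add: algebra_simps)
qed

text \<open>8 is 4 times 2: \<open>4 ^ K\<close> comes from the second moment of each pile, and
  \<open>2 ^ K\<close> bounds the number of sets \<open>T \<subseteq> S\<close> for which
  \<open>wt S f\<close> is counted.\<close>

lemma global_fourth_moment_le:
  assumes f: "\<And>y. y \<in> Om \<Longrightarrow> f y \<in> {0, 1}" and eps: "0 \<le> eps"
    and glob: "\<And>A x. A \<in> low K \<Longrightarrow> x \<in> Om \<Longrightarrow> cond A f x \<le> eps"
  shows "ex (\<lambda>x. (\<Sum>S\<in>low K. (1/4) ^ card S * comp S f x) ^ 4)
    \<le> (8 ^ K * eps * (1 + M ^ 4 * del) + 5 * M ^ 9 * del) * (nrm f)\<^sup>2"
proof -
  have h: "\<bar>f y\<bar> \<le> 1" if "y \<in> Om" for y using f[OF that] by auto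
  let ?d = "del * (nrm f)\<^sup>2"
  have d: "0 \<le> ?d" using del_nonneg by simp
  have "(\<Sum>T\<in>low K. ex (\<lambda>x. (pile K f T x)\<^sup>2))
    \<le> (\<Sum>T\<in>low K. 4 ^ K * eps * (\<Sum>S\<in>{S\<in>low K. T \<subseteq> S}. wt S f) + 2 * M ^ 7 * ?d)"
  proof (rule sum_mono)
    fix T assume T: "T \<in> low K"
    then have TI: "T \<subseteq> I" "card T \<le> K" by (auto simp: low_def)
    have "A \<in> low K" if "A \<subseteq> T" for A
      using TI that card_mono[OF finite_sub[OF TI(1)] that] by (auto simp: low_def)
    from ex_pile_square_le[where f = f and K = K, OF f TI(1) glob[OF this]]
    have "ex (\<lambda>x. (pile K f T x)\<^sup>2)
      \<le> 4 ^ card T * eps * (\<Sum>S\<in>{S\<in>low K. T \<subseteq> S}. wt S f) + 2 * M ^ 7 * ?d"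
      by (simp add: ex_pile mult.assoc)
    also have "4 ^ card T * eps * (\<Sum>S\<in>{S\<in>low K. T \<subseteq> S}. wt S f)
      \<le> 4 ^ K * eps * (\<Sum>S\<in>{S\<in>low K. T \<subseteq> S}. wt S f)"
      by (intro mult_right_mono power_increasing TI eps sum_nonneg) simp_all
    finally show "ex (\<lambda>x. (pile K f T x)\<^sup>2)
      \<le> 4 ^ K * eps * (\<Sum>S\<in>{S\<in>low K. T \<subseteq> S}. wt S f) + 2 * M ^ 7 * ?d" by simp
  qed
  also have "\<dots> = 4 ^ K * eps * (\<Sum>T\<in>low K. \<Sum>S | S \<in> low K \<and> T \<subseteq> S. wt S f) + real (card (low K)) * (2 * M ^ 7 * ?d)"
    by (simp add: sum.distrib sum_distrib_left)
  finally have sum_pile: "(\<Sum>T\<in>low K. ex (\<lambda>x. (pile K f T x)\<^sup>2))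
    \<le> 4 ^ K * eps * (\<Sum>T\<in>low K. \<Sum>S | S \<in> low K \<and> T \<subseteq> S. wt S f) + real (card (low K)) * (2 * M ^ 7 * ?d)" .
  have "(\<Sum>T\<in>low K. \<Sum>S | S \<in> low K \<and> T \<subseteq> S. wt S f) = (\<Sum>S\<in>low K. \<Sum>T | T \<in> low K \<and> T \<subseteq> S. wt S f)"
    by (rule sum.swap_restrict) auto
  also have "\<dots> \<le> (\<Sum>S\<in>Pow I. 2 ^ K * wt S f)"
  proof (rule order_trans[OF sum_mono sum_mono2])
    show "finite (Pow I)" "low K \<subseteq> Pow I" using finite_I low_subset by auto
    fix S assume S: "S \<in> low K"
    then have fS: "finite S" using finite_sub by (auto simp: low_def)
    have "real (card {T \<in> low K. T \<subseteq> S}) \<le> real (card (Pow S))"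
      by (intro of_nat_mono card_mono) (use fS in auto)
    also have "\<dots> \<le> 2 ^ K"
      using S fS by (simp add: card_Pow low_def power_increasing)
    finally show "(\<Sum>T | T \<in> low K \<and> T \<subseteq> S. wt S f) \<le> 2 ^ K * wt S f"
      by (simp add: mult_right_mono)
  qed simp
  also have "\<dots> \<le> 2 ^ K * ((1 + M ^ 4 * del) * (nrm f)\<^sup>2)"
    unfolding sum_distrib_left[symmetric] by (intro mult_left_mono sum_wt_le) simp
  finally have "4 ^ K * eps * (\<Sum>T\<in>low K. \<Sum>S | S \<in> low K \<and> T \<subseteq> S. wt S f)
    \<le> 4 ^ K * eps * (2 ^ K * ((1 + M ^ 4 * del) * (nrm f)\<^sup>2))"
    by (intro mult_left_mono) (simp_all add: eps)
  moreover have "real (card (low K)) * (2 * M ^ 7 * ?d) \<le> M * (2 * M ^ 7 * ?d)"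
    by (intro mult_right_mono card_family_le low_subset mult_nonneg_nonneg[OF _ d]) simp
  moreover have "M * (2 * M ^ 7 * ?d) = 2 * M ^ 8 * ?d"
    by (simp add: numeral_eq_Suc)
  ultimately have 1: "(\<Sum>T\<in>low K. ex (\<lambda>x. (pile K f T x)\<^sup>2))
    \<le> 4 ^ K * eps * (2 ^ K * ((1 + M ^ 4 * del) * (nrm f)\<^sup>2)) + 2 * M ^ 8 * ?d"
    using sum_pile by linarith
  \<comment> \<open>The errors are \<open>2 * M ^ 8\<close> from the piles, \<open>M ^ 6\<close>
    from the square function and \<open>2 * M ^ 9\<close> from the symmetrization. All are rounded
    up to \<open>M ^ 9\<close>, which makes 5.\<close>
  have pw: "M ^ a * ?d \<le> M ^ 9 * ?d" if "a \<le> 9" for a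
    by (intro mult_right_mono power_increasing that M_ge_1 d)
  have "real (card I) \<le> M"
    unfolding M_def by (simp add: of_nat_less_two_power less_imp_le)
  then have "real (card I) * (2 * M ^ 8 * ?d) \<le> M * (2 * M ^ 8 * ?d)"
    by (intro mult_right_mono mult_nonneg_nonneg[OF _ d]) simp_all
  then have "real (card I) * (2 * M ^ 8 * ?d) \<le> 2 * (M ^ 9 * ?d)"
    by (simp add: numeral_eq_Suc mult_ac)
  with 1 fourth_moment_le[where h = f, OF h low_subset[of K]] ex_squares_le[where h = f and K = K, OF h] pw[of 6] pw[of 8]
  have "ex (\<lambda>x. (\<Sum>S\<in>low K. (1/4) ^ card S * comp S f x) ^ 4)
    \<le> 4 ^ K * eps * (2 ^ K * ((1 + M ^ 4 * del) * (nrm f)\<^sup>2)) + 5 * (M ^ 9 * ?d)"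
    by (simp add: mult.assoc)
  also have "4 ^ K * eps * (2 ^ K * ((1 + M ^ 4 * del) * (nrm f)\<^sup>2))
    = (4 ^ K * 2 ^ K) * eps * (1 + M ^ 4 * del) * (nrm f)\<^sup>2" by simp
  also have "(4::real) ^ K * 2 ^ K = 8 ^ K" by (simp flip: power_mult_distrib)
  finally show ?thesis by (simp add: algebra_simps)
qed

section \<open>Functions of low influence\<close>

lemma err_le:
  assumes "del * M ^ 40 \<le> 1" "a \<le> 40"
  shows "M ^ a * del \<le> 1 / M ^ (40 - a)"
proof -
  have "M ^ a * M ^ (40 - a) = M ^ 40"
    using assms(2) by (simp flip: power_add)
  then have "M ^ a * del * M ^ (40 - a) = del * M ^ 40"
    by (metis mult.assoc mult.commute)
  then have "M ^ a * del * M ^ (40 - a) \<le> 1" using assms(1) by linarith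
  then show ?thesis by (subst pos_le_divide_eq) simp_all
qed

lemma cond_empty: "cond {} h x = ex h"
  using sum_mu by (simp add: cond_def cls_def agree_def ex_def)

lemma wt_empty: "wt {} h = (ex h)\<^sup>2"
  unfolding wt_def comp_def mob_empty cond_empty by simp

lemma var_eq: "ex (\<lambda>x. (h x - ex h)\<^sup>2) = ex (\<lambda>x. (h x)\<^sup>2) - (ex h)\<^sup>2"
proof -
  have "(\<lambda>x. (h x - ex h)\<^sup>2) = (\<lambda>x. ((h x)\<^sup>2 - (2 * ex h) * h x) + (ex h)\<^sup>2)"
    by (auto simp: power2_diff)
  then show ?thesis by (simp add: ex_add ex_diff ex_cmult power2_eq_square)
qed

text \<open>Each summand is the expected conditional variance of \<open>h\<close> given all
  coordinates of \<open>I\<close> except \<open>i\<close>.\<close>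

definition infl :: "(('i \<Rightarrow> 'v) \<Rightarrow> real) \<Rightarrow> real" where
  "infl h = (\<Sum>i\<in>I. ex (\<lambda>x. (h x)\<^sup>2) - ex (\<lambda>x. (cond (I - {i}) h x)\<^sup>2))"

text \<open>Passing to \<open>h = f - ex f\<close> leaves the influence unchanged but makes all
  errors proportional to the variance, so that they can be absorbed. The component of
  \<open>h\<close> at the empty set is 0 and every other \<open>S\<close> has size at least 1, so
  the variance is bounded by errors alone, hence by half of itself.\<close>

lemma variance_eq_0_if_influence_le_0:
  assumes f: "meas I f" and small: "del * M ^ 40 \<le> 1" and "I \<noteq> {}" and "infl f \<le> 0"
  shows "ex (\<lambda>x. (f x)\<^sup>2) = (ex f)\<^sup>2"
proof -
  define h where "h x = f x - ex f" for x
  have h: "meas I h" unfolding h_def by (intro meas_comb[where F = "\<lambda>t. t - ex f"] f)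
  have "ex h = 0" by (simp add: h_def[abs_def] ex_diff)
  have "1 \<le> card I" using assms(3) finite_I by (simp add: Suc_le_eq card_gt_0_iff)
  then have "2 \<le> M" unfolding M_def using power_increasing[of 1 "card I" "2::real"] by simp
  have cond_h: "ex (\<lambda>x. (cond U h x)\<^sup>2) = ex (\<lambda>x. (cond U f x)\<^sup>2) - (ex f)\<^sup>2" for U
  proof -
    have "ex (\<lambda>x. (cond U h x)\<^sup>2) = ex (\<lambda>x. (cond U f x - ex (cond U f))\<^sup>2)"
      by (rule ex_cong) (simp add: h_def[abs_def] cond_diff cond_const ex_cond)
    then show ?thesis using var_eq[of "cond U f"] by (simp only: ex_cond)
  qed
  have var_h: "(nrm h)\<^sup>2 = ex (\<lambda>x. (f x)\<^sup>2) - (ex f)\<^sup>2"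
    by (simp add: nrm_square h_def var_eq)
  let ?d = "M ^ 4 * del * (nrm h)\<^sup>2"
  have "(\<Sum>S\<in>Pow I. card S * wt S h) \<le> infl h + card I * (2 * ?d)"
    using influence_ge[OF h] by (simp add: infl_def mult.assoc)
  also have "infl h = infl f"
    unfolding infl_def cond_h using var_h by (intro sum.cong) (simp_all add: nrm_square)
  finally have up: "(\<Sum>S\<in>Pow I. card S * wt S h) \<le> card I * (2 * ?d)" using assms(4) by linarith
  have "(\<Sum>S\<in>Pow I. wt S h) \<le> (\<Sum>S\<in>Pow I. card S * wt S h)"
  proof (rule sum_mono)
    fix S assume "S \<in> Pow I"
    then have "finite S" using finite_sub by auto
    show "wt S h \<le> card S * wt S h"
    proof (cases "S = {}")
      case True then show ?thesis using \<open>ex h = 0\<close> by (simp add: wt_empty)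
    next
      case False
      then have "1 \<le> card S" using \<open>finite S\<close> by (simp add: Suc_le_eq card_gt_0_iff)
      then show ?thesis using mult_right_mono[of 1 "real (card S)" "wt S h"] by simp
    qed
  qed
  moreover have "(nrm h)\<^sup>2 \<le> (\<Sum>S\<in>Pow I. wt S h) + ?d"
  proof -
    have "(nrm h)\<^sup>2 = ex (\<lambda>x. (cond I h x)\<^sup>2)"
      unfolding nrm_square by (rule ex_cong) (simp add: cond_id h)
    then show ?thesis using parseval[of I h] by (simp add: abs_le_iff)
  qed
  moreover have "real (card I) * (2 * ?d) \<le> M * (2 * ?d)"
    using del_nonneg by (intro mult_right_mono) (simp_all add: M_def of_nat_less_two_power less_imp_le)
  ultimately have "(nrm h)\<^sup>2 \<le> M * (2 * ?d) + ?d" using up by linarith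
  also have "\<dots> = (2 * (M ^ 5 * del) + M ^ 4 * del) * (nrm h)\<^sup>2"
    by (simp add: numeral_eq_Suc algebra_simps)
  finally have main: "(nrm h)\<^sup>2 \<le> (2 * (M ^ 5 * del) + M ^ 4 * del) * (nrm h)\<^sup>2" .
  \<comment> \<open>\<open>I \<noteq> {}\<close> gives \<open>M \<ge> 2\<close>, so both error
    factors are at most 1/8 and the total is at most 3/8.\<close>
  have "M ^ 3 \<le> M ^ 35" "M ^ 3 \<le> M ^ 36" by (rule power_increasing; use M_ge_1 in simp)+
  moreover have "8 \<le> M ^ 3" using power_mono[OF \<open>2 \<le> M\<close>, of 3] by simp
  ultimately have "8 \<le> M ^ 35" "8 \<le> M ^ 36" using order_trans by blast+
  then have "1 / M ^ 35 \<le> 1 / 8" "1 / M ^ 36 \<le> 1 / 8" using \<open>2 \<le> M\<close> by (auto intro!: divide_left_mono)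
  moreover have "M ^ 5 * del \<le> 1 / M ^ 35" "M ^ 4 * del \<le> 1 / M ^ 36"
    using err_le[OF small, of 5] err_le[OF small, of 4] by simp_all
  ultimately have "2 * (M ^ 5 * del) + M ^ 4 * del \<le> 1 / 2"
    by linarith
  then have "(2 * (M ^ 5 * del) + M ^ 4 * del) * (nrm h)\<^sup>2 \<le> 1 / 2 * (nrm h)\<^sup>2"
    by (rule mult_right_mono) simp
  with main have "(nrm h)\<^sup>2 \<le> 0" by linarith
  then have "(nrm h)\<^sup>2 = 0" by (simp add: order_antisym)
  then show ?thesis using var_h by simp
qed

text \<open>Write \<open>L\<close> for the weight of the nonempty low sets and \<open>H\<close> for
  that of the high sets. Up to errors, \<open>L + (K + 1) * H\<close> is at most \<open>K\<close>
  times the variance, and the variance is \<open>L + H\<close>. Hence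
  \<open>H \<le> (K - 1) * L\<close>, and the variance is at most \<open>K * L\<close>. For
  \<open>ex f \<le> 1/2\<close> the variance is at least half of \<open>ex f\<close>.\<close>

lemma low_weight_ge:
  assumes f: "\<And>x. x \<in> Om \<Longrightarrow> f x \<in> {0, 1}" "meas I f" and K: "1 \<le> K" "K \<le> card I"
    and infl: "infl f \<le> K * (ex f - (ex f)\<^sup>2)" and half: "ex f \<le> 1/2"
  shows "K * (\<Sum>S\<in>low K. wt S f) \<ge> ex f / 2 - 4 * (M ^ 5 * del) * ex f"
proof -
  define p where "p = ex f"
  have p: "(nrm f)\<^sup>2 = p" "ex (\<lambda>x. (f x)\<^sup>2) = p"
    unfolding nrm_square p_def by (rule ex_cong; use f(1) in fastforce)+
  have p0: "0 \<le> p" unfolding p_def by (rule ex_nonneg) (use f(1) in fastforce)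
  let ?d = "M ^ 4 * del * p"
  have d0: "0 \<le> ?d" using p0 del_nonneg by simp
  have cardI: "real (card I) \<le> M"
    by (simp add: M_def of_nat_less_two_power less_imp_le)
  define w0 where "w0 = wt {} f"
  define L where "L = (\<Sum>S\<in>low K - {{}}. wt S f)"
  define H where "H = (\<Sum>S\<in>Pow I - low K. wt S f)"
  have L0: "0 \<le> L" by (simp add: L_def sum_nonneg)
  have empty_low: "{} \<in> low K" by (simp add: low_def)
  have low: "(\<Sum>S\<in>low K. wt S f) = w0 + L"
    unfolding L_def w0_def by (rule sum.remove) (use empty_low in auto)
  have all: "(\<Sum>S\<in>Pow I. wt S f) = w0 + L + H"
    using sum.subset_diff[OF low_subset[of K], of "\<lambda>S. wt S f"] finite_I low unfolding H_def by simp
  have "(\<Sum>S\<in>Pow I. card S * wt S f)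
    = (\<Sum>S\<in>Pow I - low K. card S * wt S f) + (\<Sum>S\<in>low K. card S * wt S f)"
    by (rule sum.subset_diff[OF low_subset]) (use finite_I in simp)
  moreover have "(K + 1) * H \<le> (\<Sum>S\<in>Pow I - low K. card S * wt S f)"
    unfolding H_def sum_distrib_left
  proof (rule sum_mono)
    fix S assume "S \<in> Pow I - low K"
    then have "K + 1 \<le> card S" by (auto simp: low_def)
    then show "real (K + 1) * wt S f \<le> card S * wt S f" by (intro mult_right_mono of_nat_mono) simp_all
  qed
  moreover have "L \<le> (\<Sum>S\<in>low K. card S * wt S f)"
    unfolding L_def
  proof (rule order_trans[OF sum_mono sum_mono2])
    fix S assume S: "S \<in> low K - {{}}"
    then have "finite S" using finite_sub by (auto simp: low_def)
    then have "1 \<le> card S" using S by (simp add: Suc_le_eq card_gt_0_iff)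
    then show "wt S f \<le> card S * wt S f" using mult_right_mono[of 1 "real (card S)" "wt S f"] by simp
  qed auto
  ultimately have lo: "L + (K + 1) * H \<le> (\<Sum>S\<in>Pow I. card S * wt S f)" by linarith
  have "(\<Sum>S\<in>Pow I. card S * wt S f) \<le> K * (p - p\<^sup>2) + card I * (2 * ?d)"
    using influence_ge[OF f(2)] infl p by (simp add: infl_def p_def mult.assoc)
  also have "card I * (2 * ?d) \<le> M * (2 * ?d)"
    using cardI d0 by (intro mult_right_mono) auto
  finally have up: "L + (K + 1) * H \<le> K * (p - p\<^sup>2) + 2 * (M * ?d)" using lo by simp
  have w0: "w0 = p\<^sup>2" by (simp add: w0_def wt_empty p_def)
  have "p = ex (\<lambda>x. (cond I f x)\<^sup>2)"
    unfolding p(2)[symmetric] by (rule ex_cong) (simp add: cond_id f)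
  then have par: "p - p\<^sup>2 \<le> L + H + ?d"
    using parseval[of I f] all w0 p by (simp add: abs_le_iff)
  have "real K * (p - p\<^sup>2) \<le> K * (L + H + ?d)"
    by (rule mult_left_mono[OF par]) simp
  moreover have "real K * ?d \<le> M * ?d"
    using K cardI d0 by (intro mult_right_mono) auto
  ultimately have "H \<le> (real K - 1) * L + 3 * (M * ?d)"
    using up by (simp add: algebra_simps)
  moreover have "1 * ?d \<le> M * ?d" using M_ge_1 d0 by (intro mult_right_mono) auto
  ultimately have "p - p\<^sup>2 \<le> K * L + 4 * (M * ?d)"
    using par by (simp add: algebra_simps)
  moreover have "p\<^sup>2 \<le> p / 2"
    using mult_left_mono[OF half[folded p_def] p0] by (simp add: power2_eq_square)
  moreover have "K * L \<le> K * (\<Sum>S\<in>low K. wt S f)"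
    unfolding low w0_def by (intro mult_left_mono) simp_all
  moreover have "M * ?d = M ^ 5 * del * p" by (simp add: numeral_eq_Suc)
  ultimately show ?thesis unfolding p_def[symmetric] by simp
qed

text \<open>Hoelder's inequality with exponents 4/3 and 4, as Cauchy-Schwarz for \<open>g\<close>
  and again for \<open>g ^ 2\<close>; \<open>f * f = f\<close> keeps a factor \<open>f\<close> on
  both sides of each product.\<close>

lemma fourth_power_corr_le:
  assumes f: "\<And>x. x \<in> Om \<Longrightarrow> f x \<in> {0, 1}"
  shows "(ex (\<lambda>x. f x * g x)) ^ 4 \<le> (ex f) ^ 3 * ex (\<lambda>x. g x ^ 4)"
proof -
  have ff: "f x * f x = f x" if "x \<in> Om" for x using f[OF that] by auto
  have cs: "(ex (\<lambda>x. f x * g x))\<^sup>2 \<le> ex f * ex (\<lambda>x. (g x)\<^sup>2 * f x)" for g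
  proof -
    have "(ex (\<lambda>x. f x * (f x * g x)))\<^sup>2 \<le> (nrm f * nrm (\<lambda>x. f x * g x))\<^sup>2"
      using cauchy_schwarz[of f "\<lambda>x. f x * g x"] by (intro abs_le_square_iff[THEN iffD1]) simp
    also have "\<dots> = ex (\<lambda>x. (f x)\<^sup>2) * ex (\<lambda>x. (f x * g x)\<^sup>2)"
      by (simp only: power_mult_distrib nrm_square)
    also have "ex (\<lambda>x. (f x)\<^sup>2) = ex f"
      by (rule ex_cong) (simp add: power2_eq_square ff)
    also have "ex (\<lambda>x. (f x * g x)\<^sup>2) = ex (\<lambda>x. (g x)\<^sup>2 * f x)"
      by (rule ex_cong) (simp add: power_mult_distrib power2_eq_square[of "f _"] ff mult.commute)
    also have "ex (\<lambda>x. f x * (f x * g x)) = ex (\<lambda>x. f x * g x)"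
      by (rule ex_cong) (simp add: ff flip: mult.assoc)
    finally show ?thesis .
  qed
  have p0: "0 \<le> ex f" by (rule ex_nonneg) (use f in fastforce)
  have g0: "0 \<le> ex (\<lambda>x. (g x)\<^sup>2 * f x)"
    by (rule ex_nonneg) (use f in \<open>fastforce intro: mult_nonneg_nonneg\<close>)
  have "(ex (\<lambda>x. f x * g x)) ^ 4 = ((ex (\<lambda>x. f x * g x))\<^sup>2)\<^sup>2" by simp
  also have "\<dots> \<le> (ex f * ex (\<lambda>x. (g x)\<^sup>2 * f x))\<^sup>2"
    by (rule power_mono[OF cs]) simp
  also have "\<dots> = (ex f)\<^sup>2 * (ex (\<lambda>x. f x * (g x)\<^sup>2))\<^sup>2"
    by (simp add: power_mult_distrib mult.commute)
  also have "\<dots> \<le> (ex f)\<^sup>2 * (ex f * ex (\<lambda>x. ((g x)\<^sup>2)\<^sup>2 * f x))"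
    by (rule mult_left_mono[OF cs]) simp
  also have "\<dots> \<le> (ex f)\<^sup>2 * (ex f * ex (\<lambda>x. g x ^ 4))"
  proof (intro mult_left_mono ex_mono p0)
    fix x assume "x \<in> Om"
    then have "f x = 0 \<or> f x = 1" using f by auto
    then show "((g x)\<^sup>2)\<^sup>2 * f x \<le> g x ^ 4" by auto
  qed simp
  finally show ?thesis by (simp add: power2_eq_square power3_eq_cube mult.assoc)
qed

text \<open>With \<open>z = 2 ^ K\<close> and \<open>p = ex f\<close>: the correlation of
  \<open>f\<close> with its damped low part is at least \<open>p / (8 * z ^ 3)\<close>, while in the
  absence of a dense restriction its fourth power is at most \<open>p ^ 4\<close> times about
  \<open>z ^ 3 / z ^ 30\<close>. The factors \<open>p ^ 4\<close> cancel and the powers of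
  \<open>z\<close> contradict each other.\<close>

theorem dense_restriction:
  assumes f: "\<And>x. x \<in> Om \<Longrightarrow> f x \<in> {0, 1}" "meas I f" and K: "1 \<le> K" "K \<le> card I"
    and infl: "infl f \<le> K * (ex f - (ex f)\<^sup>2)" and "ex f \<noteq> 0" and small: "del * M ^ 40 \<le> 1"
  shows "\<exists>A\<in>low K. \<exists>x\<in>Om. cond A f x > 1 / (2 ^ K) ^ 30"
proof (rule ccontr)
  define z :: real where "z = 2 ^ K"
  define p where "p = ex f"
  define W where "W = (\<Sum>S\<in>low K. wt S f)"
  assume "\<not> ?thesis"
  then have glob: "cond A f x \<le> 1 / z ^ 30" if "A \<in> low K" "x \<in> Om" for A x
    using that by (auto simp: z_def not_less)
  have p: "(nrm f)\<^sup>2 = p" unfolding nrm_square p_def by (rule ex_cong) (use f(1) in fastforce)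
  have "0 \<le> p" unfolding p_def by (rule ex_nonneg) (use f(1) in fastforce)
  with assms(6) have p0: "0 < p" by (simp add: p_def)
  have z2: "2 \<le> z" using power_increasing[OF K(1), of "2::real"] by (simp add: z_def)
  have zM: "z \<le> M" unfolding z_def M_def by (rule power_increasing) (use K in auto)
  have z0: "0 < z" using z2 by simp
  have Kz: "real K \<le> z" by (simp add: z_def of_nat_less_two_power less_imp_le)
  have zpow: "z ^ a * 2 ^ b \<le> M ^ c" if "a + b \<le> c" for a b c
  proof -
    have "z ^ a * 2 ^ b \<le> M ^ a * M ^ b"
      by (intro mult_mono power_mono) (use z2 zM z0 in auto)
    also have "\<dots> \<le> M ^ c" unfolding power_add[symmetric] by (rule power_increasing[OF that M_ge_1])
    finally show ?thesis .
  qed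
  \<comment> \<open>\<open>M\<close> dominates both 2 and \<open>z\<close>, so spare powers of
    \<open>M\<close> can be spent as either. The largest demand below is 9 + 17 + 12 = 38, within
    the budget of 40.\<close>
  have err: "M ^ a * del \<le> 1 / (z ^ c * 2 ^ b)" if "a + b + c \<le> 40" for a b c
  proof -
    have "M ^ a * del \<le> 1 / M ^ (40 - a)" using that by (intro err_le[OF small]) simp
    also have "\<dots> \<le> 1 / (z ^ c * 2 ^ b)"
      using that z0 by (intro divide_left_mono zpow) auto
    finally show ?thesis .
  qed
  have "Om \<noteq> {}" using sum_mu by auto
  then obtain x where "x \<in> Om" by auto
  \<comment> \<open>The empty restriction is among those of size at most \<open>K\<close>, so the
    contrary assumption gives the bound \<open>p \<le> 1/2\<close> that \<open>low_weight_ge\<close>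
    asks for.\<close>
  have "p = cond {} f x" by (simp add: p_def cond_empty)
  also have "\<dots> \<le> 1 / z ^ 30" by (rule glob) (auto simp: low_def \<open>x \<in> Om\<close>)
  also have "\<dots> \<le> 1 / z ^ 1" using z2 by (intro divide_left_mono power_increasing) auto
  also have "\<dots> \<le> 1 / 2" using z2 by (simp add: divide_simps)
  finally have half: "p \<le> 1 / 2" .
  have "4 * (M ^ 5 * del) * p \<le> p / 4"
    using mult_right_mono[OF err[of 5 4 0], of p] p0 by simp
  with low_weight_ge[OF f K infl] half have "p / 4 \<le> K * W"
    by (simp add: p_def W_def)
  also have "\<dots> \<le> z * W" by (intro mult_right_mono Kz) (simp add: W_def sum_nonneg)
  finally have W: "p / (4 * z) \<le> W" using z0 by (simp add: field_simps)
  let ?G = "\<lambda>x. \<Sum>S\<in>low K. (1/4) ^ card S * comp S f x"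
  have "ex (\<lambda>x. f x * ?G x) = (\<Sum>S\<in>low K. (1/4) ^ card S * ex (\<lambda>x. f x * comp S f x))"
    by (simp only: sum_distrib_left ex_sum mult.left_commute[of "f _"] ex_cmult)
  moreover have "(\<Sum>S\<in>low K. 1 / z\<^sup>2 * wt S f - M ^ 3 * del * p) \<le> \<dots>"
  proof (rule sum_mono)
    fix S assume "S \<in> low K"
    then have S: "S \<subseteq> I" "card S \<le> K" by (auto simp: low_def)
    have "1 / z\<^sup>2 = (1/4) ^ K"
    proof -
      have "z\<^sup>2 = 4 ^ K" unfolding z_def power2_eq_square power_mult_distrib[symmetric] by simp
      then show ?thesis by (simp add: power_one_over)
    qed
    also have "\<dots> \<le> (1/4) ^ card S" by (rule power_decreasing) (use S in auto)
    finally have "1 / z\<^sup>2 * wt S f \<le> (1/4) ^ card S * wt S f" by (rule mult_right_mono) simp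
    moreover have "(1/4) ^ card S * (M ^ 3 * del * p) \<le> 1 * (M ^ 3 * del * p)"
      using p0 del_nonneg by (intro mult_right_mono power_le_one) auto
    moreover have "(1/4) ^ card S * (wt S f - M ^ 3 * del * p) \<le> (1/4) ^ card S * ex (\<lambda>x. f x * comp S f x)"
      using ex_mult_comp_ge[OF f(2) S(1)] p by (intro mult_left_mono) auto
    ultimately show "1 / z\<^sup>2 * wt S f - M ^ 3 * del * p \<le> (1/4) ^ card S * ex (\<lambda>x. f x * comp S f x)"
      unfolding right_diff_distrib by linarith
  qed
  moreover have "(\<Sum>S\<in>low K. 1 / z\<^sup>2 * wt S f - M ^ 3 * del * p)
      = 1 / z\<^sup>2 * W - real (card (low K)) * (M ^ 3 * del * p)"
    by (simp add: sum_subtractf W_def sum_divide_distrib)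
  moreover have "real (card (low K)) * (M ^ 3 * del * p) \<le> M * (M ^ 3 * del * p)"
    using p0 del_nonneg by (intro mult_right_mono card_family_le low_subset) auto
  moreover have "1 / z\<^sup>2 * (p / (4 * z)) \<le> 1 / z\<^sup>2 * W" by (intro mult_left_mono W) simp
  \<comment> \<open>The main term is \<open>p / (4 * z ^ 3)\<close>; half of it pays for the errors,
    hence the 8.\<close>
  moreover have "M * (M ^ 3 * del * p) \<le> p / (8 * z ^ 3)"
    using mult_right_mono[OF err[of 4 3 3], of p] p0 by (simp add: numeral_eq_Suc mult_ac)
  moreover have "1 / z\<^sup>2 * (p / (4 * z)) = 2 * (p / (8 * z ^ 3))"
    by (simp add: power2_eq_square power3_eq_cube)
  ultimately have corr: "p / (8 * z ^ 3) \<le> ex (\<lambda>x. f x * ?G x)" by linarith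
  have "(p / (8 * z ^ 3)) ^ 4 \<le> (ex (\<lambda>x. f x * ?G x)) ^ 4"
    by (rule power_mono[OF corr]) (use p0 z0 in simp)
  also have "\<dots> \<le> p ^ 3 * ex (\<lambda>x. ?G x ^ 4)"
    unfolding p_def by (rule fourth_power_corr_le[OF f(1)])
  also have "\<dots> \<le> p ^ 3 * ((8 ^ K * (1 / z ^ 30) * (1 + M ^ 4 * del) + 5 * M ^ 9 * del) * p)"
    using global_fourth_moment_le[where f = f and K = K, OF f(1) _ glob] z0 p p0 by (intro mult_left_mono) auto
  also have "\<dots> = p ^ 4 * (8 ^ K * (1 / z ^ 30) * (1 + M ^ 4 * del) + 5 * M ^ 9 * del)"
    by (simp add: numeral_eq_Suc)
  also have "(p / (8 * z ^ 3)) ^ 4 = p ^ 4 * (1 / (8 * z ^ 3) ^ 4)"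
    by (simp add: power_divide)
  finally have "1 / (8 * z ^ 3) ^ 4 \<le> 8 ^ K * (1 / z ^ 30) * (1 + M ^ 4 * del) + 5 * M ^ 9 * del"
    by (rule mult_left_le_imp_le) (use p0 in simp)
  \<comment> \<open>30 - 3 = 27 = 12 + 15: twelve powers of \<open>z\<close> match the left side and
    the other fifteen are worth \<open>2 ^ 15\<close>, since \<open>K \<ge> 1\<close> gives
    \<open>z \<ge> 2\<close>. Two summands with \<open>2 ^ 14\<close> in the denominator then stay
    below the one with \<open>2 ^ 12\<close> on the left.\<close>
  also have "\<dots> \<le> 1 / (2 ^ 14 * z ^ 12) + 1 / (2 ^ 14 * z ^ 12)"
  proof (rule add_mono)
    have "(8::real) ^ K = z ^ 3" unfolding z_def power3_eq_cube power_mult_distrib[symmetric] by simp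
    then have "8 ^ K * (1 / z ^ 30) = 1 / z ^ 27"
      using z0 by (simp add: divide_simps flip: power_add)
    moreover have "2 ^ 15 * z ^ 12 \<le> z ^ 15 * z ^ 12"
      by (intro mult_right_mono power_mono) (use z2 in auto)
    then have "2 ^ 15 * z ^ 12 \<le> z ^ 27" by (simp flip: power_add)
    then have "1 / z ^ 27 \<le> 1 / (2 ^ 15 * z ^ 12)" using z0 by (intro divide_left_mono) auto
    ultimately have "8 ^ K * (1 / z ^ 30) \<le> 1 / (2 ^ 15 * z ^ 12)" by simp
    moreover have "1 + M ^ 4 * del \<le> 2" using err[of 4 0 0] by simp
    ultimately have "8 ^ K * (1 / z ^ 30) * (1 + M ^ 4 * del) \<le> 1 / (2 ^ 15 * z ^ 12) * 2"
      using z0 del_nonneg by (intro mult_mono) auto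
    then show "8 ^ K * (1 / z ^ 30) * (1 + M ^ 4 * del) \<le> 1 / (2 ^ 14 * z ^ 12)" by simp
    have "8 * (M ^ 9 * del) \<le> 8 * (1 / (z ^ 12 * 2 ^ 17))" by (intro mult_left_mono err) auto
    moreover have "5 * (M ^ 9 * del) \<le> 8 * (M ^ 9 * del)" using del_nonneg by (intro mult_right_mono) auto
    ultimately show "5 * M ^ 9 * del \<le> 1 / (2 ^ 14 * z ^ 12)" by (simp add: mult.commute)
  qed
  finally have "1 / (8 * z ^ 3) ^ 4 \<le> 2 / (2 ^ 14 * z ^ 12)" by simp
  moreover have "(8 * z ^ 3) ^ 4 = 2 ^ 12 * z ^ 12" by (simp add: power_mult_distrib flip: power_mult)
  ultimately show False using z0 by (simp add: divide_simps)
qed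

end

section \<open>From local to global spectral bounds\<close>

context coord_space
begin

lemma nrm_diff_trans:
  "nrm (\<lambda>x. a x - b x) \<le> s \<Longrightarrow> nrm (\<lambda>x. b x - c x) \<le> t \<Longrightarrow> nrm (\<lambda>x. a x - c x) \<le> s + t"
  using nrm_add_le[of "\<lambda>x. a x - b x" "\<lambda>x. b x - c x"] by simp

text \<open>The elements of \<open>Q\<close> are removed one at a time. Removing \<open>t\<close>
  from \<open>insert t (A \<union> Q)\<close> is an instance of \<open>pair\<close> over the base
  \<open>A \<union> Q\<close>; projecting it further to \<open>insert s A\<close> does not increase
  its norm.\<close>

lemma cond_insert_cond_Un:
  fixes g :: real
  assumes pair: "\<And>S i j h. S \<subseteq> I \<Longrightarrow> i \<in> I - S \<Longrightarrow> j \<in> I - S \<Longrightarrow> i \<noteq> j \<Longrightarrow>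
      nrm (\<lambda>x. cond (insert i S) (cond (insert j S) h) x - cond S h x) \<le> g * nrm h"
    and "finite Q" "Q \<subseteq> I" "A \<subseteq> I" "s \<in> I" "s \<notin> A \<union> Q" "A \<inter> Q = {}"
  shows "nrm (\<lambda>x. cond (insert s A) (cond (A \<union> Q) h) x - cond A h x) \<le> card Q * (g * nrm h)"
  using assms(2-)
proof (induction Q rule: finite_induct)
  case empty
  have "nrm (\<lambda>x. cond (insert s A) (cond A h) x - cond A h x) = nrm (\<lambda>_. 0)"
    by (rule nrm_cong) (simp add: cond_cond' subset_insertI)
  then show ?case by simp
next
  case (insert t Q)
  let ?B = "A \<union> Q"
  have "nrm (\<lambda>x. cond (insert s A) (cond (insert t ?B) h) x - cond (insert s A) (cond ?B h) x)
    = nrm (cond (insert s A) (\<lambda>x. cond (insert s ?B) (cond (insert t ?B) h) x - cond ?B h x))"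
  proof (rule nrm_cong)
    fix x assume "x \<in> Om"
    then show "cond (insert s A) (cond (insert t ?B) h) x - cond (insert s A) (cond ?B h) x
      = cond (insert s A) (\<lambda>x. cond (insert s ?B) (cond (insert t ?B) h) x - cond ?B h x) x"
      using cond_cond[OF insert_mono[OF Un_upper1], of x s A Q "cond (insert t ?B) h"] by (simp add: cond_diff)
  qed
  also have "\<dots> \<le> nrm (\<lambda>x. cond (insert s ?B) (cond (insert t ?B) h) x - cond ?B h x)"
    by (rule nrm_cond_le)
  also have "\<dots> \<le> g * nrm h"
    by (rule pair) (use insert in auto)
  finally have "nrm (\<lambda>x. cond (insert s A) (cond (insert t ?B) h) x - cond A h x)
    \<le> g * nrm h + card Q * (g * nrm h)"
    by (rule nrm_diff_trans) (use insert in auto)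
  then show ?case using insert.hyps by (simp add: algebra_simps)
qed

text \<open>The elements of \<open>P\<close> are added one at a time. For the base
  \<open>B = A \<union> P\<close>, the function \<open>cond (A \<union> Q) h\<close> is fixed by
  \<open>cond (B \<union> Q)\<close>, so the one-element case applies to it with \<open>B\<close> in
  place of \<open>A\<close>.\<close>

lemma cond_Un_cond_Un:
  fixes g :: real
  assumes pair: "\<And>S i j h. S \<subseteq> I \<Longrightarrow> i \<in> I - S \<Longrightarrow> j \<in> I - S \<Longrightarrow> i \<noteq> j \<Longrightarrow>
      nrm (\<lambda>x. cond (insert i S) (cond (insert j S) h) x - cond S h x) \<le> g * nrm h"
    and "0 \<le> g" and "finite Q" "Q \<subseteq> I" "A \<subseteq> I" "A \<inter> Q = {}"
    and "finite P" "P \<subseteq> I" "P \<inter> (A \<union> Q) = {}"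
  shows "nrm (\<lambda>x. cond (A \<union> P) (cond (A \<union> Q) h) x - cond A h x) \<le> card P * (card Q * (g * nrm h))"
  using assms(7-)
proof (induction P rule: finite_induct)
  case empty
  have "nrm (\<lambda>x. cond A (cond (A \<union> Q) h) x - cond A h x) = nrm (\<lambda>_. 0)"
    by (rule nrm_cong) (simp add: cond_cond)
  then show ?case by simp
next
  case (insert s P)
  let ?B = "A \<union> P" and ?h = "cond (A \<union> Q) h"
  have "nrm (\<lambda>x. cond (insert s ?B) ?h x - cond ?B ?h x)
    = nrm (\<lambda>x. cond (insert s ?B) (cond (?B \<union> Q) ?h) x - cond ?B ?h x)"
  proof (rule nrm_cong)
    fix x assume "x \<in> Om"
    have "cond (insert s ?B) (cond (?B \<union> Q) ?h) x = cond (insert s ?B) ?h x"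
      by (rule cond_cong) (auto intro!: cond_cond')
    then show "cond (insert s ?B) ?h x - cond ?B ?h x
      = cond (insert s ?B) (cond (?B \<union> Q) ?h) x - cond ?B ?h x" by simp
  qed
  also have "\<dots> \<le> card Q * (g * nrm ?h)"
    by (rule cond_insert_cond_Un[OF pair]) (use assms insert in auto)
  also have "\<dots> \<le> card Q * (g * nrm h)"
    by (intro mult_left_mono nrm_cond_le assms) simp
  finally have "nrm (\<lambda>x. cond (insert s ?B) ?h x - cond A h x)
    \<le> card Q * (g * nrm h) + card P * (card Q * (g * nrm h))"
    by (rule nrm_diff_trans) (use insert in auto)
  then show ?case using insert.hyps by (simp add: algebra_simps)
qed

lemma approx_from_pairs:
  fixes g :: real
  assumes pair: "\<And>S i j h. S \<subseteq> I \<Longrightarrow> i \<in> I - S \<Longrightarrow> j \<in> I - S \<Longrightarrow> i \<noteq> j \<Longrightarrow>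
      nrm (\<lambda>x. cond (insert i S) (cond (insert j S) h) x - cond S h x) \<le> g * nrm h"
    and "0 \<le> g" "finite I" "S \<subseteq> I" "T \<subseteq> I"
  shows "nrm (\<lambda>x. cond S (cond T h) x - cond (S \<inter> T) h x) \<le> (real (card I))\<^sup>2 * g * nrm h"
proof -
  have f: "finite S" "finite T" using assms finite_subset by auto
  have "nrm (\<lambda>x. cond (S \<inter> T \<union> (S - T)) (cond (S \<inter> T \<union> (T - S)) h) x - cond (S \<inter> T) h x)
    \<le> card (S - T) * (card (T - S) * (g * nrm h))"
    by (rule cond_Un_cond_Un[OF pair assms(2)]) (use assms f in auto)
  also have "S \<inter> T \<union> (S - T) = S" by auto
  also have "S \<inter> T \<union> (T - S) = T" by auto
  also have "card (S - T) * (card (T - S) * (g * nrm h)) \<le> card I * (card I * (g * nrm h))"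
    using assms by (intro mult_mono mult_nonneg_nonneg of_nat_mono card_mono) auto
  finally show ?thesis by (simp add: power2_eq_square mult.assoc)
qed

end

text \<open>The first-order condition at an extremum: otherwise \<open>t = - b / c\<close>, or
  \<open>t = - b\<close> for \<open>c = 0\<close>, would make the expression negative.\<close>

lemma quadratic_nonneg_imp_linear_zero:
  fixes b c :: real
  assumes "\<And>t. 0 \<le> 2 * t * b + t\<^sup>2 * c"
  shows "b = 0"
proof (rule ccontr)
  assume b: "b \<noteq> 0"
  have c: "0 \<le> c" using assms[of 1] assms[of "-1"] by simp
  show False
  proof (cases "c = 0")
    case True
    then have "0 \<le> - 2 * b\<^sup>2" using assms[of "-b"] by (simp add: power2_eq_square)
    moreover have "0 < b\<^sup>2" using b by simp
    ultimately show False by linarith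
  next
    case False
    have "2 * (- b / c) * b + (- b / c)\<^sup>2 * c = - (b\<^sup>2 / c)"
      using False by (simp add: power2_eq_square field_simps)
    moreover have "0 < b\<^sup>2 / c" using b c False by simp
    ultimately show False using assms[of "- b / c"] by linarith
  qed
qed

section \<open>Contraction of a reversible walk with bounded eigenvalues\<close>

text \<open>\<open>q\<close> holds unnormalized edge weights, so the degrees both normalize the walk
  and form its reversible measure in \<open>ip\<close>.\<close>

locale reversible_walk =
  fixes V :: "'a set" and q :: "'a \<Rightarrow> 'a \<Rightarrow> real"
  assumes finite_V: "finite V" and q_nonneg: "0 \<le> q u v" and q_sym: "q u v = q v u"
    and deg_pos: "v \<in> V \<Longrightarrow> 0 < (\<Sum>u\<in>V. q v u)"
begin

definition deg :: "'a \<Rightarrow> real" where "deg v = (\<Sum>u\<in>V. q v u)"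

definition walk :: "('a \<Rightarrow> real) \<Rightarrow> 'a \<Rightarrow> real" where
  "walk g v = (\<Sum>u\<in>V. q v u * g u) / deg v"

definition ip :: "('a \<Rightarrow> real) \<Rightarrow> ('a \<Rightarrow> real) \<Rightarrow> real" where
  "ip g h = (\<Sum>v\<in>V. deg v * (g v * h v))"

lemma deg_pos': "v \<in> V \<Longrightarrow> 0 < deg v"
  using deg_pos by (simp add: deg_def)

lemma ip_cong: "(\<And>v. v \<in> V \<Longrightarrow> g v = g' v) \<Longrightarrow> (\<And>v. v \<in> V \<Longrightarrow> h v = h' v) \<Longrightarrow> ip g h = ip g' h'"
  unfolding ip_def by (intro sum.cong) auto

lemma walk_cong: "(\<And>v. v \<in> V \<Longrightarrow> g v = g' v) \<Longrightarrow> walk g v = walk g' v"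
  unfolding walk_def by (intro arg_cong2[where f = "(/)"] sum.cong) auto

lemma ip_commute: "ip g h = ip h g"
  by (simp add: ip_def mult.commute)

lemma ip_add_right: "ip g (\<lambda>v. a * h v + b * h' v) = a * ip g h + b * ip g h'"
  unfolding ip_def sum_distrib_left sum.distrib[symmetric]
  by (rule sum.cong) (simp_all add: algebra_simps)

lemma ip_add_left: "ip (\<lambda>v. a * h v + b * h' v) g = a * ip h g + b * ip h' g"
  using ip_add_right[of g a h b h'] by (simp add: ip_commute)

lemma walk_add: "walk (\<lambda>v. a * h v + b * h' v) v = a * walk h v + b * walk h' v"
  unfolding walk_def times_divide_eq_right sum_distrib_left add_divide_distrib[symmetric] sum.distrib[symmetric]
  by (intro arg_cong2[where f = "(/)"] sum.cong) (simp_all add: algebra_simps)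

lemma ip_nonneg: "0 \<le> ip g g"
  unfolding ip_def by (intro sum_nonneg mult_nonneg_nonneg[OF _ zero_le_square] less_imp_le deg_pos')

lemma ip_eq_0: "ip g g = 0 \<Longrightarrow> v \<in> V \<Longrightarrow> g v = 0"
proof -
  assume *: "ip g g = 0" and v: "v \<in> V"
  have "\<forall>v\<in>V. deg v * (g v * g v) = 0"
    using * finite_V sum_nonneg_eq_0_iff[of V "\<lambda>v. deg v * (g v * g v)"]
    by (auto simp: ip_def less_imp_le deg_pos')
  then show "g v = 0" using v deg_pos'[OF v] by auto
qed

lemma ip_walk: "ip (walk g) h = ip g (walk h)"
proof -
  have l: "ip (walk g) h = (\<Sum>v\<in>V. \<Sum>u\<in>V. q v u * g u * h v)" for g h
    unfolding ip_def
  proof (rule sum.cong[OF refl])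
    fix v assume "v \<in> V"
    then have "deg v \<noteq> 0" using deg_pos' by force
    then show "deg v * (walk g v * h v) = (\<Sum>u\<in>V. q v u * g u * h v)"
      by (simp add: walk_def sum_distrib_right)
  qed
  have "ip (walk g) h = (\<Sum>u\<in>V. \<Sum>v\<in>V. q v u * g u * h v)"
    unfolding l by (rule sum.swap)
  also have "\<dots> = ip (walk h) g"
    unfolding l by (intro sum.cong refl) (metis q_sym mult.assoc mult.commute)
  finally show ?thesis by (simp only: ip_commute)
qed

lemma ip_walk_one: "ip (walk g) (\<lambda>_. 1) = ip g (\<lambda>_. 1)"
proof -
  have "walk (\<lambda>_. 1) v = 1" if "v \<in> V" for v
    using deg_pos'[OF that] by (simp add: walk_def deg_def)
  then show ?thesis unfolding ip_walk by (intro ip_cong) auto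
qed

lemma maximizer_exists:
  assumes "ip g (\<lambda>_. 1) = 0" "ip g g \<noteq> 0"
  shows "\<exists>g0. ip g0 g0 = 1 \<and> ip g0 (\<lambda>_. 1) = 0 \<and>
    (\<forall>h. ip h (\<lambda>_. 1) = 0 \<longrightarrow> ip (walk h) (walk h) \<le> ip (walk g0) (walk g0) * ip h h)"
proof -
  \<comment> \<open>Functions live on the whole type, so they are pinned to 0 outside
    \<open>V\<close> to get a compact box in the product topology. Inside \<open>V\<close> the box
    is no restriction, as \<open>ip g g = 1\<close> forces
    \<open>deg v * (g v) ^ 2 \<le> 1\<close>.\<close>
  define R where "R v = (if v \<in> V then {- (1 / sqrt (deg v))..1 / sqrt (deg v)} else {0})" for v
  define S where "S = {g \<in> PiE UNIV R. ip g g = 1 \<and> ip g (\<lambda>_. 1) = 0}"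
  have "compactin (product_topology (\<lambda>_. euclidean) UNIV) (PiE UNIV R)"
    unfolding compactin_PiE by (auto simp: R_def)
  then have cR: "compact (PiE UNIV R)"
    by (simp add: euclidean_product_topology)
  have cont: "continuous_on UNIV (\<lambda>g. ip g g)" "continuous_on UNIV (\<lambda>g. ip g (\<lambda>_. 1))"
    "continuous_on UNIV (\<lambda>g. ip (walk g) (walk g))"
    unfolding ip_def walk_def divide_inverse by (intro continuous_intros continuous_on_product_coordinates)+
  have "closed ({g. ip g g = 1} \<inter> {g. ip g (\<lambda>_. 1) = 0})"
    by (intro closed_Int closed_Collect_eq cont continuous_on_const)
  moreover have "S = PiE UNIV R \<inter> ({g. ip g g = 1} \<inter> {g. ip g (\<lambda>_. 1) = 0})"
    by (auto simp: S_def)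
  ultimately have cS: "compact S" using compact_Int_closed[OF cR] by simp
  have scale: "\<exists>g'\<in>S. \<forall>v\<in>V. h v = sqrt (ip h h) * g' v" if h: "ip h (\<lambda>_. 1) = 0" "ip h h \<noteq> 0" for h
  proof -
    define c where "c = sqrt (ip h h)"
    have c: "0 < c" "c * c = ip h h" using h ip_nonneg[of h] by (auto simp: c_def)
    \<comment> \<open>The summand \<open>0 * h v\<close> only brings the function into the shape of
      \<open>ip_add_left\<close>.\<close>
    define g' where "g' v = (if v \<in> V then (1 / c) * h v + 0 * h v else 0)" for v
    have g': "ip g' k = ip (\<lambda>v. (1 / c) * h v + 0 * h v) k" for k
      by (rule ip_cong) (simp_all add: g'_def)
    have "ip g' g' = (1 / c) * ((1 / c) * ip h h)"
      unfolding g' ip_add_left unfolding ip_commute[of h g'] g' ip_add_left by simp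
    then have one: "ip g' g' = 1" using c(1) unfolding c(2)[symmetric] by simp
    moreover have "ip g' (\<lambda>_. 1) = 0" unfolding g' ip_add_left using h by simp
    moreover have "g' \<in> PiE UNIV R"
    proof (intro PiE_I)
      fix v
      show "g' v \<in> R v"
      proof (cases "v \<in> V")
        case True
        have "deg v * (g' v * g' v) \<le> ip g' g'"
          unfolding ip_def by (rule member_le_sum) (use True finite_V in \<open>auto dest: deg_pos' less_imp_le\<close>)
        then have "(g' v)\<^sup>2 \<le> 1 / deg v"
          using deg_pos'[OF True] one by (simp add: field_simps power2_eq_square)
        then have "\<bar>g' v\<bar> \<le> sqrt (1 / deg v)"
          using real_le_rsqrt[of "\<bar>g' v\<bar>"] by simp
        then show ?thesis using True by (auto simp: R_def real_sqrt_divide abs_le_iff minus_le_iff)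
      qed (simp add: g'_def R_def)
    qed simp
    ultimately have "g' \<in> S" by (simp add: S_def)
    moreover have "\<forall>v\<in>V. h v = c * g' v" using c by (simp add: g'_def)
    ultimately show ?thesis unfolding c_def by blast
  qed
  have "S \<noteq> {}" using scale[OF assms] by auto
  with continuous_attains_sup[OF cS this continuous_on_subset[OF cont(3)]]
  obtain g0 where g0: "g0 \<in> S" and max: "\<And>h. h \<in> S \<Longrightarrow> ip (walk h) (walk h) \<le> ip (walk g0) (walk g0)"
    by auto
  have "ip (walk h) (walk h) \<le> ip (walk g0) (walk g0) * ip h h" if h: "ip h (\<lambda>_. 1) = 0" for h
  proof (cases "ip h h = 0")
    case True
    then have "walk h v = walk (\<lambda>_. 0) v" for v by (intro walk_cong) (rule ip_eq_0)
    then have "walk h = (\<lambda>_. 0)" by (auto simp: walk_def)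
    then show ?thesis using True by (simp add: ip_def)
  next
    case False
    with scale[OF h] obtain g' where g': "g' \<in> S" "\<And>v. v \<in> V \<Longrightarrow> h v = sqrt (ip h h) * g' v + 0 * g' v"
      by auto
    let ?c = "sqrt (ip h h)"
    have w: "walk h = (\<lambda>v. ?c * walk g' v + 0 * walk g' v)"
      unfolding walk_add[symmetric] by (intro ext walk_cong g'(2))
    have "ip (walk h) (walk h) = ?c * (?c * ip (walk g') (walk g'))"
      unfolding w ip_add_left unfolding ip_add_right by simp
    also have "\<dots> = ip (walk g') (walk g') * ip h h"
      using ip_nonneg[of h] by (simp flip: mult.assoc)
    also have "\<dots> \<le> ip (walk g0) (walk g0) * ip h h"
      by (intro mult_right_mono max g' ip_nonneg)
    finally show ?thesis .
  qed
  then show ?thesis using g0 by (auto simp: S_def)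
qed

text \<open>One extremal function replaces a diagonalization: a maximizer \<open>g0\<close> of the
  norm of \<open>walk g\<close> is an eigenvector of the squared walk with eigenvalue
  \<open>L\<close>. Then \<open>sqrt L\<close> or its negative is a nontrivial eigenvalue of
  \<open>walk\<close>, hence at most \<open>c\<close> in absolute value.\<close>

lemma walk_contracts:
  assumes eig: "\<And>r g. \<exists>v\<in>V. g v \<noteq> 0 \<Longrightarrow> ip g (\<lambda>_. 1) = 0 \<Longrightarrow> (\<And>v. v \<in> V \<Longrightarrow> walk g v = r * g v) \<Longrightarrow> \<bar>r\<bar> \<le> c"
    and g: "ip g (\<lambda>_. 1) = 0"
  shows "ip (walk g) (walk g) \<le> c\<^sup>2 * ip g g"
proof (cases "ip g g = 0")
  case True
  then have "walk g v = walk (\<lambda>_. 0) v" for v by (intro walk_cong) (rule ip_eq_0)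
  then have "walk g = (\<lambda>_. 0)" by (auto simp: walk_def)
  then show ?thesis using True by (simp add: ip_def)
next
  case False
  obtain g0 where g0: "ip g0 g0 = 1" "ip g0 (\<lambda>_. 1) = 0"
    and max: "\<And>h. ip h (\<lambda>_. 1) = 0 \<Longrightarrow> ip (walk h) (walk h) \<le> ip (walk g0) (walk g0) * ip h h"
    using maximizer_exists[OF g False] by blast
  define L where "L = ip (walk g0) (walk g0)"
  define l where "l = sqrt L"
  have L: "0 \<le> L" "l * l = L" "0 \<le> l" using ip_nonneg by (auto simp: L_def l_def)
  \<comment> \<open>Up to a factor 2, \<open>h\<close> is the gradient at \<open>g0\<close> of
    \<open>L * ip g g - ip (walk g) (walk g)\<close>, which is minimal there. Perturbing
    \<open>g0\<close> along \<open>h\<close> itself therefore forces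
    \<open>ip h h = 0\<close>.\<close>
  define h where "h v = L * g0 v + (- 1) * walk (walk g0) v" for v
  have h1: "ip h (\<lambda>_. 1) = 0"
    unfolding h_def ip_add_left by (simp add: ip_walk_one g0)
  have quad: "0 \<le> 2 * t * ip h h + t\<^sup>2 * (L * ip h h - ip (walk h) (walk h))" for t
  proof -
    let ?k = "\<lambda>v. 1 * g0 v + t * h v"
    have "ip ?k (\<lambda>_. 1) = 0" unfolding ip_add_left using g0 h1 by simp
    from max[OF this] have le: "ip (walk ?k) (walk ?k) \<le> L * ip ?k ?k" by (simp only: L_def)
    have 1: "ip ?k ?k = 1 + 2 * t * ip g0 h + t\<^sup>2 * ip h h"
      unfolding ip_add_left unfolding ip_add_right
      by (simp add: g0 ip_commute[of h g0] power2_eq_square algebra_simps)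
    have "walk ?k = (\<lambda>v. 1 * walk g0 v + t * walk h v)" by (intro ext walk_add)
    then have "ip (walk ?k) (walk ?k)
      = ip (\<lambda>v. 1 * walk g0 v + t * walk h v) (\<lambda>v. 1 * walk g0 v + t * walk h v)" by (simp only:)
    also have "\<dots> = L + 2 * t * ip (walk g0) (walk h) + t\<^sup>2 * ip (walk h) (walk h)"
      unfolding ip_add_left unfolding ip_add_right
      by (simp add: L_def ip_commute[of "walk h" "walk g0"] power2_eq_square algebra_simps)
    finally have 2: "L + 2 * t * ip (walk g0) (walk h) + t\<^sup>2 * ip (walk h) (walk h)
      \<le> L * (1 + 2 * t * ip g0 h + t\<^sup>2 * ip h h)" using le unfolding 1 by linarith
    have "ip h h = ip (\<lambda>v. L * g0 v + (- 1) * walk (walk g0) v) h" by (simp only: h_def[abs_def])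
    also have "\<dots> = L * ip g0 h - ip (walk (walk g0)) h" unfolding ip_add_left by simp
    also have "ip (walk (walk g0)) h = ip (walk g0) (walk h)" by (rule ip_walk)
    finally have "2 * t * ip h h = 2 * t * (L * ip g0 h - ip (walk g0) (walk h))" by simp
    with 2 show ?thesis by (simp only: distrib_left right_diff_distrib mult_1_right) (simp add: mult_ac)
  qed
  have "ip h h = 0" by (rule quadratic_nonneg_imp_linear_zero[OF quad])
  then have WW: "walk (walk g0) v = L * g0 v" if "v \<in> V" for v
    using ip_eq_0[OF _ that, of h] by (simp add: h_def)
  \<comment> \<open>\<open>(W - l) (W + l) g0 = 0\<close>, so \<open>(W + l) g0\<close> or \<open>g0\<close> itself is an eigenvector.\<close>
  define k where "k v = 1 * walk g0 v + l * g0 v" for v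
  have "l \<le> c"
  proof (cases "\<exists>v\<in>V. k v \<noteq> 0")
    case True
    have "\<bar>l\<bar> \<le> c"
    proof (rule eig[OF True])
      show "ip k (\<lambda>_. 1) = 0" unfolding k_def ip_add_left by (simp add: ip_walk_one g0)
      fix v assume "v \<in> V"
      have "walk k v = 1 * walk (walk g0) v + l * walk g0 v"
        unfolding k_def[abs_def] by (rule walk_add)
      also have "\<dots> = (l * l) * g0 v + l * walk g0 v"
        using WW[OF \<open>v \<in> V\<close>] L(2) by simp
      finally show "walk k v = l * k v" by (simp add: k_def distrib_left)
    qed
    then show ?thesis by simp
  next
    case False
    have "\<exists>v\<in>V. g0 v \<noteq> 0"
    proof (rule ccontr)
      assume "\<not> ?thesis"
      then have "ip g0 g0 = 0" by (simp add: ip_def)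
      then show False using g0 by simp
    qed
    then have "\<bar>- l\<bar> \<le> c"
    proof (rule eig)
      fix v assume "v \<in> V"
      then have "k v = 0" using False by blast
      then show "walk g0 v = - l * g0 v" by (simp add: k_def)
    qed (rule g0)
    then show ?thesis by simp
  qed
  then have "L \<le> c\<^sup>2"
    using mult_mono[of l c l c] L by (simp add: power2_eq_square)
  then have "L * ip g g \<le> c\<^sup>2 * ip g g" by (intro mult_right_mono ip_nonneg)
  with max[OF g] show ?thesis by (simp add: L_def)
qed

end

section \<open>Pure complexes as spaces of ordered faces\<close>

lemma card_bij_extending:
  assumes "finite D" "A \<subseteq> D" "inj_on a A" "a ` A \<subseteq> t" "finite t" "card t = card D"
  shows "card {x \<in> extensional D. bij_betw x D t \<and> agree A x a} = fact (card D - card A)"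
  using assms
proof (induction "card D - card A" arbitrary: A a)
  case 0
  then have A: "A = D" by (metis card_subset_eq card_mono diff_is_0_eq le_antisym)
  have "bij_betw a D t"
    using 0 A card_subset_eq[of t "a ` D"] by (simp add: bij_betw_def card_image)
  then have "bij_betw (restrict a D) D t" by (simp cong: bij_betw_cong)
  then have "{x \<in> extensional D. bij_betw x D t \<and> agree A x a} = {restrict a D}"
    using A by (auto simp: agree_def extensional_def restrict_def)
  then show ?case using 0 by simp
next
  case (Suc n)
  have fA: "finite A" using Suc.prems finite_subset by blast
  have "A \<noteq> D" using Suc.hyps by auto
  then obtain j where j: "j \<in> D" "j \<notin> A" using Suc.prems by auto
  let ?E = "\<lambda>A a. {x \<in> extensional D. bij_betw x D t \<and> agree A x a}"
  have E: "?E A a = (\<Union>v\<in>t - a ` A. ?E (insert j A) (a(j := v)))"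
  proof (intro equalityI subsetI)
    fix x assume x: "x \<in> ?E A a"
    have "x j \<notin> a ` A"
    proof
      assume "x j \<in> a ` A"
      then obtain l where "l \<in> A" "x j = x l" using x by (auto simp: agree_def)
      moreover have "inj_on x D" using x by (simp add: bij_betw_def)
      ultimately show False using j Suc.prems(2) by (metis inj_on_eq_iff subsetD)
    qed
    moreover have "x j \<in> t" using x j by (auto simp: bij_betw_def)
    ultimately show "x \<in> (\<Union>v\<in>t - a ` A. ?E (insert j A) (a(j := v)))"
      using x j by (auto simp: agree_def)
  next
    fix x assume "x \<in> (\<Union>v\<in>t - a ` A. ?E (insert j A) (a(j := v)))"
    then obtain v where x: "x \<in> extensional D" "bij_betw x D t" "agree (insert j A) x (a(j := v))"
      by blast
    have "x l = a l" if "l \<in> A" for l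
      using x(3) that j unfolding agree_def by (metis fun_upd_other insertI2)
    with x show "x \<in> ?E A a" by (simp add: agree_def)
  qed
  have fin: "finite (?E B b)" for B b
  proof (rule finite_subset)
    show "?E B b \<subseteq> (\<Pi>\<^sub>E i\<in>D. t)" by (auto simp: bij_betw_def PiE_def)
    show "finite (\<Pi>\<^sub>E i\<in>D. t)" using Suc.prems by (intro finite_PiE) auto
  qed
  have "card (?E A a) = (\<Sum>v\<in>t - a ` A. card (?E (insert j A) (a(j := v))))"
    unfolding E
  proof (rule card_UN_disjoint)
    show "\<forall>v\<in>t - a ` A. \<forall>w\<in>t - a ` A. v \<noteq> w \<longrightarrow>
        ?E (insert j A) (a(j := v)) \<inter> ?E (insert j A) (a(j := w)) = {}"
      by (auto simp: agree_def)
  qed (use Suc.prems fin in auto)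
  also have "\<dots> = (\<Sum>v\<in>t - a ` A. fact n)"
  proof (rule sum.cong[OF refl])
    fix v assume v: "v \<in> t - a ` A"
    have "n = card D - card (insert j A)" using Suc.hyps j fA by simp
    moreover have "inj_on (a(j := v)) (insert j A)"
      using Suc.prems(3) j v by (auto simp: inj_on_def)
    moreover have "(a(j := v)) ` insert j A \<subseteq> t" using Suc.prems(4) j v by auto
    ultimately show "card (?E (insert j A) (a(j := v))) = fact n"
      using Suc.hyps(1)[of "insert j A" "a(j := v)"] Suc.prems j by simp
  qed
  also have "\<dots> = Suc n * fact n"
    using Suc.prems Suc.hyps fA by (simp add: card_Diff_subset card_image)
  finally show ?case using Suc.hyps by (metis fact_Suc of_nat_id)
qed

text \<open>An ordering that maps \<open>B\<close> onto \<open>s\<close> is an ordering of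
  \<open>s\<close> on \<open>B\<close> extending \<open>a\<close>, followed by an arbitrary
  extension to \<open>D\<close>; the two counts multiply.\<close>

lemma card_bij_extending_image:
  assumes D: "finite D" "A \<subseteq> B" "B \<subseteq> D" and a: "inj_on a A" "a ` A \<subseteq> s"
    and s: "s \<subseteq> t" "card s = card B" and t: "finite t" "card t = card D"
  shows "card {x \<in> extensional D. bij_betw x D t \<and> agree A x a \<and> x ` B = s}
    = fact (card B - card A) * fact (card D - card B)"
proof -
  let ?Z = "{z \<in> extensional B. bij_betw z B s \<and> agree A z a}"
  let ?E = "\<lambda>z. {x \<in> extensional D. bij_betw x D t \<and> agree B x z}"
  have fB: "finite B" "finite s" using assms finite_subset by blast+
  have E: "{x \<in> extensional D. bij_betw x D t \<and> agree A x a \<and> x ` B = s} = (\<Union>z\<in>?Z. ?E z)"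
  proof (intro equalityI subsetI)
    fix x assume x: "x \<in> {x \<in> extensional D. bij_betw x D t \<and> agree A x a \<and> x ` B = s}"
    then have "bij_betw (restrict x B) B s"
      using inj_on_subset[of x D B] D by (auto simp: bij_betw_def inj_on_def)
    then have "restrict x B \<in> ?Z" using x D by (auto simp: agree_def)
    moreover have "x \<in> ?E (restrict x B)" using x by (simp add: agree_def)
    ultimately show "x \<in> (\<Union>z\<in>?Z. ?E z)" by blast
  next
    fix x assume "x \<in> (\<Union>z\<in>?Z. ?E z)"
    then obtain z where z: "z \<in> ?Z" "x \<in> ?E z" by blast
    then have "x ` B = z ` B" by (auto simp: agree_def)
    with z D show "x \<in> {x \<in> extensional D. bij_betw x D t \<and> agree A x a \<and> x ` B = s}"
      by (auto simp: agree_def bij_betw_def subset_iff)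
  qed
  have fin: "finite (?E z)" for z
  proof (rule finite_subset)
    show "?E z \<subseteq> (\<Pi>\<^sub>E i\<in>D. t)" by (auto simp: bij_betw_def PiE_def)
    show "finite (\<Pi>\<^sub>E i\<in>D. t)" using assms by (intro finite_PiE) auto
  qed
  have finZ: "finite ?Z"
  proof (rule finite_subset)
    show "?Z \<subseteq> (\<Pi>\<^sub>E i\<in>B. s)" by (auto simp: bij_betw_def PiE_def)
    show "finite (\<Pi>\<^sub>E i\<in>B. s)" using fB by (intro finite_PiE) auto
  qed
  have "card (\<Union>z\<in>?Z. ?E z) = (\<Sum>z\<in>?Z. card (?E z))"
  proof (rule card_UN_disjoint)
    have "z = z'" if "z \<in> ?Z" "z' \<in> ?Z" "x \<in> ?E z" "x \<in> ?E z'" for z z' x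
      using that by (intro extensionalityI[of z B z']) (auto simp: agree_def)
    then show "\<forall>z\<in>?Z. \<forall>z'\<in>?Z. z \<noteq> z' \<longrightarrow> ?E z \<inter> ?E z' = {}" by blast
  qed (use fin finZ in auto)
  also have "\<dots> = (\<Sum>z\<in>?Z. fact (card D - card B))"
  proof (rule sum.cong[OF refl])
    fix z assume "z \<in> ?Z"
    then show "card (?E z) = fact (card D - card B)"
      using assms by (intro card_bij_extending) (auto simp: bij_betw_def)
  qed
  also have "card ?Z = fact (card B - card A)"
    by (rule card_bij_extending) (use assms fB in auto)
  then have "(\<Sum>z\<in>?Z. fact (card D - card B)) = fact (card B - card A) * fact (card D - card B)"
    by simp
  finally show ?thesis unfolding E by simp
qed

text \<open>Kept apart from the distribution assumptions on \<open>P\<close>, so that every link is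
  an instance, even at a face of weight 0, where \<open>link_wt\<close> is no distribution.\<close>

locale pure_family =
  fixes d :: nat and X :: "'a set set" and P :: "'a set \<Rightarrow> real"
  assumes finite_X: "finite X" and finite_top: "t \<in> X \<Longrightarrow> finite t" and card_top: "t \<in> X \<Longrightarrow> card t = d"
begin

text \<open>An unnormalized marginal, related to the level weights by \<open>level_wt_eq\<close>. It
  makes sense for all sets and vanishes on those that are no faces, so sums over faces can be
  extended freely.\<close>

definition upw :: "'a set \<Rightarrow> real" where "upw s = (\<Sum>t | t \<in> X \<and> s \<subseteq> t. P t)"

lemma finite_faces: "finite (faces X i)"
  by (rule finite_subset[of _ "Pow (\<Union>X)"]) (use finite_X finite_top in \<open>auto simp: faces_def\<close>)

lemma finite_Union_X: "finite (\<Union>X)"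
  using finite_X finite_top by blast

lemma sum_faces_upw:
  assumes "finite s" "card s \<le> i"
  shows "(\<Sum>y | y \<in> faces X i \<and> s \<subseteq> y. upw y * g y)
    = (\<Sum>t | t \<in> X \<and> s \<subseteq> t. P t * (\<Sum>y | y \<subseteq> t \<and> s \<subseteq> y \<and> card y = i. g y))"
proof -
  have "(\<Sum>y | y \<in> faces X i \<and> s \<subseteq> y. upw y * g y)
      = (\<Sum>y\<in>{y \<in> faces X i. s \<subseteq> y}. \<Sum>t | t \<in> {t \<in> X. s \<subseteq> t} \<and> y \<subseteq> t. P t * g y)"
    unfolding upw_def sum_distrib_right
    by (intro sum.cong refl) auto
  also have "\<dots> = (\<Sum>t\<in>{t \<in> X. s \<subseteq> t}. \<Sum>y | y \<in> {y \<in> faces X i. s \<subseteq> y} \<and> y \<subseteq> t. P t * g y)"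
    by (rule sum.swap_restrict) (use finite_faces finite_X in auto)
  also have "\<dots> = (\<Sum>t | t \<in> X \<and> s \<subseteq> t. P t * (\<Sum>y | y \<subseteq> t \<and> s \<subseteq> y \<and> card y = i. g y))"
    unfolding sum_distrib_left
    by (intro sum.cong refl) (auto simp: faces_def intro: finite_subset[OF _ finite_top])
  finally show ?thesis .
qed

lemma sum_upw_insert:
  assumes "finite s"
  shows "(\<Sum>v\<in>\<Union>X - s. upw (insert v s)) = (d - card s) * upw s"
proof -
  have "(\<Sum>v\<in>\<Union>X - s. upw (insert v s)) = (\<Sum>v\<in>\<Union>X - s. \<Sum>t | t \<in> {t \<in> X. s \<subseteq> t} \<and> v \<in> t. P t)"
    unfolding upw_def by (intro sum.cong refl) auto
  also have "\<dots> = (\<Sum>t\<in>{t \<in> X. s \<subseteq> t}. \<Sum>v | v \<in> \<Union>X - s \<and> v \<in> t. P t)"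
    by (rule sum.swap_restrict) (use finite_Union_X finite_X in auto)
  also have "\<dots> = (\<Sum>t\<in>{t \<in> X. s \<subseteq> t}. (d - card s) * P t)"
  proof (rule sum.cong[OF refl])
    fix t assume t: "t \<in> {t \<in> X. s \<subseteq> t}"
    then have "{v. v \<in> \<Union>X - s \<and> v \<in> t} = t - s" by auto
    then show "(\<Sum>v | v \<in> \<Union>X - s \<and> v \<in> t. P t) = (d - card s) * P t"
      using t assms card_top[of t] by (simp add: card_Diff_subset)
  qed
  finally show ?thesis by (simp add: upw_def sum_distrib_left)
qed

text \<open>Downward induction on the level: a top face above \<open>s\<close> contains
  \<open>d - i\<close> faces of the next level above \<open>s\<close>, so their \<open>upw\<close>
  sums to \<open>(d - i) * upw s\<close>. The absorption identity
  \<open>(d - i) * (d choose i) = (i + 1) * (d choose (i + 1))\<close> then matches the factor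
  \<open>1 / (i + 1)\<close>.\<close>

lemma level_wt_eq:
  assumes "i \<le> d" "s \<in> faces X i"
  shows "level_wt d X P i s = upw s / (d choose i)"
  using assms
proof (induction "d - i" arbitrary: i s)
  case 0
  then have i: "i = d" by simp
  with 0 obtain t where t: "t \<in> X" "s \<subseteq> t" "card s = d" by (auto simp: faces_def)
  then have "s \<in> X" using card_subset_eq[of t s] finite_top card_top by auto
  have "t' = s" if "t' \<in> X" "s \<subseteq> t'" for t'
    using that t card_subset_eq[of t' s] finite_top card_top by auto
  with \<open>s \<in> X\<close> have "{t. t \<in> X \<and> s \<subseteq> t} = {s}" by auto
  then show ?case using i by (simp add: level_wt.simps upw_def)
next
  case (Suc n)
  then have i: "i < d" "n = d - (i + 1)" by auto
  have s: "finite s" "card s = i" "s \<subseteq> \<Union>X" using Suc.prems by (auto simp: faces_def)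
  let ?F = "{y. y \<in> faces X (i + 1) \<and> s \<subset> y}"
  have F: "?F \<subseteq> (\<lambda>v. insert v s) ` (\<Union>X - s)"
  proof
    fix y assume y: "y \<in> ?F"
    then have "finite y" "card y = Suc (card s)" "s \<subset> y" using s by (auto simp: faces_def)
    then have "card (y - s) = 1" using s by (simp add: card_Diff_subset psubset_imp_subset)
    then obtain v where v: "y - s = {v}" by (auto simp: card_1_singleton_iff)
    then have "y = insert v s" "v \<in> \<Union>X - s" using y by (auto simp: faces_def)
    then show "y \<in> (\<lambda>v. insert v s) ` (\<Union>X - s)" by blast
  qed
  have inj: "inj_on (\<lambda>v. insert v s) (\<Union>X - s)" by (auto simp: inj_on_def)
  have "(\<Sum>y\<in>?F. upw y) = (\<Sum>y\<in>(\<lambda>v. insert v s) ` (\<Union>X - s). upw y)"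
  proof (rule sum.mono_neutral_left[OF _ F])
    show "\<forall>y\<in>(\<lambda>v. insert v s) ` (\<Union>X - s) - ?F. upw y = 0"
    proof
      fix y assume y: "y \<in> (\<lambda>v. insert v s) ` (\<Union>X - s) - ?F"
      then have "{t. t \<in> X \<and> y \<subseteq> t} = {}" using s by (auto simp: faces_def)
      then show "upw y = 0" unfolding upw_def by (simp only: sum.empty)
    qed
  qed (use finite_Union_X in auto)
  also have "\<dots> = (d - i) * upw s"
    using sum_upw_insert[OF s(1)] s inj by (simp add: sum.reindex)
  finally have sumF: "(\<Sum>y\<in>?F. upw y) = (d - i) * upw s" .
  have "(\<Sum>y\<in>?F. level_wt d X P (i + 1) y) = (\<Sum>y\<in>?F. upw y / (d choose (i + 1)))"
    by (intro sum.cong refl Suc.hyps(1)) (use i in auto)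
  also have "\<dots> = (d - i) * upw s / (d choose (i + 1))"
    by (simp only: sum_divide_distrib[symmetric] sumF)
  finally have "level_wt d X P i s = 1 / (i + 1) * ((d - i) * upw s / (d choose (i + 1)))"
    using i by (subst level_wt.simps) simp
  also have "\<dots> = upw s / (d choose i)"
  proof -
    have "(d - i) * (d choose i) = Suc i * (d choose Suc i)"
      unfolding binomial_absorb_comp binomial_absorption ..
    then have "real (d - i) * real (d choose i) = real (i + 1) * real (d choose (i + 1))"
      by (metis Suc_eq_plus1 of_nat_mult)
    moreover have pos: "0 < d choose i" "0 < d choose (i + 1)" using i by simp_all
    ultimately have "real (d - i) = real (i + 1) * real (d choose (i + 1)) / real (d choose i)"
      by (simp add: eq_divide_eq)
    then have "1 / real (i + 1) * (real (d - i) * upw s / real (d choose (i + 1)))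
      = 1 / real (i + 1) * (real (i + 1) * real (d choose (i + 1)) / real (d choose i) * upw s / real (d choose (i + 1)))"
      by (simp only:)
    then show ?thesis using pos by simp
  qed
  finally show ?case .
qed

end

locale weighted_family = pure_family d X P for d and X :: "'a set set" and P +
  assumes P_nonneg: "t \<in> X \<Longrightarrow> 0 \<le> P t" and sum_P: "sum P X = 1"
begin

text \<open>All \<open>d\<close> positions of a top face are ordered, so every marginal is a sum
  over the same space. Faces of weight 0 are dropped to satisfy \<open>mu_pos\<close>;
  extensionality keeps the set finite.\<close>

definition Om :: "(nat \<Rightarrow> 'a) set" where
  "Om = {x \<in> extensional {..<d}. inj_on x {..<d} \<and> x ` {..<d} \<in> X \<and> 0 < P (x ` {..<d})}"

definition mu :: "(nat \<Rightarrow> 'a) \<Rightarrow> real" where "mu x = P (x ` {..<d}) / fact d"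

lemma finite_Om: "finite Om"
proof (rule finite_subset)
  show "Om \<subseteq> (\<Pi>\<^sub>E i\<in>{..<d}. \<Union>X)" by (auto simp: Om_def PiE_def)
  show "finite (\<Pi>\<^sub>E i\<in>{..<d}. \<Union>X)" using finite_Union_X by (intro finite_PiE) auto
qed

sublocale coord_space Om mu
  by unfold_locales (simp_all add: finite_Om, simp add: mu_def Om_def)

lemma Om_props:
  assumes "x \<in> Om" "A \<subseteq> {..<d}"
  shows "inj_on x A" "card (x ` A) = card A" "x ` A \<in> faces X (card A)" "0 < upw (x ` A)"
proof -
  show inj: "inj_on x A" using assms inj_on_subset by (auto simp: Om_def)
  then show c: "card (x ` A) = card A" by (rule card_image)
  have t: "x ` {..<d} \<in> X" "0 < P (x ` {..<d})" "x ` A \<subseteq> x ` {..<d}" using assms by (auto simp: Om_def)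
  have "finite A" by (rule finite_subset[OF assms(2)]) simp
  then show "x ` A \<in> faces X (card A)" using t c by (auto simp: faces_def)
  show "0 < upw (x ` A)" unfolding upw_def
    by (rule sum_pos2[of _ "x ` {..<d}"]) (use t finite_X P_nonneg in auto)
qed

text \<open>Tuples are grouped by their top face and then by the set onto which they map
  \<open>B\<close>; by \<open>card_bij_extending_image\<close> the group sizes do not depend on
  these sets. \<open>A = {}\<close> gives unconditional sums.\<close>

lemma sum_Om_image:
  assumes B: "A \<subseteq> B" "B \<subseteq> {..<d}" and a: "inj_on a A"
  shows "(\<Sum>y | y \<in> Om \<and> agree A y a. mu y * F (y ` B))
    = fact (card B - card A) * fact (d - card B) / fact d
      * (\<Sum>s | s \<in> faces X (card B) \<and> a ` A \<subseteq> s. upw s * F s)"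
proof -
  let ?D = "{..<d}" and ?c = "fact (card B - card A) * fact (d - card B) :: real"
  let ?S = "{y. y \<in> Om \<and> agree A y a}"
  let ?T = "{t. t \<in> X \<and> a ` A \<subseteq> t}"
  let ?E = "\<lambda>t. {x \<in> extensional ?D. bij_betw x ?D t \<and> agree A x a}"
  let ?Y = "\<lambda>t. {y. y \<subseteq> t \<and> a ` A \<subseteq> y \<and> card y = card B}"
  have "finite B" by (rule finite_subset[OF B(2)]) simp
  then have fin: "finite A" "finite B" using finite_subset[OF B(1)] by auto
  have E: "(\<Sum>x\<in>?E t. F (x ` B)) = ?c * (\<Sum>y\<in>?Y t. F y)" if t: "t \<in> ?T" for t
  proof -
    have ft: "finite t" "card t = d" using t finite_top card_top by auto
    have finE: "finite (?E t)"
    proof (rule finite_subset)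
      show "?E t \<subseteq> (\<Pi>\<^sub>E i\<in>?D. t)" by (auto simp: bij_betw_def PiE_def)
      show "finite (\<Pi>\<^sub>E i\<in>?D. t)" using ft by (intro finite_PiE) auto
    qed
    have "(\<Sum>x\<in>?E t. F (x ` B)) = (\<Sum>y\<in>?Y t. \<Sum>x\<in>{x \<in> ?E t. x ` B = y}. F (x ` B))"
    proof (rule sum.group[symmetric, OF finE])
      show "finite (?Y t)" by (rule finite_subset[of _ "Pow t"]) (use ft in auto)
      show "(\<lambda>x. x ` B) ` ?E t \<subseteq> ?Y t"
      proof
        fix y assume "y \<in> (\<lambda>x. x ` B) ` ?E t"
        then obtain x where x: "x \<in> ?E t" "y = x ` B" by blast
        then have "inj_on x B" "y \<subseteq> t" using B inj_on_subset by (auto simp: bij_betw_def)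
        moreover have "a ` A = x ` A" using x by (auto simp: agree_def)
        ultimately show "y \<in> ?Y t" using x B by (auto simp: card_image)
      qed
    qed
    also have "\<dots> = (\<Sum>y\<in>?Y t. ?c * F y)"
    proof (rule sum.cong[OF refl])
      fix y assume y: "y \<in> ?Y t"
      have "{x \<in> ?E t. x ` B = y} = {x \<in> extensional ?D. bij_betw x ?D t \<and> agree A x a \<and> x ` B = y}"
        by auto
      also have "card \<dots> = fact (card B - card A) * fact (card ?D - card B)"
        by (rule card_bij_extending_image) (use B a y ft in auto)
      finally have card: "real (card {x \<in> ?E t. x ` B = y}) = ?c" by simp
      have "(\<Sum>x\<in>{x \<in> ?E t. x ` B = y}. F (x ` B)) = (\<Sum>x\<in>{x \<in> ?E t. x ` B = y}. F y)"
        by (rule sum.cong) auto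
      then show "(\<Sum>x\<in>{x \<in> ?E t. x ` B = y}. F (x ` B)) = ?c * F y" using card by simp
    qed
    finally show ?thesis by (simp only: sum_distrib_left)
  qed
  have "(\<Sum>y\<in>?S. mu y * F (y ` B)) = (\<Sum>t\<in>?T. \<Sum>y\<in>{y \<in> ?S. y ` ?D = t}. mu y * F (y ` B))"
  proof (rule sum.group[symmetric])
    show "(\<lambda>y. y ` ?D) ` ?S \<subseteq> ?T"
    proof
      fix t assume "t \<in> (\<lambda>y. y ` ?D) ` ?S"
      then obtain y where y: "y \<in> ?S" "t = y ` ?D" by blast
      then have "a ` A = y ` A" by (auto simp: agree_def)
      with y B show "t \<in> ?T" by (auto simp: Om_def)
    qed
  qed (use finite_Om finite_X in auto)
  also have "\<dots> = (\<Sum>t\<in>?T. P t * (?c / fact d * (\<Sum>y\<in>?Y t. F y)))"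
  proof (rule sum.cong[OF refl])
    fix t assume t: "t \<in> ?T"
    show "(\<Sum>y\<in>{y \<in> ?S. y ` ?D = t}. mu y * F (y ` B)) = P t * (?c / fact d * (\<Sum>y\<in>?Y t. F y))"
    proof (cases "P t > 0")
      case True
      have "{y \<in> ?S. y ` ?D = t} = ?E t"
        using t True by (auto simp: Om_def bij_betw_def)
      then have "(\<Sum>y\<in>{y \<in> ?S. y ` ?D = t}. mu y * F (y ` B)) = (\<Sum>y\<in>?E t. P t / fact d * F (y ` B))"
        by (intro sum.cong) (auto simp: mu_def bij_betw_def)
      also have "\<dots> = P t / fact d * (\<Sum>y\<in>?E t. F (y ` B))" by (rule sum_distrib_left[symmetric])
      finally show ?thesis by (simp add: E[OF t])
    next
      case False
      then have "{y \<in> ?S. y ` ?D = t} = {}" by (auto simp: Om_def)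
      moreover have "P t = 0" using False P_nonneg[of t] t by auto
      ultimately show ?thesis by (simp only: sum.empty mult_zero_left)
    qed
  qed
  also have "\<dots> = ?c / fact d * (\<Sum>t\<in>?T. P t * (\<Sum>y\<in>?Y t. F y))"
    unfolding sum_distrib_left by (simp only: mult.left_commute)
  also have "(\<Sum>t\<in>?T. P t * (\<Sum>y\<in>?Y t. F y)) = (\<Sum>s | s \<in> faces X (card B) \<and> a ` A \<subseteq> s. upw s * F s)"
    using card_mono[OF fin(2) B(1)] card_image[OF a] fin by (intro sum_faces_upw[symmetric]) simp_all
  finally show ?thesis .
qed

lemma sum_Om_agree:
  assumes "A \<subseteq> {..<d}" and a: "inj_on a A"
  shows "(\<Sum>y | y \<in> Om \<and> agree A y a. mu y) = fact (d - card A) / fact d * upw (a ` A)"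
proof -
  have fA: "finite A" by (rule finite_subset[OF assms(1)]) simp
  have sub: "{s. s \<in> faces X (card A) \<and> a ` A \<subseteq> s} \<subseteq> {a ` A}"
  proof
    fix s assume s: "s \<in> {s. s \<in> faces X (card A) \<and> a ` A \<subseteq> s}"
    then have "finite s" "card s = card (a ` A)" "a ` A \<subseteq> s" using a by (auto simp: faces_def card_image)
    then have "a ` A = s" by (intro card_subset_eq) auto
    then show "s \<in> {a ` A}" by simp
  qed
  have "(\<Sum>s | s \<in> faces X (card A) \<and> a ` A \<subseteq> s. upw s) = (\<Sum>s\<in>{a ` A}. upw s)"
  proof (rule sum.mono_neutral_left[OF _ sub])
    show "\<forall>s\<in>{a ` A} - {s. s \<in> faces X (card A) \<and> a ` A \<subseteq> s}. upw s = 0"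
    proof
      fix s assume "s \<in> {a ` A} - {s. s \<in> faces X (card A) \<and> a ` A \<subseteq> s}"
      then have "{t. t \<in> X \<and> s \<subseteq> t} = {}" using a fA by (auto simp: faces_def card_image)
      then show "upw s = 0" unfolding upw_def by (simp only: sum.empty)
    qed
  qed simp
  then show ?thesis using sum_Om_image[of A A a "\<lambda>_. 1"] assms by simp
qed

lemma sum_mu: "sum mu Om = 1"
  using sum_Om_agree[of "{}" undefined] sum_P by (simp add: agree_def upw_def)

text \<open>The multiplicities from \<open>sum_Om_image\<close> and the binomials in the level
  weights cancel between numerator and denominator, so link averages are conditional expectations
  exactly, without error.\<close>

lemma cond_image:
  assumes "A \<subseteq> {..<k}" "k \<le> d" "x \<in> Om"
  shows "cond A (\<lambda>y. F (y ` {..<k})) x = link_mean d X P k F (x ` A)"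
proof -
  have kd: "{..<k} \<subseteq> {..<d}" using assms by auto
  have inj: "inj_on x A" by (rule Om_props(1)[OF assms(3) order_trans[OF assms(1) kd]])
  let ?c = "fact (k - card A) * fact (d - k) / fact d :: real"
  let ?b = "real (d choose k)"
  let ?N = "\<lambda>F. \<Sum>s | s \<in> faces X k \<and> x ` A \<subseteq> s. upw s * F s"
  have c: "?c \<noteq> 0" by simp
  have b: "?b \<noteq> 0" using assms by simp
  have num: "(\<Sum>y\<in>cls A x. mu y * F (y ` {..<k})) = ?c * ?N F" for F
    using sum_Om_image[OF assms(1) kd inj, of F] by (simp add: cls_def)
  have lw: "(\<Sum>s | s \<in> faces X k \<and> x ` A \<subseteq> s. level_wt d X P k s * F s) = ?N F / ?b" for F
    unfolding sum_divide_distrib by (rule sum.cong) (use assms in \<open>auto simp: level_wt_eq\<close>)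
  have "cond A (\<lambda>y. F (y ` {..<k})) x = (?c * ?N F) / (?c * ?N (\<lambda>_. 1))"
    unfolding cond_def num using num[of "\<lambda>_. 1"] by simp
  also have "\<dots> = ?N F / ?N (\<lambda>_. 1)" using c by (rule mult_divide_mult_cancel_left)
  also have "\<dots> = (?N F / ?b) / (?N (\<lambda>_. 1) / ?b)" using b by simp
  also have "\<dots> = link_mean d X P k F (x ` A)"
    unfolding link_mean_def lw using lw[of "\<lambda>_. 1"] by simp
  finally show ?thesis .
qed

lemma mean_image:
  assumes "k \<le> d"
  shows "mean d X P k F = ex (\<lambda>y. F (y ` {..<k}))"
proof -
  let ?N = "\<Sum>s\<in>faces X k. upw s * F s"
  have "ex (\<lambda>y. F (y ` {..<k})) = fact k * fact (d - k) / fact d * ?N"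
    using sum_Om_image[of "{}" "{..<k}" undefined F] assms by (simp add: ex_def agree_def)
  also have "\<dots> = ?N / (d choose k)"
    using assms by (simp add: binomial_fact)
  also have "\<dots> = mean d X P k F"
    unfolding mean_def sum_divide_distrib by (rule sum.cong) (use assms in \<open>auto simp: level_wt_eq\<close>)
  finally show ?thesis ..
qed

end

section \<open>Links\<close>

context pure_family
begin

lemma link_pure:
  assumes "finite s"
  shows "pure_family (d - card s) (link X s)"
proof
  have "link X s = (\<lambda>t. t - s) ` {t \<in> X. s \<subseteq> t}" by (auto simp: link_def)
  then show "finite (link X s)" using finite_X by simp
  fix t assume "t \<in> link X s"
  then obtain t' where "t' \<in> X" "s \<subseteq> t'" "t = t' - s" by (auto simp: link_def)
  then show "finite t" "card t = d - card s"
    using finite_top card_top assms by (auto simp: card_Diff_subset)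
qed

lemma upw_link:
  assumes "w \<inter> s = {}" "finite s"
  shows "pure_family.upw (link X s) (link_wt X P s) w = upw (s \<union> w) / upw s"
proof -
  interpret L: pure_family "d - card s" "link X s" "link_wt X P s" by (rule link_pure[OF assms(2)])
  have "{t. t \<in> link X s \<and> w \<subseteq> t} = (\<lambda>t. t - s) ` {t. t \<in> X \<and> s \<union> w \<subseteq> t}"
    using assms by (auto simp: link_def)
  moreover have "inj_on (\<lambda>t. t - s) {t. t \<in> X \<and> s \<union> w \<subseteq> t}"
    by (rule inj_onI) (metis (mono_tags, lifting) Diff_partition le_sup_iff mem_Collect_eq)
  ultimately have "(\<Sum>t | t \<in> link X s \<and> w \<subseteq> t. link_wt X P s t)
      = (\<Sum>t | t \<in> X \<and> s \<union> w \<subseteq> t. link_wt X P s (t - s))"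
    by (simp add: sum.reindex)
  also have "\<dots> = (\<Sum>t | t \<in> X \<and> s \<union> w \<subseteq> t. P t / upw s)"
  proof (rule sum.cong[OF refl])
    fix t assume "t \<in> {t. t \<in> X \<and> s \<union> w \<subseteq> t}"
    then have "t - s \<union> s = t" by auto
    then show "link_wt X P s (t - s) = P t / upw s" by (simp add: link_wt_def upw_def)
  qed
  also have "\<dots> = upw (s \<union> w) / upw s" by (simp add: upw_def sum_divide_distrib)
  finally show ?thesis
    by (simp only: L.upw_def)
qed

end

context weighted_family
begin

lemma upw_nonneg: "0 \<le> upw s"
  unfolding upw_def by (rule sum_nonneg) (auto simp: P_nonneg)

lemma upw_antimono: "s \<subseteq> s' \<Longrightarrow> upw s' \<le> upw s"
  unfolding upw_def by (rule sum_mono2) (use finite_X P_nonneg in auto)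

lemma upw_antimono_0: "upw s = 0 \<Longrightarrow> s \<subseteq> s' \<Longrightarrow> upw s' = 0"
  using upw_antimono[of s s'] upw_nonneg[of s'] by simp

text \<open>
  Vertices of weight \<open>0\<close> are left out: the walk is not a Markov chain there (\<open>walk_op\<close> is \<open>0 / 0 = 0\<close>).
\<close>

definition linkV :: "'a set \<Rightarrow> 'a set" where
  "linkV s = {v \<in> \<Union>X - s. 0 < upw (insert v s)}"

text \<open>The edge weights of the link up to the factor \<open>upw s * (m choose 2)\<close> with
  \<open>m = d - card s\<close>, which cancels in the walk.\<close>

definition linkq :: "'a set \<Rightarrow> 'a \<Rightarrow> 'a \<Rightarrow> real" where
  "linkq s v u = (if u \<in> linkV s \<and> v \<in> linkV s \<and> u \<noteq> v then upw (insert u (insert v s)) else 0)"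

lemma finite_linkV: "finite (linkV s)"
  by (rule finite_subset[OF _ finite_Union_X]) (auto simp: linkV_def)

lemma sum_linkV: "(\<Sum>u\<in>\<Union>X - s. upw (insert u s) * F u) = (\<Sum>u\<in>linkV s. upw (insert u s) * F u)"
proof (rule sum.mono_neutral_right)
  show "\<forall>u\<in>\<Union>X - s - linkV s. upw (insert u s) * F u = 0"
    using upw_nonneg by (auto simp: linkV_def not_less intro: antisym)
qed (auto simp: finite_Union_X linkV_def)

text \<open>An omitted vertex has \<open>upw\<close> 0, and by antimonotonicity so has every edge at
  it; therefore the sum may run over all vertices.\<close>

lemma sum_linkq:
  assumes "v \<in> linkV s"
  shows "(\<Sum>u\<in>linkV s. linkq s v u * F u)
    = (\<Sum>u\<in>\<Union>X - insert v s. upw (insert u (insert v s)) * F u)"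
proof -
  have "(\<Sum>u\<in>linkV s. linkq s v u * F u) = (\<Sum>u\<in>linkV s - {v}. upw (insert u (insert v s)) * F u)"
    using assms by (intro sum.mono_neutral_cong_right) (auto simp: linkq_def finite_linkV)
  also have "\<dots> = (\<Sum>u\<in>\<Union>X - insert v s. upw (insert u (insert v s)) * F u)"
  proof (rule sum.mono_neutral_left)
    show "\<forall>u\<in>\<Union>X - insert v s - (linkV s - {v}). upw (insert u (insert v s)) * F u = 0"
    proof
      fix u assume u: "u \<in> \<Union>X - insert v s - (linkV s - {v})"
      then have "upw (insert u s) = 0" using upw_nonneg[of "insert u s"] by (auto simp: linkV_def)
      then have "upw (insert u (insert v s)) = 0" by (rule upw_antimono_0) auto
      then show "upw (insert u (insert v s)) * F u = 0" by simp
    qed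
  qed (auto simp: finite_Union_X linkV_def)
  finally show ?thesis .
qed

lemma sum_linkq_one:
  assumes "v \<in> linkV s" "finite s"
  shows "(\<Sum>u\<in>linkV s. linkq s v u) = (d - card s - 1) * upw (insert v s)"
proof -
  have "v \<notin> s" using assms by (auto simp: linkV_def)
  then show ?thesis
    using sum_linkq[OF assms(1), of "\<lambda>_. 1"] sum_upw_insert[of "insert v s"] assms by simp
qed

lemma reversible_walk_link:
  assumes "finite s" "card s + 2 \<le> d"
  shows "reversible_walk (linkV s) (linkq s)"
proof
  show "0 < (\<Sum>u\<in>linkV s. linkq s v u)" if "v \<in> linkV s" for v
    using sum_linkq_one[OF that assms(1)] that assms by (simp add: linkV_def)
qed (auto simp: finite_linkV linkq_def upw_nonneg insert_commute)

text \<open>On \<open>linkV s\<close> the two walks agree, and \<open>deg v\<close> is proportional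
  to the level-1 weight of \<open>v\<close> in the link, so orthogonality to the constants means the
  same for both.\<close>

lemma nontrivial_eigenvalue_link:
  assumes s: "finite s" "card s + 2 \<le> d" "0 < upw s"
    and g: "\<exists>v\<in>linkV s. g v \<noteq> 0" "reversible_walk.ip (linkV s) (linkq s) g (\<lambda>_. 1) = 0"
    and eig: "\<And>v. v \<in> linkV s \<Longrightarrow> reversible_walk.walk (linkV s) (linkq s) g v = r * g v"
  shows "nontrivial_walk_eigenvalue (d - card s) (link X s) (link_wt X P s) r"
proof -
  interpret W: reversible_walk "linkV s" "linkq s" by (rule reversible_walk_link[OF s(1,2)])
  interpret L: pure_family "d - card s" "link X s" "link_wt X P s" by (rule link_pure[OF s(1)])
  let ?m = "d - card s"
  \<comment> \<open>Extended by 0: at a vertex of weight 0 the eigenvalue equation then reads 0 =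
    \<open>r\<close> * 0.\<close>
  define g' where "g' v = (if v \<in> linkV s then g v else 0)" for v
  have disj: "w \<inter> s = {}" if "w \<in> faces (link X s) i" for w i
    using that by (auto simp: faces_def link_def)
  have lw: "level_wt ?m (link X s) (link_wt X P s) i w = upw (s \<union> w) / upw s / (?m choose i)"
    if "w \<in> faces (link X s) i" "i \<le> ?m" for w i
    using L.level_wt_eq[OF that(2,1)] upw_link[OF disj[OF that(1)] s(1)] by simp
  have faceI: "w \<in> faces (link X s) (card w)" if "0 < upw (s \<union> w)" "w \<inter> s = {}" "finite w" for w
  proof -
    have "\<exists>t\<in>X. s \<union> w \<subseteq> t"
    proof (rule ccontr)
      assume "\<not> ?thesis"
      then have "{t. t \<in> X \<and> s \<union> w \<subseteq> t} = {}" by blast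
      then have "upw (s \<union> w) = 0" unfolding upw_def by (simp only: sum.empty)
      with that show False by simp
    qed
    then obtain t where "t \<in> X" "s \<union> w \<subseteq> t" by blast
    then have "t - s \<in> link X s" "w \<subseteq> t - s" using that by (auto simp: link_def)
    then show ?thesis using that by (auto simp: faces_def)
  qed
  have face1: "{v} \<in> faces (link X s) 1" if "v \<in> linkV s" for v
    using faceI[of "{v}"] that by (auto simp: linkV_def)
  have outside: "upw (insert v s) = 0" if "{v} \<in> faces (link X s) 1" "v \<notin> linkV s" for v
  proof -
    have "v \<in> \<Union>X - s" using that(1) by (auto simp: faces_def link_def)
    then show ?thesis using that(2) upw_nonneg[of "insert v s"] by (auto simp: linkV_def)
  qed
  have m: "2 \<le> ?m" using s by simp
  let ?c = "upw s * (?m choose 2)"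
  have edge: "level_wt ?m (link X s) (link_wt X P s) 2 {v, u} = upw (insert u (insert v s)) / ?c"
    if "u \<in> nbrs (link X s) v" for u v
  proof -
    have "{v, u} \<in> faces (link X s) 2" using that by (simp add: nbrs_def)
    from lw[OF this m] show ?thesis by (simp add: insert_commute Un_commute)
  qed
  have fin_nbrs: "finite (nbrs (link X s) v)" for v
  proof (rule finite_subset)
    show "nbrs (link X s) v \<subseteq> \<Union>X" by (auto simp: nbrs_def faces_def link_def)
  qed (rule finite_Union_X)
  have sum_nbrs: "(\<Sum>u\<in>nbrs (link X s) v. level_wt ?m (link X s) (link_wt X P s) 2 {v, u} * F u)
    = (\<Sum>u\<in>linkV s. linkq s v u * F u) / ?c" if v: "v \<in> linkV s" for v F
  proof -
    have "(\<Sum>u\<in>nbrs (link X s) v. level_wt ?m (link X s) (link_wt X P s) 2 {v, u} * F u)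
      = (\<Sum>u\<in>nbrs (link X s) v. upw (insert u (insert v s)) * F u) / ?c"
      unfolding sum_divide_distrib by (rule sum.cong) (simp_all add: edge)
    also have "(\<Sum>u\<in>nbrs (link X s) v. upw (insert u (insert v s)) * F u)
      = (\<Sum>u\<in>\<Union>X - insert v s. upw (insert u (insert v s)) * F u)"
    proof (rule sum.mono_neutral_left)
      show "nbrs (link X s) v \<subseteq> \<Union>X - insert v s" by (auto simp: nbrs_def faces_def link_def)
      show "\<forall>u\<in>\<Union>X - insert v s - nbrs (link X s) v. upw (insert u (insert v s)) * F u = 0"
      proof
        fix u assume u: "u \<in> \<Union>X - insert v s - nbrs (link X s) v"
        have "upw (insert u (insert v s)) = 0"
        proof (rule ccontr)
          assume "upw (insert u (insert v s)) \<noteq> 0"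
          then have "0 < upw (s \<union> {v, u})"
            using upw_nonneg[of "insert u (insert v s)"] by (simp add: insert_commute Un_commute)
          then have "{v, u} \<in> faces (link X s) (card {v, u})"
            using u v by (intro faceI) (auto simp: linkV_def)
          moreover have "card {v, u} = 2" using u by auto
          ultimately have "{v, u} \<in> faces (link X s) 2" by simp
          then show False using u by (auto simp: nbrs_def)
        qed
        then show "upw (insert u (insert v s)) * F u = 0" by simp
      qed
    qed (simp add: finite_Union_X)
    finally show ?thesis by (simp only: sum_linkq[OF v])
  qed
  show ?thesis
    unfolding nontrivial_walk_eigenvalue_def
  proof (intro exI[of _ g'] conjI allI impI)
    show "\<exists>v. {v} \<in> faces (link X s) 1 \<and> g' v \<noteq> 0" using g(1) face1 by (auto simp: g'_def)
    have "(\<Sum>v | {v} \<in> faces (link X s) 1. level_wt ?m (link X s) (link_wt X P s) 1 {v} * g' v)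
      = (\<Sum>v\<in>linkV s. level_wt ?m (link X s) (link_wt X P s) 1 {v} * g v)"
    proof (rule sum.mono_neutral_cong_right)
      show "finite {v. {v} \<in> faces (link X s) 1}"
        by (rule finite_subset[OF _ finite_Union_X]) (auto simp: faces_def link_def)
    qed (auto simp: g'_def face1[simplified])
    also have "\<dots> = (\<Sum>v\<in>linkV s. W.deg v * (g v * 1) / (real (?m - 1) * upw s * ?m))"
    proof (rule sum.cong[OF refl])
      fix v assume v: "v \<in> linkV s"
      have "W.deg v = (?m - 1) * upw (insert v s)"
        using sum_linkq_one[OF v s(1)] by (simp add: W.deg_def)
      moreover have "level_wt ?m (link X s) (link_wt X P s) 1 {v} = upw (insert v s) / upw s / ?m"
        using lw[OF face1[OF v]] m by simp
      ultimately show "level_wt ?m (link X s) (link_wt X P s) 1 {v} * g v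
        = W.deg v * (g v * 1) / (real (?m - 1) * upw s * ?m)"
        using m by simp
    qed
    also have "\<dots> = W.ip g (\<lambda>_. 1) / (real (?m - 1) * upw s * ?m)"
      unfolding W.ip_def by (rule sum_divide_distrib[symmetric])
    finally show "(\<Sum>v | {v} \<in> faces (link X s) 1. level_wt ?m (link X s) (link_wt X P s) 1 {v} * g' v) = 0"
      using g(2) by simp
    fix v assume v: "{v} \<in> faces (link X s) 1"
    show "walk_op ?m (link X s) (link_wt X P s) g' v = r * g' v"
    proof (cases "v \<in> linkV s")
      case True
      have c: "?c \<noteq> 0" using s m by simp
      have "walk_op ?m (link X s) (link_wt X P s) g' v
        = ((\<Sum>u\<in>linkV s. linkq s v u * g' u) / ?c) / ((\<Sum>u\<in>linkV s. linkq s v u * 1) / ?c)"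
        unfolding walk_op_def sum_nbrs[OF True, symmetric] by simp
      also have "\<dots> = (\<Sum>u\<in>linkV s. linkq s v u * g' u) / (\<Sum>u\<in>linkV s. linkq s v u * 1)"
        using c by simp
      also have "\<dots> = W.walk g' v" by (simp add: W.walk_def W.deg_def)
      also have "\<dots> = W.walk g v" by (rule W.walk_cong) (simp add: g'_def)
      finally show ?thesis using eig[OF True] True by (simp add: g'_def)
    next
      case False
      have "level_wt ?m (link X s) (link_wt X P s) 2 {v, u} = 0" if "u \<in> nbrs (link X s) v" for u
        unfolding edge[OF that] using upw_antimono_0[OF outside[OF v False], of "insert u (insert v s)"]
        by auto
      then show ?thesis using False by (simp add: walk_op_def g'_def)
    qed
  qed
qed

section \<open>Link walks as conditional expectations\<close>

text \<open>The conditional law of an unseen coordinate given \<open>S\<close>: the value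
  \<open>u\<close> has probability proportional to \<open>upw\<close> of the enlarged face,
  whichever position \<open>l\<close> is taken. Tuples are grouped by their value at
  \<open>l\<close>.\<close>

lemma sum_cls_coord:
  assumes S: "S \<subseteq> {..<d}" and l: "l < d" "l \<notin> S" and x: "x \<in> Om"
  shows "(\<Sum>y\<in>cls S x. mu y * F (y l))
    = fact (d - card S - 1) / fact d * (\<Sum>u\<in>\<Union>X - x ` S. upw (insert u (x ` S)) * F u)"
proof -
  let ?c = "fact (d - card S - 1) / fact d :: real"
  have fS: "finite S" by (rule finite_subset[OF S]) simp
  have "(\<Sum>y\<in>cls S x. mu y * F (y l)) = (\<Sum>u\<in>\<Union>X - x ` S. \<Sum>y\<in>{y \<in> cls S x. y l = u}. mu y * F (y l))"
  proof (rule sum.group[symmetric])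
    show "(\<lambda>y. y l) ` cls S x \<subseteq> \<Union>X - x ` S"
    proof
      fix u assume "u \<in> (\<lambda>y. y l) ` cls S x"
      then obtain y where y: "y \<in> Om" "agree S y x" "u = y l" by (auto simp: cls_def)
      then have "y ` S = x ` S" by (auto simp: agree_def)
      moreover have "y l \<notin> y ` S"
      proof
        assume "y l \<in> y ` S"
        then obtain i where "i \<in> S" "y i = y l" by auto
        moreover have "inj_on y {..<d}" using y by (simp add: Om_def)
        ultimately show False using S l by (metis inj_on_eq_iff lessThan_iff subsetD)
      qed
      moreover have "y ` {..<d} \<in> X" "y l \<in> y ` {..<d}" using y l by (auto simp: Om_def)
      then have "y l \<in> \<Union>X" by blast
      ultimately show "u \<in> \<Union>X - x ` S" using y by simp
    qed
  qed (simp_all add: finite_Union_X)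
  also have "\<dots> = (\<Sum>u\<in>\<Union>X - x ` S. ?c * (upw (insert u (x ` S)) * F u))"
  proof (rule sum.cong[OF refl])
    fix u assume u: "u \<in> \<Union>X - x ` S"
    have im: "(x(l := u)) ` insert l S = insert u (x ` S)" using l by auto
    have eq: "{y \<in> cls S x. y l = u} = {y. y \<in> Om \<and> agree (insert l S) y (x(l := u))}"
      using l by (auto simp: cls_def agree_def)
    have "inj_on x S" by (rule Om_props(1)[OF x S])
    then have inj: "inj_on (x(l := u)) (insert l S)"
      using u l by (auto simp: inj_on_def)
    have "(\<Sum>y\<in>{y \<in> cls S x. y l = u}. mu y * F (y l)) = (\<Sum>y\<in>{y \<in> cls S x. y l = u}. mu y) * F u"
      unfolding sum_distrib_right by (rule sum.cong) auto
    also have "(\<Sum>y\<in>{y \<in> cls S x. y l = u}. mu y) = fact (d - card (insert l S)) / fact d * upw (insert u (x ` S))"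
      unfolding eq im[symmetric] by (rule sum_Om_agree[OF _ inj]) (use S l in auto)
    finally show "(\<Sum>y\<in>{y \<in> cls S x. y l = u}. mu y * F (y l)) = ?c * (upw (insert u (x ` S)) * F u)"
      using l fS by simp
  qed
  finally show ?thesis by (simp only: sum_distrib_left)
qed

text \<open>Within the class of \<open>x\<close>, a function that sees one further coordinate
  \<open>j\<close> is a function \<open>G\<close> of a vertex of the link, and conditioning on
  coordinate \<open>i\<close> instead applies the walk once. Coordinates \<open>i\<close> and
  \<open>j\<close> both have the law proportional to \<open>deg\<close>, so the two sums of squares
  are the same multiple of \<open>ip\<close>.\<close>

lemma cls_cond_contracts:
  assumes S: "S \<subseteq> {..<d}" and ij: "i < d" "j < d" "i \<noteq> j" "i \<notin> S" "j \<notin> S" and x: "x \<in> Om"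
    and eig: "\<And>r. nontrivial_walk_eigenvalue (d - card (x ` S)) (link X (x ` S)) (link_wt X P (x ` S)) r \<Longrightarrow> \<bar>r\<bar> \<le> c"
    and g: "meas (insert j S) g" "cond S g x = 0"
  shows "(\<Sum>y\<in>cls S x. mu y * (cond (insert i S) g y)\<^sup>2) \<le> c\<^sup>2 * (\<Sum>y\<in>cls S x. mu y * (g y)\<^sup>2)"
proof -
  define s where "s = x ` S"
  have fS: "finite S" by (rule finite_subset[OF S]) simp
  have cs: "card s = card S" "finite s" using Om_props(2)[OF x S] fS by (auto simp: s_def)
  have "card (insert i (insert j S)) \<le> card {..<d}"
    by (rule card_mono) (use S ij in auto)
  then have cd: "card s + 2 \<le> d" using ij fS cs by simp
  interpret W: reversible_walk "linkV s" "linkq s" by (rule reversible_walk_link[OF cs(2) cd])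
  let ?m = "d - card S - 1"
  let ?C = "fact ?m / fact d / real ?m"
  have m: "0 < ?m" using cd cs by simp
  have C: "0 < ?C" using m by simp
  have deg: "W.deg v = ?m * upw (insert v s)" if "v \<in> linkV s" for v
    using sum_linkq_one[OF that cs(2)] cs by (simp add: W.deg_def)
  have sum_cls: "(\<Sum>y\<in>cls S x. mu y * F (y l)) = ?C * (\<Sum>u\<in>linkV s. W.deg u * F u)"
    if "l < d" "l \<notin> S" for l F
  proof -
    have "(\<Sum>y\<in>cls S x. mu y * F (y l)) = fact ?m / fact d * (\<Sum>u\<in>linkV s. upw (insert u s) * F u)"
      using sum_cls_coord[OF S that x, of F] by (simp only: s_def sum_linkV)
    also have "\<dots> = (\<Sum>u\<in>linkV s. ?C * (W.deg u * F u))"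
      unfolding sum_distrib_left by (rule sum.cong) (use deg m in auto)
    finally show ?thesis by (simp only: sum_distrib_left)
  qed
  \<comment> \<open>Any tuple of the class with value \<open>u\<close> at \<open>j\<close> may be
    chosen, since \<open>g\<close> is measurable in \<open>insert j S\<close>.\<close>
  define G where "G u = g (SOME z. z \<in> cls S x \<and> z j = u)" for u
  have G: "g z = G (z j)" if z: "z \<in> cls S x" for z
  proof -
    let ?z = "SOME z'. z' \<in> cls S x \<and> z' j = z j"
    have "?z \<in> cls S x \<and> ?z j = z j" by (rule someI[of _ z]) (simp add: z)
    then have "agree (insert j S) z ?z" "?z \<in> Om" "z \<in> Om" using z by (auto simp: cls_def agree_def)
    then show ?thesis unfolding G_def using measD[OF g(1)] by blast
  qed
  have cond_g: "cond (insert i S) g y = W.walk G (y i)" if y: "y \<in> cls S x" for y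
  proof -
    have yO: "y \<in> Om" "agree S y x" using y by (auto simp: cls_def)
    have iS: "insert i S \<subseteq> {..<d}" "j \<notin> insert i S" using S ij by auto
    have im: "y ` insert i S = insert (y i) s" using yO by (auto simp: s_def agree_def)
    have sub: "cls (insert i S) y \<subseteq> cls S x"
      using yO by (auto simp: cls_def agree_def)
    have "y i \<notin> s"
      using Om_props(2)[OF yO(1) iS(1)] cs fS ij unfolding im by (auto simp: insert_absorb)
    moreover have "0 < upw (insert (y i) s)" using Om_props(4)[OF yO(1) iS(1)] unfolding im .
    moreover have "y ` {..<d} \<in> X" "y i \<in> y ` {..<d}" using yO ij by (auto simp: Om_def)
    then have "y i \<in> \<Union>X" by blast
    ultimately have V: "y i \<in> linkV s" by (simp add: linkV_def)
    let ?k = "fact (d - card (insert i S) - 1) / fact d :: real"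
    have num: "(\<Sum>z\<in>cls (insert i S) y. mu z * F (z j)) = ?k * (\<Sum>u\<in>linkV s. linkq s (y i) u * F u)" for F
      using sum_cls_coord[OF iS(1) ij(2) iS(2) yO(1), of F] unfolding im sum_linkq[OF V] .
    have "cond (insert i S) g y
      = (\<Sum>z\<in>cls (insert i S) y. mu z * G (z j)) / (\<Sum>z\<in>cls (insert i S) y. mu z * 1)"
      unfolding cond_def using sub G by (intro arg_cong2[where f = "(/)"] sum.cong) auto
    also have "\<dots> = (?k * (\<Sum>u\<in>linkV s. linkq s (y i) u * G u)) / (?k * (\<Sum>u\<in>linkV s. linkq s (y i) u * 1))"
      unfolding num[of G] num[of "\<lambda>_. 1"] by (rule refl)
    also have "\<dots> = W.walk G (y i)"
      by (simp add: W.walk_def W.deg_def)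
    finally show ?thesis .
  qed
  have "(\<Sum>y\<in>cls S x. mu y * g y) = 0"
    using g(2) sum_cls_pos[OF x, of S] by (simp add: cond_def)
  moreover have "(\<Sum>y\<in>cls S x. mu y * g y) = (\<Sum>y\<in>cls S x. mu y * G (y j))"
    by (rule sum.cong) (simp_all add: G)
  ultimately have "W.ip G (\<lambda>_. 1) = 0"
    using sum_cls[OF ij(2,5), of G] m by (simp add: W.ip_def)
  have "W.ip (W.walk G) (W.walk G) \<le> c\<^sup>2 * W.ip G G"
  proof (rule W.walk_contracts[OF _ \<open>W.ip G (\<lambda>_. 1) = 0\<close>])
    fix r g assume "\<exists>v\<in>linkV s. g v \<noteq> 0" "W.ip g (\<lambda>_. 1) = 0"
      "\<And>v. v \<in> linkV s \<Longrightarrow> W.walk g v = r * g v"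
    from nontrivial_eigenvalue_link[OF cs(2) cd _ this] show "\<bar>r\<bar> \<le> c"
      using eig Om_props(4)[OF x S] by (simp add: s_def)
  qed
  then have "?C * W.ip (W.walk G) (W.walk G) \<le> ?C * (c\<^sup>2 * W.ip G G)"
    using C by (intro mult_left_mono) auto
  moreover have "(\<Sum>y\<in>cls S x. mu y * (cond (insert i S) g y)\<^sup>2) = (\<Sum>y\<in>cls S x. mu y * (W.walk G (y i))\<^sup>2)"
    by (rule sum.cong) (simp_all add: cond_g)
  moreover have "(\<Sum>y\<in>cls S x. mu y * (g y)\<^sup>2) = (\<Sum>y\<in>cls S x. mu y * (G (y j))\<^sup>2)"
    by (rule sum.cong) (simp_all add: G)
  ultimately show ?thesis
    using sum_cls[OF ij(1,4), of "\<lambda>v. (W.walk G v)\<^sup>2"] sum_cls[OF ij(2,5), of "\<lambda>v. (G v)\<^sup>2"]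
    by (simp add: W.ip_def power2_eq_square mult_ac)
qed

text \<open>Subtracting \<open>cond S h\<close> makes \<open>cond (insert j S) h\<close> mean zero
  on each \<open>S\<close>-class, so the contraction applies class by class and then in expectation.
  By Pythagoras the subtraction does not increase the norm.\<close>

lemma pair_estimate:
  assumes S: "S \<subseteq> {..<d}" and ij: "i < d" "j < d" "i \<noteq> j" "i \<notin> S" "j \<notin> S"
    and eig: "\<And>s r. s \<in> faces X (card S) \<Longrightarrow>
      nontrivial_walk_eigenvalue (d - card S) (link X s) (link_wt X P s) r \<Longrightarrow> \<bar>r\<bar> \<le> c"
    and c: "0 \<le> c"
  shows "nrm (\<lambda>x. cond (insert i S) (cond (insert j S) h) x - cond S h x) \<le> c * nrm h"
proof -
  let ?g = "\<lambda>x. cond (insert j S) h x - cond S h x"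
  have mg: "meas (insert j S) ?g"
    by (intro meas_comb2[where F = "(-)"] meas_cond meas_mono[OF meas_cond]) auto
  have g0: "cond S ?g x = 0" if "x \<in> Om" for x
    using that by (simp add: cond_diff cond_cond cond_cond' subset_insertI)
  have gi: "cond (insert i S) ?g x = cond (insert i S) (cond (insert j S) h) x - cond S h x" if "x \<in> Om" for x
    using that by (simp add: cond_diff cond_cond' subset_insertI)
  have "cond S (\<lambda>y. (cond (insert i S) ?g y)\<^sup>2) x \<le> c\<^sup>2 * cond S (\<lambda>y. (?g y)\<^sup>2) x" if x: "x \<in> Om" for x
  proof -
    have "(\<Sum>y\<in>cls S x. mu y * (cond (insert i S) ?g y)\<^sup>2) \<le> c\<^sup>2 * (\<Sum>y\<in>cls S x. mu y * (?g y)\<^sup>2)"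
      using eig[OF Om_props(3)[OF x S]] Om_props(2)[OF x S]
      by (intro cls_cond_contracts[OF S ij x _ mg g0[OF x]]) auto
    then show ?thesis
      using sum_cls_pos[OF x, of S] by (simp add: cond_def divide_right_mono less_imp_le)
  qed
  then have "ex (cond S (\<lambda>y. (cond (insert i S) ?g y)\<^sup>2)) \<le> ex (\<lambda>x. c\<^sup>2 * cond S (\<lambda>y. (?g y)\<^sup>2) x)"
    by (rule ex_mono)
  then have "(nrm (cond (insert i S) ?g))\<^sup>2 \<le> (c * nrm ?g)\<^sup>2"
    by (simp only: ex_cond ex_cmult nrm_square power_mult_distrib)
  then have 1: "nrm (cond (insert i S) ?g) \<le> c * nrm ?g"
    by (rule power2_le_imp_le) (simp add: c)
  have "nrm (\<lambda>x. cond (insert i S) (cond (insert j S) h) x - cond S h x) = nrm (cond (insert i S) ?g)"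
    by (rule nrm_cong) (simp add: gi)
  also have "\<dots> \<le> c * nrm ?g" by (rule 1)
  also have "nrm ?g \<le> nrm h"
  proof (rule power2_le_imp_le)
    have "(nrm ?g)\<^sup>2 = ex (\<lambda>x. ((cond (insert j S) h x)\<^sup>2 - 2 * (cond S h x * cond (insert j S) h x)) + (cond S h x)\<^sup>2)"
      unfolding nrm_square by (rule ex_cong) (simp add: power2_diff)
    also have "\<dots> = ex (\<lambda>x. (cond (insert j S) h x)\<^sup>2) - 2 * ex (\<lambda>x. cond S h x * cond (insert j S) h x)
        + ex (\<lambda>x. (cond S h x)\<^sup>2)"
      by (simp only: ex_add ex_diff ex_cmult)
    also have "ex (\<lambda>x. cond S h x * cond (insert j S) h x) = ex (\<lambda>x. cond S h x * cond S h x)"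
      using ex_mult_cond[OF meas_mono[OF meas_cond subset_insertI], of S h j h] ex_cond_mult_cond[of S h h]
      by simp
    finally have "(nrm ?g)\<^sup>2 = (nrm (cond (insert j S) h))\<^sup>2 - (nrm (cond S h))\<^sup>2"
      unfolding nrm_square by (simp add: power2_eq_square)
    then have "(nrm ?g)\<^sup>2 \<le> (nrm (cond (insert j S) h))\<^sup>2" by simp
    also have "\<dots> \<le> (nrm h)\<^sup>2" by (intro power_mono nrm_cond_le) simp
    finally show "(nrm ?g)\<^sup>2 \<le> (nrm h)\<^sup>2" .
  qed simp
  finally show ?thesis using c by (simp add: mult_left_mono)
qed

end

section \<open>Low influence implies a dense link\<close>

lemma two_powr_minus_mult: "2 powr (- (real m * real k)) = 1 / (2 ^ k) ^ m"
proof -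
  have "(2::real) powr (real m * real k) = 2 powr real (k * m)" by (simp add: mult.commute)
  also have "\<dots> = 2 ^ (k * m)" by (rule powr_realpow) simp
  also have "\<dots> = (2 ^ k) ^ m" by (rule power_mult)
  finally show ?thesis by (simp add: powr_minus divide_inverse)
qed

locale expander_family = weighted_family d X P for d and X :: "'a set set" and P +
  fixes c :: real and k :: nat
  assumes k_le_d: "k \<le> d" and c_nonneg: "0 \<le> c"
    and eigenvalue_le: "\<And>i s r. i + 2 \<le> d \<Longrightarrow> s \<in> faces X i \<Longrightarrow>
      nontrivial_walk_eigenvalue (d - i) (link X s) (link_wt X P s) r \<Longrightarrow> \<bar>r\<bar> \<le> c"
begin

text \<open>Two distinct coordinates below \<open>k\<close> outside \<open>S\<close> force
  \<open>card S + 2 \<le> k \<le> d\<close>, so every link that occurs is covered by the expander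
  assumption.\<close>

sublocale approx_space Om mu "{..<k}" "(real k)\<^sup>2 * c"
proof
  show "sum mu Om = 1" by (rule sum_mu)
  show "0 \<le> (real k)\<^sup>2 * c" using c_nonneg by simp
  show "nrm (\<lambda>x. cond S (cond T h) x - cond (S \<inter> T) h x) \<le> (real k)\<^sup>2 * c * nrm h"
    if "S \<subseteq> {..<k}" "T \<subseteq> {..<k}" for S T h
  proof -
    have "nrm (\<lambda>x. cond S (cond T h) x - cond (S \<inter> T) h x) \<le> (real (card {..<k}))\<^sup>2 * c * nrm h"
    proof (rule approx_from_pairs[OF _ c_nonneg _ that])
      fix S i j h
      assume a: "S \<subseteq> {..<k}" "i \<in> {..<k} - S" "j \<in> {..<k} - S" "i \<noteq> j"
      have fS: "finite S" by (rule finite_subset[OF a(1)]) simp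
      have "card (insert i (insert j S)) \<le> card {..<k}"
        by (rule card_mono) (use a in auto)
      then have cS: "card S + 2 \<le> d" using a fS k_le_d by simp
      show "nrm (\<lambda>x. cond (insert i S) (cond (insert j S) h) x - cond S h x) \<le> c * nrm h"
        by (rule pair_estimate) (use a k_le_d eigenvalue_le[OF cS] c_nonneg in auto)
    qed simp
    then show ?thesis by simp
  qed
qed simp

definition lift :: "('a set \<Rightarrow> real) \<Rightarrow> (nat \<Rightarrow> 'a) \<Rightarrow> real" where
  "lift f x = f (x ` {..<k})"

lemma meas_lift: "meas {..<k} (lift f)"
  unfolding meas_def lift_def agree_def by (intro ballI impI arg_cong[where f = f] image_cong) auto

lemma mean_eq: "mean d X P k f = ex (lift f)"
  using mean_image[OF k_le_d, of f] by (simp add: lift_def[abs_def])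

lemma cond_lift: "A \<subseteq> {..<k} \<Longrightarrow> x \<in> Om \<Longrightarrow> cond A (lift f) x = link_mean d X P k f (x ` A)"
  using cond_image[OF _ k_le_d, of A x f] by (simp add: lift_def[abs_def])

lemma var_lift: "var d X P k f = ex (\<lambda>x. (lift f x)\<^sup>2) - (ex (lift f))\<^sup>2"
  using mean_eq[of f] mean_eq[of "\<lambda>x. (f x)\<^sup>2"] by (simp add: var_def lift_def[abs_def])

lemma image_in_faces: "x \<in> Om \<Longrightarrow> A \<subseteq> {..<k} \<Longrightarrow> x ` A \<in> faces X (card A)"
  by (rule Om_props(3)) (use k_le_d in auto)

text \<open>Injectivity of the tuple makes the facets correspond to the positions that are
  deleted.\<close>

lemma sum_facets:
  assumes "0 < k" "x \<in> Om"
  shows "(\<Sum>t | t \<in> faces X (k - 1) \<and> t \<subset> x ` {..<k}. F t) = (\<Sum>i<k. F (x ` ({..<k} - {i})))"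
proof -
  have inj: "inj_on x {..<k}" using Om_props(1)[OF assms(2), of "{..<k}"] k_le_d by simp
  have inj': "inj_on (\<lambda>i. x ` ({..<k} - {i})) {..<k}"
  proof (rule inj_onI)
    fix i j assume ij: "i \<in> {..<k}" "j \<in> {..<k}" "x ` ({..<k} - {i}) = x ` ({..<k} - {j})"
    then have "{..<k} - {i} = {..<k} - {j}"
      using inj_on_image_eq_iff[OF inj Diff_subset Diff_subset, of "{i}" "{j}"] by simp
    with ij(1,2) show "i = j" by auto
  qed
  have "{t. t \<in> faces X (k - 1) \<and> t \<subset> x ` {..<k}} = (\<lambda>i. x ` ({..<k} - {i})) ` {..<k}"
  proof (intro equalityI subsetI)
    fix t assume t: "t \<in> {t. t \<in> faces X (k - 1) \<and> t \<subset> x ` {..<k}}"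
    then have ct: "finite t" "card t = k - 1" "t \<subseteq> x ` {..<k}" by (auto simp: faces_def)
    then have "card (x ` {..<k} - t) = 1"
      using assms inj by (simp add: card_Diff_subset card_image)
    then obtain v where v: "x ` {..<k} - t = {v}" by (auto simp: card_1_singleton_iff)
    then obtain i where i: "i < k" "v = x i" by blast
    have "t = x ` {..<k} - {v}" using v ct(3) by blast
    also have "\<dots> = x ` ({..<k} - {i})"
      using inj_on_image_set_diff[OF inj, of "{..<k}" "{i}"] i by simp
    finally show "t \<in> (\<lambda>i. x ` ({..<k} - {i})) ` {..<k}" using i by blast
  next
    fix t assume "t \<in> (\<lambda>i. x ` ({..<k} - {i})) ` {..<k}"
    then obtain i where i: "i < k" "t = x ` ({..<k} - {i})" by blast
    then have "t = x ` {..<k} - {x i}" using inj_on_image_set_diff[OF inj, of "{..<k}" "{i}"] by simp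
    then have "t \<subset> x ` {..<k}" using i by auto
    moreover have "t \<in> faces X (k - 1)" using image_in_faces[OF assms(2), of "{..<k} - {i}"] i by simp
    ultimately show "t \<in> {t. t \<in> faces X (k - 1) \<and> t \<subset> x ` {..<k}}" by simp
  qed
  then show ?thesis using inj' by (simp add: sum.reindex)
qed

text \<open>The factor \<open>k\<close> cancels the normalization of \<open>up_op\<close>, leaving
  the sum of the projections that forget one coordinate; self-adjointness turns their product with
  \<open>f\<close> into their squares.\<close>

lemma total_influence_eq:
  assumes "0 < k"
  shows "total_influence d X P k f = infl (lift f)"
proof -
  let ?U = "up_op X (k - 1) (down_op d X P k f)"
  have "total_influence d X P k f = ex (\<lambda>x. lift f x * (real k * (lift f x - ?U (x ` {..<k}))))"
    unfolding total_influence_def inner_lvl_def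
    using mean_eq[of "\<lambda>s. f s * (real k * (f s - ?U s))"] by (simp add: mean_def lift_def[abs_def])
  also have "\<dots> = ex (\<lambda>x. \<Sum>i<k. (lift f x)\<^sup>2 - cond ({..<k} - {i}) (lift f) x * lift f x)"
  proof (rule ex_cong)
    fix x assume x: "x \<in> Om"
    have "real k * ?U (x ` {..<k}) = (\<Sum>i<k. link_mean d X P k f (x ` ({..<k} - {i})))"
      using assms sum_facets[OF assms x, of "link_mean d X P k f"] by (simp add: up_op_def down_op_def)
    also have "\<dots> = (\<Sum>i<k. cond ({..<k} - {i}) (lift f) x)"
      by (rule sum.cong) (simp_all add: cond_lift x)
    finally have "real k * ?U (x ` {..<k}) = (\<Sum>i<k. cond ({..<k} - {i}) (lift f) x)" .
    then show "lift f x * (real k * (lift f x - ?U (x ` {..<k})))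
      = (\<Sum>i<k. (lift f x)\<^sup>2 - cond ({..<k} - {i}) (lift f) x * lift f x)"
      by (simp add: right_diff_distrib sum_subtractf sum_distrib_left power2_eq_square mult_ac)
  qed
  also have "\<dots> = infl (lift f)"
    unfolding infl_def ex_sum ex_diff by (simp add: power2_eq_square ex_cond_mult_cond)
  finally show ?thesis .
qed

text \<open>42 = 40 + 2: \<open>dense_restriction\<close> asks for
  \<open>del * M ^ 40 \<le> 1\<close> with \<open>M = 2 ^ k\<close>, and
  \<open>del = k ^ 2 * c\<close> costs another \<open>M ^ 2\<close>.\<close>

theorem dense_link:
  assumes f: "\<And>s. s \<in> faces X k \<Longrightarrow> f s \<in> {0, 1}" and "mean d X P k f \<noteq> 0" and "K \<le> k"
    and infl: "total_influence d X P k f \<le> real K * var d X P k f"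
    and c: "c \<le> 2 powr (- (42 * real k))"
  shows "\<exists>i\<le>K. \<exists>t\<in>faces X i. link_mean d X P k f t \<ge> 2 powr (- (30 * real K))"
proof -
  let ?f = "lift f"
  have f01: "?f x \<in> {0, 1}" if "x \<in> Om" for x
    unfolding lift_def by (rule f) (use image_in_faces[OF that, of "{..<k}"] in simp)
  have M: "M = 2 ^ k" by (simp add: M_def)
  have sq: "ex (\<lambda>x. (?f x)\<^sup>2) = ex ?f"
    by (rule ex_cong) (use f01 in fastforce)
  have p: "ex ?f \<noteq> 0" using assms(2) by (simp add: mean_eq)
  have small: "(real k)\<^sup>2 * c * M ^ 40 \<le> 1"
  proof -
    have "real k \<le> 2 ^ k" by (simp add: of_nat_less_two_power less_imp_le)
    then have "(real k)\<^sup>2 \<le> (2 ^ k)\<^sup>2" by (rule power_mono) simp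
    moreover have "c \<le> 1 / (2 ^ k) ^ 42"
      using c two_powr_minus_mult[of 42 k] by simp
    ultimately have "(real k)\<^sup>2 * c * M ^ 40 \<le> (2 ^ k)\<^sup>2 * (1 / (2 ^ k) ^ 42) * M ^ 40"
      using c_nonneg by (intro mult_right_mono mult_mono) auto
    also have "\<dots> = 1" by (simp add: M flip: power_add)
    finally show ?thesis .
  qed
  have "Om \<noteq> {}" using sum_mu by auto
  then obtain x where x: "x \<in> Om" by blast
  show ?thesis
  proof (cases "K = 0")
    \<comment> \<open>Only the empty face is available, so the mean itself has to be 1: vanishing
      variance gives \<open>p = p ^ 2\<close> for the nonzero mean \<open>p\<close>. For
      \<open>k = 0\<close> this holds because \<open>f\<close> lives on the empty face
      alone.\<close>
    case True
    have "ex ?f = (ex ?f)\<^sup>2"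
    proof (cases "k = 0")
      case True
      then have "cond {} ?f x = ?f x" using cond_id[OF meas_lift x] by simp
      then show ?thesis using f01[OF x] by (auto simp: cond_empty)
    next
      case False
      have "infl ?f \<le> 0" using infl True total_influence_eq[of f] False by simp
      from variance_eq_0_if_influence_le_0[OF meas_lift small _ this] False sq
      show ?thesis by auto
    qed
    then have "ex ?f = 1" using p by (simp add: power2_eq_square)
    then have "link_mean d X P k f {} = 1"
      using cond_lift[of "{}" x f] x by (simp add: cond_empty)
    moreover have "{} \<in> faces X 0" using image_in_faces[OF x, of "{}"] by simp
    ultimately show ?thesis using True by (intro exI[of _ 0] conjI bexI[of _ "{}"]) auto
  next
    case False
    then have k: "0 < k" using assms(3) by simp
    have "infl ?f \<le> real K * (ex ?f - (ex ?f)\<^sup>2)"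
      using infl by (simp add: total_influence_eq[OF k] var_lift sq)
    then obtain A y where A: "A \<in> low K" "y \<in> Om" "cond A ?f y > 1 / (2 ^ K) ^ 30"
      using dense_restriction[where f = ?f and K = K, OF f01 meas_lift _ _ _ p small] False assms(3) by auto
    then have "A \<subseteq> {..<k}" "card A \<le> K" by (auto simp: low_def)
    moreover have "2 powr (- (30 * real K)) = 1 / (2 ^ K) ^ 30"
      using two_powr_minus_mult[of 30 K] by simp
    ultimately show ?thesis
      using A cond_lift[of A y f] image_in_faces[of y A]
      by (intro exI[of _ "card A"] conjI bexI[of _ "y ` A"]) auto
  qed
qed

end

text \<open>A nonzero mean is demanded because for \<open>f = 0\<close> influence and variance both
  vanish, yet no link mean is positive.\<close>

theorem mainTheorem4:
  shows "\<exists>c C :: real. c > 0 \<and> C > 0 \<and>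
    (\<forall>(n::nat) (d::nat) (X :: nat set set) (P :: nat set \<Rightarrow> real) (\<gamma>::real)
       (k::nat) (f :: nat set \<Rightarrow> real) (K::nat).
      weighted_complex n d X P \<longrightarrow>
      two_sided_local_spectral_expander d X P \<gamma> \<longrightarrow>
      k \<le> d \<longrightarrow>
      \<gamma> \<le> 2 powr (- (c * real k)) \<longrightarrow>
      (\<forall>\<sigma>\<in>faces X k. f \<sigma> \<in> {0, 1}) \<longrightarrow>
      mean d X P k f \<noteq> 0 \<longrightarrow>
      K \<le> k \<longrightarrow>
      total_influence d X P k f \<le> real K * var d X P k f \<longrightarrow>
      (\<exists>i\<le>K. \<exists>\<tau>\<in>faces X i. link_mean d X P k f \<tau> \<ge> 2 powr (- (C * real K))))"
proof (rule exI[of _ 42], rule exI[of _ 30], intro conjI allI impI)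
  fix n d :: nat and X :: "nat set set" and P :: "nat set \<Rightarrow> real" and \<gamma> :: real
    and k :: nat and f :: "nat set \<Rightarrow> real" and K :: nat
  assume wc: "weighted_complex n d X P" and exp: "two_sided_local_spectral_expander d X P \<gamma>"
    and kd: "k \<le> d" and \<gamma>: "\<gamma> \<le> 2 powr (- (42 * real k))"
    and f: "\<forall>\<sigma>\<in>faces X k. f \<sigma> \<in> {0, 1}" and mean: "mean d X P k f \<noteq> 0" and K: "K \<le> k"
    and infl: "total_influence d X P k f \<le> real K * var d X P k f"
  have X: "t \<subseteq> {1..n}" "card t = d" if "t \<in> X" for t
    using wc that by (auto simp: weighted_complex_def pure_complex_def)
  \<comment> \<open>A negative gamma can occur if there are no nontrivial eigenvalues at all; then 0
    is an equally good bound, and it satisfies the smallness condition.\<close>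
  interpret expander_family d X P "max \<gamma> 0" k
  proof
    show "finite X" by (rule finite_subset[of _ "Pow {1..n}"]) (use X in auto)
    show "finite t" "card t = d" if "t \<in> X" for t
      using X[OF that] finite_subset by auto
    show "0 \<le> P t" if "t \<in> X" for t
      using wc that by (simp add: weighted_complex_def distribution_on_def)
    show "sum P X = 1" using wc by (simp add: weighted_complex_def distribution_on_def)
    show "\<bar>r\<bar> \<le> max \<gamma> 0"
      if "i + 2 \<le> d" "s \<in> faces X i" "nontrivial_walk_eigenvalue (d - i) (link X s) (link_wt X P s) r" for i s r
      using exp that unfolding two_sided_local_spectral_expander_def by (meson max.coboundedI1)
  qed (use kd in auto)
  show "\<exists>i\<le>K. \<exists>\<tau>\<in>faces X i. link_mean d X P k f \<tau> \<ge> 2 powr (- (30 * real K))"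
    by (rule dense_link[OF _ mean K infl]) (use f \<gamma> in auto)
qed simp_all

end
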